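(* Let $p$ be a prime and let $m,n\ge 1$ be integers. For every $\tau>(m+n)/m$, there exists a Borel probability measure $\mu$ supported on $W(m,n,\tau)$ such that $$|\widehat{\mu}(\xi)|\lesssim |\xi|_p^{-n/\tau}\,\ln^{n+1}(1+|\xi|_p)\qquad\text{for all }\xi\in\mathbb{Q}_p^{mn},\ \xi\neq 0 .$$
   Context: $X\lesssim Y$ means $X\le CY$ for some positive constant $C$ whose value may depend on $p$, but not on any other parameters. $|\cdot|_p$ is the $p$-adic absolute value on $\mathbb{Q}_p$ (normalized by $|p|_p=p^{-1}$); for $x\in\mathbb{Q}_p^d$, $|x|_p=\max_i|x_i|_p$; $\mathbb{Z}_p=\{x\in\mathbb{Q}_p:|x|_p\le1\}$. For real or integer vectors, $|x|=\max_i|x_i|$. An $m\times n$ matrix with entries $x_{ij}$ is identified with the point $x=(x_{11},\dots,x_{1n},\dots,x_{m1},\dots,x_{mn})$, and for $q\in\mathbb{Z}^n$ the product $xq$ is the matrix-vector product, an element of $\mathbb{Q}_p^m$. For $\tau\in\mathbb{R}$, $$W(m,n,\tau)=\{x\in\mathbb{Z}_p^{mn}: |xq-r|_p\le\max(|q|,|r|)^{-\tau}\text{ for infinitely many }(q,r)\in\mathbb{Z}^n\times\mathbb{Z}^m\}.$$ For $x\in\mathbb{Q}_p$ with $p$-adic expansion $x=\sum_{j\ge M}c_jp^j$, $c_j\in\{0,\dots,p-1\}$, $\{x\}_p=\sum_{M\le j\le -1}c_jp^j$, and $e(t)=e^{2\pi i t}$. For a finite Borel measure $\mu$ on $\mathbb{Q}_p^{d}$,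 $\widehat\mu(\xi)=\int_{\mathbb{Q}_p^{d}}e(\{x\cdot\xi\}_p)\,d\mu(x)$, where $x\cdot\xi=\sum_i x_i\xi_i$. A measure is supported on $A$ if its (closed) support is contained in $A$. $\ln^{n+1}(t)$ means $(\ln t)^{n+1}$.
   Formalization: The bound is proved for all ξ with |ξ|_p > 1 instead of all ξ ≠ 0: for |ξ|_p ≤ 1 the transform equals 1, while the right-hand side tends to 0 as ξ → 0 (and, at |ξ|_p = 1, as n → ∞ with a constant depending only on p), so the stated range is false. *)

theory Defs
  imports "HOL-Probability.Probability" "Berlekamp_Zassenhaus.Finite_Field"
begin

section \<open>The \<open>p\<close>-adic absolute value on the rationals\<close>

definition padic_abs :: "nat \<Rightarrow> rat \<Rightarrow> real" where
  "padic_abs p r =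
     (if r = 0 then 0
      else (let (a, b) = quotient_of r
            in real p powi (int (multiplicity (int p) b) - int (multiplicity (int p) a))))"

lemma padic_abs_0 [simp]: "padic_abs p 0 = 0"
  by (simp add: padic_abs_def)

lemma padic_abs_divide:
  assumes "prime p" "a \<noteq> 0" "b \<noteq> 0"
  shows "padic_abs p (of_int a / of_int b) =
    real p powi (int (multiplicity (int p) b) - int (multiplicity (int p) a))"
proof -
  define r :: rat where "r = of_int a / of_int b"
  obtain c d where q: "quotient_of r = (c, d)" by (cases "quotient_of r")
  have d: "d > 0" using q by (rule quotient_of_denom_pos)
  have r: "r = of_int c / of_int d" using q by (rule quotient_of_div)
  have "r \<noteq> 0" using assms by (simp add: r_def)
  hence c: "c \<noteq> 0" using r by auto
  have "(of_int (a * d) :: rat) = of_int (c * b)"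
    using r r_def d assms by (simp add: field_simps)
  hence eq: "a * d = c * b" by (simp only: of_int_eq_iff)
  have P: "prime_elem (int p)" using assms by simp
  have "multiplicity (int p) a + multiplicity (int p) d = multiplicity (int p) c + multiplicity (int p) b"
    using prime_elem_multiplicity_mult_distrib[OF P, of a d]
      prime_elem_multiplicity_mult_distrib[OF P, of c b] eq c d assms by simp
  hence "int (multiplicity (int p) d) - int (multiplicity (int p) c) =
    int (multiplicity (int p) b) - int (multiplicity (int p) a)" by linarith
  thus ?thesis using \<open>r \<noteq> 0\<close> q by (simp add: padic_abs_def flip: r_def)
qed

lemma rat_int_divide: obtains a b :: int where "b \<noteq> 0" "(r::rat) = of_int a / of_int b"
proof -
  obtain a b where q: "quotient_of r = (a, b)" by (cases "quotient_of r")
  show thesis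
    using that[of b a] quotient_of_denom_pos[OF q] quotient_of_div[OF q] by simp
qed

lemma padic_abs_nonneg [simp]: "padic_abs p r \<ge> 0"
  by (auto simp: padic_abs_def split: prod.splits)

lemma padic_abs_eq_0: "prime p \<Longrightarrow> padic_abs p r = 0 \<longleftrightarrow> r = 0"
  by (auto simp: padic_abs_def split: prod.splits dest: prime_gt_0_nat)

lemma padic_abs_1: "prime p \<Longrightarrow> padic_abs p 1 = 1"
  using padic_abs_divide[of p 1 1] by simp

lemma padic_abs_minus [simp]: "padic_abs p (- r) = padic_abs p r"
proof -
  have "multiplicity (int p) (- a) = multiplicity (int p) a" for a
    by (simp add: multiplicity_def)
  thus ?thesis by (auto simp: padic_abs_def rat_uminus_code split: prod.splits)
qed

lemma padic_abs_minus_commute: "padic_abs p (r - s) = padic_abs p (s - r)"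
  using padic_abs_minus[of p "r - s"] by simp

lemma padic_abs_mult:
  assumes p: "prime p"
  shows "padic_abs p (r * s) = padic_abs p r * padic_abs p s"
proof (cases "r = 0 \<or> s = 0")
  case True
  thus ?thesis
    by (elim disjE) (simp_all only: padic_abs_0 mult_zero_left mult_zero_right)
next
  case False
  obtain a b where ab: "b \<noteq> 0" "r = of_int a / of_int b" by (rule rat_int_divide)
  obtain c d where cd: "d \<noteq> 0" "s = of_int c / of_int d" by (rule rat_int_divide)
  have nz: "a \<noteq> 0" "c \<noteq> 0" using False ab cd by auto
  have P: "prime_elem (int p)" using assms by simp
  have bd: "a * c \<noteq> 0" "b * d \<noteq> 0" using nz ab(1) cd(1) by simp_all
  have rs: "r * s = of_int (a * c) / of_int (b * d)" by (simp add: ab(2) cd(2))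
  have r': "padic_abs p r = real p powi (int (multiplicity (int p) b) - int (multiplicity (int p) a))"
    unfolding ab(2) by (rule padic_abs_divide[OF p nz(1) ab(1)])
  have s': "padic_abs p s = real p powi (int (multiplicity (int p) d) - int (multiplicity (int p) c))"
    unfolding cd(2) by (rule padic_abs_divide[OF p nz(2) cd(1)])
  have p0: "real p \<noteq> 0" using prime_gt_0_nat[OF p] by simp
  have e: "int (multiplicity (int p) (b * d)) - int (multiplicity (int p) (a * c)) =
      (int (multiplicity (int p) b) - int (multiplicity (int p) a)) +
      (int (multiplicity (int p) d) - int (multiplicity (int p) c))"
    using prime_elem_multiplicity_mult_distrib[OF P nz]
      prime_elem_multiplicity_mult_distrib[OF P ab(1) cd(1)] by simp
  have "padic_abs p (r * s) =
      real p powi (int (multiplicity (int p) (b * d)) - int (multiplicity (int p) (a * c)))"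
    unfolding rs by (rule padic_abs_divide[OF p bd])
  also have "\<dots> = padic_abs p r * padic_abs p s"
    unfolding e r' s' by (rule power_int_add[OF disjI1[OF p0]])
  finally show ?thesis .
qed

lemma padic_abs_inverse:
  assumes p: "prime p"
  shows "padic_abs p (inverse r) = inverse (padic_abs p r)"
proof (cases "r = 0")
  case False
  hence "padic_abs p r * padic_abs p (inverse r) = 1"
    using padic_abs_mult[OF p, of r "inverse r"] padic_abs_1[OF p] by simp
  thus ?thesis by (rule inverse_unique[symmetric])
qed simp

lemma padic_abs_add_le_max:
  assumes p: "prime p"
  shows "padic_abs p (r + s) \<le> max (padic_abs p r) (padic_abs p s)"
proof (cases "r = 0 \<or> s = 0 \<or> r + s = 0")
  case True
  thus ?thesis by (auto simp: max_def)
next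
  case False
  obtain a b where ab: "b \<noteq> 0" "r = of_int a / of_int b" by (rule rat_int_divide)
  obtain c d where cd: "d \<noteq> 0" "s = of_int c / of_int d" by (rule rat_int_divide)
  define u v w where "u = a * d" and "v = c * b" and "w = b * d"
  have w: "w \<noteq> 0" using ab cd by (simp add: w_def)
  have r: "r = of_int u / of_int w" and s: "s = of_int v / of_int w"
    using ab cd by (simp_all add: u_def v_def w_def)
  have rs: "r + s = of_int (u + v) / of_int w" by (simp add: r s add_divide_distrib)
  have nz: "u \<noteq> 0" "v \<noteq> 0" "u + v \<noteq> 0"
    using False r s rs by fastforce+
  define k where "k = min (multiplicity (int p) u) (multiplicity (int p) v)"
  have "int p ^ k dvd u + v"
    by (intro dvd_add multiplicity_dvd') (auto simp: k_def)
  moreover have "\<not> is_unit (int p)"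
    using p not_prime_unit prime_nat_int_transfer by blast
  ultimately have k: "k \<le> multiplicity (int p) (u + v)"
    using nz by (intro multiplicity_geI) auto
  have le: "real p powi (int (multiplicity (int p) w) - int (multiplicity (int p) (u + v)))
     \<le> real p powi (int (multiplicity (int p) w) - int k)"
    using k prime_gt_0_nat[OF p] by (intro power_int_increasing) auto
  have "k = multiplicity (int p) u \<or> k = multiplicity (int p) v"
    by (auto simp: k_def)
  thus ?thesis
    using le padic_abs_divide[OF p nz(3) w, folded rs] padic_abs_divide[OF p nz(1) w, folded r]
      padic_abs_divide[OF p nz(2) w, folded s]
    by auto
qed

lemma padic_abs_triangle: "prime p \<Longrightarrow> padic_abs p (r + s) \<le> padic_abs p r + padic_abs p s"
  using padic_abs_add_le_max[of p r s] padic_abs_nonneg[of p r] padic_abs_nonneg[of p s]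
  by linarith

lemma padic_abs_triangle_rev:
  "prime p \<Longrightarrow> \<bar>padic_abs p r - padic_abs p s\<bar> \<le> padic_abs p (r - s)"
  using padic_abs_triangle[of p "r - s" s] padic_abs_triangle[of p "s - r" r]
  by (simp add: padic_abs_minus_commute[of p s r])


section \<open>The field of \<open>p\<close>-adic numbers\<close>

text \<open>
  The prime is carried by the type: it is the cardinality of the type argument, as for
  \<^typ>\<open>'p mod_ring\<close>.
\<close>

definition padic_cauchy :: "nat \<Rightarrow> (nat \<Rightarrow> rat) \<Rightarrow> bool" where
  "padic_cauchy p X \<longleftrightarrow> (\<forall>e>0. \<exists>N. \<forall>m\<ge>N. \<forall>n\<ge>N. padic_abs p (X m - X n) < e)"

definition padic_null :: "nat \<Rightarrow> (nat \<Rightarrow> rat) \<Rightarrow> bool" where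
  "padic_null p X \<longleftrightarrow> (\<lambda>n. padic_abs p (X n)) \<longlonglongrightarrow> 0"

context
  fixes p :: nat
  assumes p: "prime p"
begin

lemma padic_null_le:
  assumes "padic_null p X" "\<And>n. padic_abs p (Y n) \<le> B * padic_abs p (X n)"
  shows "padic_null p Y"
proof -
  have "(\<lambda>n. B * padic_abs p (X n)) \<longlonglongrightarrow> 0"
    using tendsto_mult_right_zero assms(1) unfolding padic_null_def by blast
  thus ?thesis unfolding padic_null_def
    by (rule Lim_null_comparison[rotated]) (simp add: assms)
qed

lemma padic_null_minus: "padic_null p X \<Longrightarrow> padic_null p (\<lambda>n. - X n)"
  by (simp add: padic_null_def)

lemma padic_null_add:
  assumes "padic_null p X" "padic_null p Y"
  shows "padic_null p (\<lambda>n. X n + Y n)"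
  unfolding padic_null_def
proof (rule Lim_null_comparison)
  show "(\<lambda>n. padic_abs p (X n) + padic_abs p (Y n)) \<longlonglongrightarrow> 0"
    using tendsto_add[OF assms[unfolded padic_null_def]] by simp
qed (simp add: padic_abs_triangle[OF p])

lemma padic_cauchy_const: "padic_cauchy p (\<lambda>n. c)"
  by (simp add: padic_cauchy_def)

lemma padic_cauchy_add:
  assumes X: "padic_cauchy p X" and Y: "padic_cauchy p Y"
  shows "padic_cauchy p (\<lambda>n. X n + Y n)"
  unfolding padic_cauchy_def
proof (intro allI impI)
  fix e :: real assume e: "e > 0"
  obtain M where M: "\<And>m n. m \<ge> M \<Longrightarrow> n \<ge> M \<Longrightarrow> padic_abs p (X m - X n) < e"
    using X e unfolding padic_cauchy_def by meson
  obtain N where N: "\<And>m n. m \<ge> N \<Longrightarrow> n \<ge> N \<Longrightarrow> padic_abs p (Y m - Y n) < e"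
    using Y e unfolding padic_cauchy_def by meson
  show "\<exists>N. \<forall>m\<ge>N. \<forall>n\<ge>N. padic_abs p (X m + Y m - (X n + Y n)) < e"
  proof (intro exI allI impI)
    fix m n assume "max M N \<le> m" "max M N \<le> n"
    thus "padic_abs p (X m + Y m - (X n + Y n)) < e"
      using padic_abs_add_le_max[OF p, of "X m - X n" "Y m - Y n"] M[of m n] N[of m n]
      by (simp add: add_diff_add)
  qed
qed

lemma padic_cauchy_minus: "padic_cauchy p X \<Longrightarrow> padic_cauchy p (\<lambda>n. - X n)"
  unfolding padic_cauchy_def minus_diff_minus padic_abs_minus .

lemma padic_cauchy_imp_Cauchy: "padic_cauchy p X \<Longrightarrow> Cauchy (\<lambda>n. padic_abs p (X n))"
  unfolding padic_cauchy_def Cauchy_def dist_real_def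
  by (meson padic_abs_triangle_rev[OF p] le_less_trans)

lemma padic_cauchy_bounded:
  assumes "padic_cauchy p X"
  obtains B where "B > 0" "\<And>n. padic_abs p (X n) \<le> B"
proof -
  obtain B where "B > 0" "\<And>n. norm (padic_abs p (X n)) \<le> B"
    using Cauchy_Bseq[OF padic_cauchy_imp_Cauchy[OF assms]] unfolding Bseq_def by blast
  thus thesis using that[of B] by simp
qed

lemma padic_cauchy_mult:
  assumes X: "padic_cauchy p X" and Y: "padic_cauchy p Y"
  shows "padic_cauchy p (\<lambda>n. X n * Y n)"
  unfolding padic_cauchy_def
proof (intro allI impI)
  fix e :: real assume e: "e > 0"
  obtain A where A: "A > 0" "\<And>n. padic_abs p (X n) \<le> A" using X by (rule padic_cauchy_bounded) blast
  obtain B where B: "B > 0" "\<And>n. padic_abs p (Y n) \<le> B" using Y by (rule padic_cauchy_bounded) blast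
  obtain M where M: "\<And>m n. m \<ge> M \<Longrightarrow> n \<ge> M \<Longrightarrow> padic_abs p (X m - X n) < e / B"
    using X e B unfolding padic_cauchy_def by (meson divide_pos_pos)
  obtain N where N: "\<And>m n. m \<ge> N \<Longrightarrow> n \<ge> N \<Longrightarrow> padic_abs p (Y m - Y n) < e / A"
    using Y e A unfolding padic_cauchy_def by (meson divide_pos_pos)
  show "\<exists>N. \<forall>m\<ge>N. \<forall>n\<ge>N. padic_abs p (X m * Y m - X n * Y n) < e"
  proof (intro exI allI impI)
    fix m n assume mn: "max M N \<le> m" "max M N \<le> n"
    have "padic_abs p (X m * (Y m - Y n)) \<le> A * padic_abs p (Y m - Y n)"
      using A by (simp add: padic_abs_mult[OF p] mult_right_mono)
    also have "\<dots> < e" using N[of m n] mn A by (simp add: field_simps)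
    finally have 1: "padic_abs p (X m * (Y m - Y n)) < e" .
    have "padic_abs p ((X m - X n) * Y n) \<le> padic_abs p (X m - X n) * B"
      using B by (simp add: padic_abs_mult[OF p] mult_left_mono)
    also have "\<dots> < e" using M[of m n] mn B by (simp add: field_simps)
    finally have 2: "padic_abs p ((X m - X n) * Y n) < e" .
    show "padic_abs p (X m * Y m - X n * Y n) < e"
      using padic_abs_add_le_max[OF p, of "X m * (Y m - Y n)" "(X m - X n) * Y n"] 1 2
      by (simp add: mult_diff_mult)
  qed
qed

lemma padic_null_mult:
  assumes "padic_cauchy p X" "padic_null p Y"
  shows "padic_null p (\<lambda>n. X n * Y n)"
proof -
  obtain B where "B > 0" "\<And>n. padic_abs p (X n) \<le> B"
    using assms(1) by (rule padic_cauchy_bounded) blast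
  thus ?thesis
    by (intro padic_null_le[OF assms(2), where B = B])
      (auto simp: padic_abs_mult[OF p] intro: mult_right_mono)
qed

lemma padic_not_null_bound:
  assumes X: "padic_cauchy p X" and nz: "\<not> padic_null p X"
  obtains b N where "b > 0" "\<And>n. n \<ge> N \<Longrightarrow> padic_abs p (X n) > b"
proof -
  obtain L where L: "(\<lambda>n. padic_abs p (X n)) \<longlonglongrightarrow> L"
    using padic_cauchy_imp_Cauchy[OF X] Cauchy_convergent_iff convergent_def by blast
  have "L \<ge> 0" by (rule LIMSEQ_le_const[OF L]) simp
  moreover have "L \<noteq> 0" using L nz by (auto simp: padic_null_def)
  ultimately have "L / 2 > 0" "L / 2 < L" by simp_all
  with order_tendstoD(1)[OF L] show thesis
    using that unfolding eventually_sequentially by metis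
qed

lemma padic_cauchy_inverse:
  assumes X: "padic_cauchy p X" and nz: "\<not> padic_null p X"
  shows "padic_cauchy p (\<lambda>n. inverse (X n))"
  unfolding padic_cauchy_def
proof (intro allI impI)
  fix e :: real assume e: "e > 0"
  obtain b M where b: "b > 0" "\<And>n. n \<ge> M \<Longrightarrow> padic_abs p (X n) > b"
    using X nz by (rule padic_not_null_bound) blast
  have "e * (b * b) > 0" using e b by simp
  then obtain N where N: "\<And>m n. m \<ge> N \<Longrightarrow> n \<ge> N \<Longrightarrow> padic_abs p (X m - X n) < e * (b * b)"
    using X unfolding padic_cauchy_def by meson
  show "\<exists>N. \<forall>m\<ge>N. \<forall>n\<ge>N. padic_abs p (inverse (X m) - inverse (X n)) < e"
  proof (intro exI allI impI)
    fix m n assume mn: "max M N \<le> m" "max M N \<le> n"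
    have bm: "padic_abs p (X m) > b" and bn: "padic_abs p (X n) > b" using b mn by auto
    have nz: "X m \<noteq> 0" "X n \<noteq> 0" using bm bn b(1) by auto
    have "padic_abs p (inverse (X m) - inverse (X n)) =
        padic_abs p (X m - X n) / (padic_abs p (X m) * padic_abs p (X n))"
      unfolding inverse_diff_inverse[OF nz] padic_abs_minus padic_abs_mult[OF p] padic_abs_inverse[OF p]
      by (simp add: divide_simps)
    also have "\<dots> \<le> padic_abs p (X m - X n) / (b * b)"
      using bm bn b(1) by (intro divide_left_mono mult_mono mult_pos_pos) auto
    also have "\<dots> < e" using N[of m n] mn b(1) by (simp add: field_simps)
    finally show "padic_abs p (inverse (X m) - inverse (X n)) < e" .
  qed
qed

lemma padic_cauchy_diff:
  "padic_cauchy p X \<Longrightarrow> padic_cauchy p Y \<Longrightarrow> padic_cauchy p (\<lambda>n. X n - Y n)"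
  using padic_cauchy_add[OF _ padic_cauchy_minus, of X Y] by simp

lemma padic_abs_lim_eq:
  assumes "padic_cauchy p X" "padic_null p (\<lambda>n. X n - Y n)"
  shows "lim (\<lambda>n. padic_abs p (X n)) = lim (\<lambda>n. padic_abs p (Y n))"
proof -
  obtain L where L: "(\<lambda>n. padic_abs p (X n)) \<longlonglongrightarrow> L"
    using assms padic_cauchy_imp_Cauchy Cauchy_convergent_iff convergent_def by metis
  have "(\<lambda>n. padic_abs p (X n) - padic_abs p (Y n)) \<longlonglongrightarrow> 0"
  proof (rule Lim_null_comparison)
    show "(\<lambda>n. padic_abs p (X n - Y n)) \<longlonglongrightarrow> 0"
      using assms by (simp add: padic_null_def)
  qed (simp add: padic_abs_triangle_rev[OF p])
  hence "(\<lambda>n. padic_abs p (Y n)) \<longlonglongrightarrow> L"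
    using tendsto_diff[OF L] by fastforce
  thus ?thesis using L by (simp add: limI)
qed

lemma padic_cauchy_abs_lim:
  assumes "padic_cauchy p X"
  shows "(\<lambda>n. padic_abs p (X n)) \<longlonglongrightarrow> lim (\<lambda>n. padic_abs p (X n))"
  using padic_cauchy_imp_Cauchy[OF assms] Cauchy_convergent_iff convergent_LIMSEQ_iff by blast

end

typedef 'p padic_seq = "{X. padic_cauchy CARD('p::prime_card) X}"
  using padic_cauchy_const[OF prime_card] by blast

setup_lifting type_definition_padic_seq

instantiation padic_seq :: (prime_card) comm_ring_1
begin

lift_definition zero_padic_seq :: "'a padic_seq" is "\<lambda>n. 0"
  by (rule padic_cauchy_const[OF prime_card])

lift_definition one_padic_seq :: "'a padic_seq" is "\<lambda>n. 1"
  by (rule padic_cauchy_const[OF prime_card])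

lift_definition plus_padic_seq :: "'a padic_seq \<Rightarrow> 'a padic_seq \<Rightarrow> 'a padic_seq"
  is "\<lambda>X Y n. X n + Y n" by (rule padic_cauchy_add[OF prime_card])

lift_definition uminus_padic_seq :: "'a padic_seq \<Rightarrow> 'a padic_seq"
  is "\<lambda>X n. - X n" by (rule padic_cauchy_minus[OF prime_card])

lift_definition minus_padic_seq :: "'a padic_seq \<Rightarrow> 'a padic_seq \<Rightarrow> 'a padic_seq"
  is "\<lambda>X Y n. X n - Y n" by (rule padic_cauchy_diff[OF prime_card])

lift_definition times_padic_seq :: "'a padic_seq \<Rightarrow> 'a padic_seq \<Rightarrow> 'a padic_seq"
  is "\<lambda>X Y n. X n * Y n" by (rule padic_cauchy_mult[OF prime_card])

instance
  by standard (transfer; simp add: algebra_simps fun_eq_iff)+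

end

lift_definition padic_seq_null :: "'p::prime_card padic_seq \<Rightarrow> bool" is "padic_null CARD('p)" .

lift_definition padic_seq_abs :: "'p::prime_card padic_seq \<Rightarrow> real"
  is "\<lambda>X. lim (\<lambda>n. padic_abs CARD('p) (X n))" .

lift_definition padic_seq_inverse :: "'p::prime_card padic_seq \<Rightarrow> 'p padic_seq"
  is "\<lambda>X. if padic_null CARD('p) X then (\<lambda>n. 0) else (\<lambda>n. inverse (X n))"
  by (auto intro: padic_cauchy_inverse[OF prime_card] padic_cauchy_const[OF prime_card])

lemma padic_seq_null_0: "padic_seq_null 0"
  by transfer (simp add: padic_null_def)

lemma padic_seq_null_minus: "padic_seq_null X \<Longrightarrow> padic_seq_null (- X)"
  by transfer (rule padic_null_minus[OF prime_card])

lemma padic_seq_null_add: "padic_seq_null X \<Longrightarrow> padic_seq_null Y \<Longrightarrow> padic_seq_null (X + Y)"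
  by transfer (rule padic_null_add[OF prime_card])

lemma padic_seq_null_mult: "padic_seq_null Y \<Longrightarrow> padic_seq_null (X * Y)"
  by transfer (rule padic_null_mult[OF prime_card])

lemma padic_seq_abs_eq: "padic_seq_null (X - Y) \<Longrightarrow> padic_seq_abs X = padic_seq_abs Y"
  by transfer (rule padic_abs_lim_eq[OF prime_card])

lemma padic_seq_null_iff: "padic_seq_null (X - Y) \<Longrightarrow> padic_seq_null X \<longleftrightarrow> padic_seq_null Y"
  using padic_seq_null_add[of "X - Y" Y] padic_seq_null_add[of "- (X - Y)" X]
    padic_seq_null_minus[of "X - Y"] by auto

lemma padic_seq_inverse_right:
  assumes "\<not> padic_seq_null X"
  shows "padic_seq_null (X * padic_seq_inverse X - 1)"
  using assms
proof transfer
  fix X assume X: "padic_cauchy CARD('a) X" and nz: "\<not> padic_null CARD('a) X"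
  obtain b N where "b > 0" "\<And>n. n \<ge> N \<Longrightarrow> padic_abs CARD('a) (X n) > b"
    using padic_not_null_bound[OF prime_card X nz] by blast
  hence "eventually (\<lambda>n. X n \<noteq> 0) sequentially"
    unfolding eventually_sequentially by (metis padic_abs_0 less_asym)
  hence "eventually (\<lambda>n. padic_abs CARD('a) (X n * inverse (X n) - 1) = 0) sequentially"
    by eventually_elim simp
  thus "padic_null CARD('a)
      (\<lambda>n. X n * (if padic_null CARD('a) X then \<lambda>n. 0 else (\<lambda>n. inverse (X n))) n - 1)"
    using nz by (simp add: padic_null_def tendsto_eventually)
qed

lemma padic_seq_inverse_null: "padic_seq_null X \<Longrightarrow> padic_seq_inverse X = 0"
  by transfer simp

lemma padic_seq_inverse_cong:
  assumes "padic_seq_null (X - Y)"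
  shows "padic_seq_null (padic_seq_inverse X - padic_seq_inverse Y)"
proof (cases "padic_seq_null X")
  case True
  thus ?thesis using padic_seq_null_iff[OF assms]
    by (simp add: padic_seq_inverse_null padic_seq_null_0)
next
  case False
  define U V where "U = padic_seq_inverse X" and "V = padic_seq_inverse Y"
  have 1: "padic_seq_null (X * U - 1)" and 2: "padic_seq_null (Y * V - 1)"
    using False padic_seq_null_iff[OF assms]
    by (auto simp: U_def V_def intro: padic_seq_inverse_right)
  have "U - V = U * - (Y * V - 1) + V * (X * U - 1) + (- (U * V)) * (X - Y)"
    by (simp add: algebra_simps)
  also have "padic_seq_null \<dots>"
    by (intro padic_seq_null_add padic_seq_null_mult padic_seq_null_minus 1 2 assms)
  finally show ?thesis by (simp add: U_def V_def)
qed

quotient_type 'p padic = "'p::prime_card padic_seq" / "\<lambda>X Y. padic_seq_null (X - Y)"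
proof (rule equivpI)
  show "reflp (\<lambda>X Y :: 'p padic_seq. padic_seq_null (X - Y))"
    by (rule reflpI) (simp add: padic_seq_null_0)
  show "symp (\<lambda>X Y :: 'p padic_seq. padic_seq_null (X - Y))"
    using padic_seq_null_minus by (fastforce intro: sympI)
  show "transp (\<lambda>X Y :: 'p padic_seq. padic_seq_null (X - Y))"
    using padic_seq_null_add by (fastforce intro: transpI)
qed

instantiation padic :: (prime_card) field
begin

lift_definition zero_padic :: "'a padic" is 0 .

lift_definition one_padic :: "'a padic" is 1 .

lift_definition plus_padic :: "'a padic \<Rightarrow> 'a padic \<Rightarrow> 'a padic" is "(+)"
  using padic_seq_null_add by (fastforce simp: add_diff_add)

lift_definition uminus_padic :: "'a padic \<Rightarrow> 'a padic" is uminus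
  using padic_seq_null_minus by (fastforce simp: minus_diff_minus)

lift_definition minus_padic :: "'a padic \<Rightarrow> 'a padic \<Rightarrow> 'a padic" is "(-)"
proof -
  fix X X' Y Y' :: "'a padic_seq"
  assume "padic_seq_null (X - X')" "padic_seq_null (Y - Y')"
  hence "padic_seq_null ((X - X') + - (Y - Y'))"
    by (intro padic_seq_null_add padic_seq_null_minus)
  thus "padic_seq_null (X - Y - (X' - Y'))" by (simp add: algebra_simps)
qed

lift_definition times_padic :: "'a padic \<Rightarrow> 'a padic \<Rightarrow> 'a padic" is "(*)"
proof -
  fix X X' Y Y' :: "'a padic_seq"
  assume "padic_seq_null (X - X')" "padic_seq_null (Y - Y')"
  hence "padic_seq_null (X * (Y - Y') + Y' * (X - X'))"
    by (intro padic_seq_null_add padic_seq_null_mult)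
  thus "padic_seq_null (X * Y - X' * Y')" by (simp add: algebra_simps)
qed

lift_definition inverse_padic :: "'a padic \<Rightarrow> 'a padic" is padic_seq_inverse
  by (rule padic_seq_inverse_cong)

definition divide_padic :: "'a padic \<Rightarrow> 'a padic \<Rightarrow> 'a padic" where
  "divide_padic x y = x * inverse y"

instance
proof
  fix x y z :: "'a padic"
  have eq: "padic_seq_null (X - Y)" if "X = Y" for X Y :: "'a padic_seq"
    using that by (simp add: padic_seq_null_0)
  show "x + y + z = x + (y + z)" by transfer (rule eq, simp add: algebra_simps)
  show "x + y = y + x" by transfer (rule eq, simp add: algebra_simps)
  show "0 + x = x" by transfer (rule eq, simp)
  show "- x + x = 0" by transfer (rule eq, simp)
  show "x - y = x + - y" by transfer (rule eq, simp)
  show "x * y * z = x * (y * z)" by transfer (rule eq, simp add: algebra_simps)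
  show "x * y = y * x" by transfer (rule eq, simp add: algebra_simps)
  show "1 * x = x" by transfer (rule eq, simp)
  show "(x + y) * z = x * z + y * z" by transfer (rule eq, simp add: algebra_simps)
  show "(0 :: 'a padic) \<noteq> 1"
  proof transfer
    have "\<not> padic_seq_null (- 1 :: 'a padic_seq)"
      by transfer (simp add: padic_null_def padic_abs_1[OF prime_card] LIMSEQ_const_iff)
    thus "\<not> padic_seq_null (0 - 1 :: 'a padic_seq)" by simp
  qed
  show "x \<noteq> 0 \<Longrightarrow> inverse x * x = 1"
    by transfer (simp add: mult.commute padic_seq_inverse_right)
  show "x div y = x * inverse y" by (rule divide_padic_def)
  show "inverse (0 :: 'a padic) = 0"
    by transfer (simp add: padic_seq_inverse_null padic_seq_null_0)
qed

end

text \<open>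
  A separate constant, since the type constraint of \<^const>\<open>norm\<close> is real normed vector spaces.
\<close>

lift_definition padic_norm :: "'p::prime_card padic \<Rightarrow> real" is padic_seq_abs
  by (rule padic_seq_abs_eq)

lemma padic_seq_abs_lim:
  "(\<lambda>n. padic_abs CARD('p) (Rep_padic_seq X n)) \<longlonglongrightarrow> padic_seq_abs (X :: 'p::prime_card padic_seq)"
  using padic_cauchy_abs_lim[OF prime_card] Rep_padic_seq[of X] by (simp add: padic_seq_abs.rep_eq)

lemma padic_norm_nonneg: "padic_norm (x :: 'p::prime_card padic) \<ge> 0"
proof transfer
  fix X :: "'p padic_seq"
  show "padic_seq_abs X \<ge> 0"
    by (rule LIMSEQ_le_const[OF padic_seq_abs_lim]) simp
qed

lemma padic_norm_eq_0 [simp]: "padic_norm (x :: 'p::prime_card padic) = 0 \<longleftrightarrow> x = 0"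
proof transfer
  fix X :: "'p padic_seq"
  have "padic_seq_null X \<longleftrightarrow> padic_seq_abs X = 0"
    using padic_seq_abs_lim[of X] LIMSEQ_unique
    by (auto simp: padic_seq_null.rep_eq padic_null_def)
  thus "padic_seq_abs X = 0 \<longleftrightarrow> padic_seq_null (X - 0)" by simp
qed

lemma padic_norm_mult: "padic_norm (x * y :: 'p::prime_card padic) = padic_norm x * padic_norm y"
proof transfer
  fix X Y :: "'p padic_seq"
  have "(\<lambda>n. padic_abs CARD('p) (Rep_padic_seq (X * Y) n)) \<longlonglongrightarrow> padic_seq_abs X * padic_seq_abs Y"
    using tendsto_mult[OF padic_seq_abs_lim[of X] padic_seq_abs_lim[of Y]]
    by (simp add: times_padic_seq.rep_eq padic_abs_mult[OF prime_card])
  thus "padic_seq_abs (X * Y) = padic_seq_abs X * padic_seq_abs Y"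
    by (rule LIMSEQ_unique[OF padic_seq_abs_lim])
qed

lemma padic_norm_ultrametric:
  "padic_norm (x + y :: 'p::prime_card padic) \<le> max (padic_norm x) (padic_norm y)"
proof transfer
  fix X Y :: "'p padic_seq"
  show "padic_seq_abs (X + Y) \<le> max (padic_seq_abs X) (padic_seq_abs Y)"
    by (rule LIMSEQ_le[OF padic_seq_abs_lim
          tendsto_max[OF padic_seq_abs_lim[of X] padic_seq_abs_lim[of Y]]])
      (simp add: plus_padic_seq.rep_eq padic_abs_add_le_max[OF prime_card])
qed

lemma padic_norm_minus [simp]: "padic_norm (- x :: 'p::prime_card padic) = padic_norm x"
  by transfer (transfer, simp)

lemma padic_norm_triangle: "padic_norm (x + y :: 'p::prime_card padic) \<le> padic_norm x + padic_norm y"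
  using padic_norm_ultrametric[of x y] padic_norm_nonneg[of x] padic_norm_nonneg[of y]
  by (auto simp: max_def split: if_splits)

lemma padic_norm_of_nat_prime: "padic_norm (of_nat CARD('p) :: 'p::prime_card padic) = 1 / CARD('p)"
proof -
  have of_nat_seq: "padic_seq_abs (of_nat k :: 'p padic_seq) = padic_abs CARD('p) (of_nat k)" for k
  proof -
    have "Rep_padic_seq (of_nat k :: 'p padic_seq) = (\<lambda>n. of_nat k)"
      by (induction k) (simp_all add: zero_padic_seq.rep_eq plus_padic_seq.rep_eq one_padic_seq.rep_eq)
    thus ?thesis by (simp add: padic_seq_abs.rep_eq limI)
  qed
  have "of_nat k = abs_padic (of_nat k :: 'p padic_seq)" for k
    by (induction k) (simp_all add: zero_padic_def one_padic_def plus_padic.abs_eq)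
  hence "padic_norm (of_nat CARD('p) :: 'p padic) = padic_abs CARD('p) (of_nat CARD('p))"
    by (simp add: padic_norm.abs_eq of_nat_seq)
  also have "\<dots> = 1 / CARD('p)"
    using padic_abs_divide[OF prime_card[where 'a = 'p], of "int CARD('p)" 1]
      prime_card[where 'a = 'p] by (simp add: power_int_minus field_simps)
  finally show ?thesis .
qed

instantiation padic :: (prime_card) metric_space
begin

definition dist_padic :: "'a padic \<Rightarrow> 'a padic \<Rightarrow> real" where
  "dist_padic x y = padic_norm (x - y)"

definition uniformity_padic :: "('a padic \<times> 'a padic) filter" where
  "uniformity_padic = (INF e\<in>{0 <..}. principal {(x, y). dist x y < e})"

definition open_padic :: "'a padic set \<Rightarrow> bool" where
  "open_padic U = (\<forall>x\<in>U. eventually (\<lambda>(x', y). x' = x \<longrightarrow> y \<in> U) uniformity)"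

instance
proof
  fix x y z :: "'a padic"
  show "dist x y = 0 \<longleftrightarrow> x = y" by (simp add: dist_padic_def)
  have "padic_norm (y - z) = padic_norm (z - y)" using padic_norm_minus[of "y - z"] by simp
  thus "dist x y \<le> dist x z + dist y z"
    using padic_norm_triangle[of "x - z" "z - y"] by (simp add: dist_padic_def)
qed (rule uniformity_padic_def open_padic_def)+

end


section \<open>Vectors and measures\<close>

text \<open>
  A vector over an index set \<^term>\<open>I\<close> is an extensional function on \<^term>\<open>I\<close>; the entries
  of an \<^term>\<open>m\<close> by \<^term>\<open>n\<close> matrix are indexed by \<^term>\<open>{..<m} \<times> {..<n}\<close>.
\<close>

abbreviation vecs :: "'i set \<Rightarrow> ('i \<Rightarrow> 'a) set" where
  "vecs I \<equiv> I \<rightarrow>\<^sub>E UNIV"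

abbreviation padic_vec_topology :: "'i set \<Rightarrow> ('i \<Rightarrow> 'p::prime_card padic) topology" where
  "padic_vec_topology I \<equiv> product_topology (\<lambda>_. euclidean) I"

definition padic_vec_norm :: "'i set \<Rightarrow> ('i \<Rightarrow> 'p::prime_card padic) \<Rightarrow> real" where
  "padic_vec_norm I x = Max ((\<lambda>i. padic_norm (x i)) ` I)"

definition int_vec_norm :: "'i set \<Rightarrow> ('i \<Rightarrow> int) \<Rightarrow> int" where
  "int_vec_norm I q = Max ((\<lambda>i. \<bar>q i\<bar>) ` I)"

definition borel_sigma :: "'a topology \<Rightarrow> 'a measure" where
  "borel_sigma T = sigma (topspace T) {U. openin T U}"

definition closed_support :: "'a topology \<Rightarrow> 'a measure \<Rightarrow> 'a set" where
  "closed_support T \<mu> = {x \<in> topspace T. \<forall>U. openin T U \<and> x \<in> U \<longrightarrow> emeasure \<mu> U > 0}"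


section \<open>The Fourier transform\<close>

definition padic_expansion :: "'p::prime_card padic \<Rightarrow> int \<Rightarrow> (int \<Rightarrow> nat) \<Rightarrow> bool" where
  "padic_expansion x M c \<longleftrightarrow>
     (\<forall>j. c j < CARD('p)) \<and>
     (\<lambda>N. \<Sum>j\<in>{M..int N}. of_nat (c j) * of_nat CARD('p) powi j) \<longlonglongrightarrow> x"

text \<open>
  The lower bound \<open>M\<close> is not unique (an expansion can be padded with zeros), but the digits are,
  so the sum over the negative positions is well defined.
\<close>

definition padic_frac :: "'p::prime_card padic \<Rightarrow> real" where
  "padic_frac x = (THE t. \<exists>M c. padic_expansion x M c \<and>
     t = (\<Sum>j\<in>{M..-1}. real (c j) * real CARD('p) powi j))"

definition padic_fourier ::
  "'i set \<Rightarrow> ('i \<Rightarrow> 'p::prime_card padic) measure \<Rightarrow> ('i \<Rightarrow> 'p padic) \<Rightarrow> complex" where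
  "padic_fourier I \<mu> \<xi> =
     (\<integral>x. exp (2 * of_real pi * \<i> * of_real (padic_frac (\<Sum>i\<in>I. x i * \<xi> i))) \<partial>\<mu>)"


section \<open>Well-approximable matrices\<close>

text \<open>
  The pair \<^term>\<open>(q, r) = (0, 0)\<close>, for which \<open>powr\<close> uses the convention that powers of \<open>0\<close>
  are \<open>0\<close>, does not affect whether there are infinitely many pairs.
\<close>

definition well_approximable :: "nat \<Rightarrow> nat \<Rightarrow> real \<Rightarrow> (nat \<times> nat \<Rightarrow> 'p::prime_card padic) set" where
  "well_approximable m n \<tau> =
     {x \<in> {..<m} \<times> {..<n} \<rightarrow>\<^sub>E {z. padic_norm z \<le> 1}.
        infinite {(q, r) \<in> vecs {..<n} \<times> vecs {..<m}.
          padic_vec_norm {..<m} (\<lambda>i. (\<Sum>j<n. x (i, j) * of_int (q j)) - of_int (r i))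
            \<le> real_of_int (max (int_vec_norm {..<n} q) (int_vec_norm {..<m} r)) powr (- \<tau>)}}"

end

theory Submission
  imports Defs "HOL-Real_Asymp.Real_Asymp"
begin

text \<open>
  The measure is the law of a random matrix \<open>X = lim X\<^sub>j\<close>, where \<open>X\<^sub>j\<close> is an integer matrix known
  modulo \<open>p^(K j)\<close>. Given \<open>X\<^sub>j\<close>, pick at random a vector \<open>q\<close> of size at most \<open>p^(2h)\<close> whose entry \<open>q 0\<close>
  is a prime, and a random vector \<open>r\<close> that is compatible with \<open>X\<^sub>j\<close>, and let \<open>X\<^sub>j\<^sub>+\<^sub>1\<close> be a uniformly random lift
  of \<open>X\<^sub>j\<close> that solves \<open>X q = r\<close> modulo \<open>p^(K (j+1))\<close>. At a frequency \<open>\<xi>\<close> of norm \<open>p^l\<close> with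
  \<open>K j < l \<le> K (j+1)\<close> only \<open>X\<^sub>j\<^sub>+\<^sub>1\<close> matters. The average over the lifts vanishes unless the rows of
  \<open>\<xi>\<close> are multiples \<open>a q\<close> of \<open>q\<close>, and the average over \<open>r\<close> is a Fejer kernel in \<open>a\<close>. The kernel vanishes
  for \<open>l \<le> K j + 2h\<close>. For larger \<open>l\<close> the prime \<open>q 0\<close> determines \<open>q\<close>, and \<open>a * q 0 = b + t p^(l - K j)\<close>
  for some \<open>t\<close>. The kernel decays like \<open>1/t^2\<close>, and each such number has boundedly many prime divisors of
  the size of \<open>q 0\<close>. Hence the transform is at most a constant times \<open>h p^(-2hn)\<close> by Chebyshev's bound, where
  the constant depends on \<open>K j\<close>. The right-hand side of the theorem has a spare factor of order at least \<open>h\<close>,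
  which absorbs every such constant if \<open>h\<close> is large.
\<close>

text \<open>A step is bounded by averaging over its own choices with the matrix reached so far held
  fixed; that matrix enters only through a unimodular factor, so the steps do not interact. The
  obstacle is a mismatch of sizes: \<open>r\<close> must agree with \<open>X\<^sub>j q\<close>
  modulo \<open>p^(K j)\<close>, so it can be as large as \<open>p^(K j + 2h)\<close>, while
  \<open>q\<close> offers only about \<open>p^(2hn) / h\<close> directions. The resulting loss, a
  power of \<open>p^(K j)\<close>, is why \<open>h\<close> is chosen after \<open>K j\<close>. The
  logarithms are used up completely when \<open>n = 1\<close>: one factor \<open>h\<close> pays for
  the density of the primes, the other absorbs the constants. Hence \<open>r\<close> carries a sum
  of two independent uniform vectors: a single one would give a kernel of size
  \<open>1 / |t|\<close>, whose sum costs a further factor \<open>h\<close>. Hence also a prime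
  entry: counting all divisors instead would cost more than a constant. The lower end
  \<open>p^h\<close> of the range of \<open>q 0\<close> is what bounds the number of prime divisors,
  and \<open>q 0 \<noteq> p\<close> makes \<open>q 0\<close> invertible, so that column 0 of the
  lift can be solved for.\<close>

section \<open>The \<open>p\<close>-adic norm and integers\<close>

lemma padic_norm_abs_const:
  assumes "Rep_padic_seq X = (\<lambda>n. r)"
  shows "padic_norm (abs_padic X :: 'p::prime_card padic) = padic_abs CARD('p) r"
  using assms by (simp add: padic_norm.abs_eq padic_seq_abs.rep_eq limI)

lemma padic_of_int_eq_abs:
  "(of_int k :: 'p::prime_card padic) = abs_padic (of_int k)"
proof -
  have n: "of_nat k = (abs_padic (of_nat k) :: 'p padic)" for k
    by (induction k) (simp_all add: zero_padic_def one_padic_def plus_padic.abs_eq)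
  show ?thesis
    by (cases k) (simp_all add: n uminus_padic.abs_eq one_padic_def plus_padic.abs_eq minus_padic.abs_eq)
qed

lemma Rep_padic_seq_of_int:
  "Rep_padic_seq (of_int k :: 'p::prime_card padic_seq) = (\<lambda>n. of_int k)"
proof -
  have n: "Rep_padic_seq (of_nat k :: 'p padic_seq) = (\<lambda>n. of_nat k)" for k
    by (induction k) (simp_all add: zero_padic_seq.rep_eq plus_padic_seq.rep_eq one_padic_seq.rep_eq)
  show ?thesis
    by (cases k) (simp_all add: n uminus_padic_seq.rep_eq minus_padic_seq.rep_eq plus_padic_seq.rep_eq one_padic_seq.rep_eq)
qed

lemma padic_norm_of_int: "padic_norm (of_int a :: 'p::prime_card padic) = padic_abs CARD('p) (of_int a)"
  unfolding padic_of_int_eq_abs by (rule padic_norm_abs_const[OF Rep_padic_seq_of_int])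

text \<open>The bridge between analysis and arithmetic: closeness of integers is congruence modulo a
  power of \<open>p\<close>.\<close>

lemma padic_abs_of_int_le_iff:
  assumes p: "prime p"
  shows "padic_abs p (of_int a) \<le> 1 / real p ^ N \<longleftrightarrow> int p ^ N dvd a"
proof (cases "a = 0")
  case False
  have p1: "real p > 1" using prime_gt_1_nat[OF p] by simp
  have "padic_abs p (of_int a) = real p powi (- int (multiplicity (int p) a))"
    using padic_abs_divide[OF p False, of 1] by simp
  also have "\<dots> = 1 / real p ^ multiplicity (int p) a"
    by (simp add: power_int_minus divide_inverse)
  finally have "padic_abs p (of_int a) \<le> 1 / real p ^ N \<longleftrightarrow> N \<le> multiplicity (int p) a"
    using p1 by (simp add: divide_le_eq_1 le_divide_eq_1 frac_le_eq inverse_eq_divide[symmetric] power_increasing_iff)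
  moreover have "\<not> is_unit (int p)"
    using p not_prime_unit prime_nat_int_transfer by blast
  ultimately show ?thesis
    using False by (simp add: power_dvd_iff_le_multiplicity)
qed simp

lemma padic_norm_0 [simp]: "padic_norm (0 :: 'p::prime_card padic) = 0"
  by (simp only: padic_norm_eq_0)

lemma prime_card_gt_1: "CARD('p::prime_card) > 1"
  using prime_gt_1_nat[OF prime_card] .

lemma padic_norm_of_int_le_iff:
  "padic_norm (of_int a :: 'p::prime_card padic) \<le> 1 / real CARD('p) ^ N \<longleftrightarrow> int CARD('p) ^ N dvd a"
  by (simp add: padic_norm_of_int padic_abs_of_int_le_iff[OF prime_card])

lemma padic_norm_of_int_le_1: "padic_norm (of_int a :: 'p::prime_card padic) \<le> 1"
  using padic_norm_of_int_le_iff[of a 0] by simp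

lemma padic_norm_1: "padic_norm (1 :: 'p::prime_card padic) = 1"
  using padic_norm_of_int[of 1, where 'p = 'p] by (simp add: padic_abs_1[OF prime_card])

lemma padic_of_nat_card_nonzero: "(of_nat CARD('p) :: 'p::prime_card padic) \<noteq> 0"
proof
  assume "(of_nat CARD('p) :: 'p padic) = 0"
  then show False using padic_norm_of_nat_prime[where 'p = 'p] by simp
qed

lemma padic_norm_power: "padic_norm (x ^ n :: 'p::prime_card padic) = padic_norm x ^ n"
  by (induction n) (simp_all add: padic_norm_1 padic_norm_mult)

lemma padic_norm_inverse: "padic_norm (inverse x :: 'p::prime_card padic) = inverse (padic_norm x)"
proof (cases "x = 0")
  case False
  then have "padic_norm x * padic_norm (inverse x) = 1"
    using padic_norm_mult[of x "inverse x"] by (simp add: padic_norm_1)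
  then show ?thesis by (rule inverse_unique[symmetric])
qed simp

lemma padic_norm_divide: "padic_norm (x / y :: 'p::prime_card padic) = padic_norm x / padic_norm y"
  by (simp add: divide_inverse padic_norm_mult padic_norm_inverse)

lemma padic_norm_card_power: "padic_norm (of_nat CARD('p) ^ n :: 'p::prime_card padic) = 1 / real CARD('p) ^ n"
  by (simp add: padic_norm_power padic_norm_of_nat_prime power_one_over)

section \<open>Ultrametric estimates, density of the integers, limits of compatible integers\<close>

lemma padic_norm_le_trans:
  assumes "padic_norm (x - y :: 'p::prime_card padic) \<le> e" "padic_norm (y - z) \<le> e"
  shows "padic_norm (x - z) \<le> e"
  using padic_norm_ultrametric[of "x - y" "y - z"] assms by simp

lemma padic_norm_diff_commute: "padic_norm (x - y :: 'p::prime_card padic) = padic_norm (y - x)"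
  using padic_norm_minus[of "x - y"] by simp

lemma padic_norm_sum_le:
  assumes "finite A" "\<And>i. i \<in> A \<Longrightarrow> padic_norm (f i :: 'p::prime_card padic) \<le> e" "e \<ge> 0"
  shows "padic_norm (\<Sum>i\<in>A. f i) \<le> e"
  using assms
proof (induction A rule: finite_induct)
  case (insert i A)
  then show ?case
    using padic_norm_ultrametric[of "f i" "sum f A"] by fastforce
qed simp

text \<open>By the ultrametric inequality a single term within \<open>e\<close> of the limit
  transfers the bound without loss.\<close>

lemma padic_norm_le_closed:
  assumes "s \<longlonglongrightarrow> (x :: 'p::prime_card padic)" "\<And>n. padic_norm (s n - y) \<le> e" "e > 0"
  shows "padic_norm (x - y) \<le> e"
proof -
  have "\<forall>\<^sub>F n in sequentially. dist (s n) x < e" by (rule tendstoD[OF assms(1,3)])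
  then obtain n where "dist (s n) x < e" by (auto simp: eventually_sequentially)
  then have "padic_norm (x - s n) \<le> e" by (simp add: dist_padic_def padic_norm_diff_commute)
  then show ?thesis using assms(2) by (rule padic_norm_le_trans)
qed

lemma padic_tendstoI:
  assumes "\<And>n. padic_norm (s n - x :: 'p::prime_card padic) \<le> 1 / real CARD('p) ^ n"
  shows "s \<longlonglongrightarrow> x"
proof -
  have *: "(\<lambda>n. 1 / real CARD('p) ^ n) \<longlonglongrightarrow> 0"
    using prime_card_gt_1 by (intro LIMSEQ_divide_realpow_zero) simp
  have "(\<lambda>n. dist (s n) x) \<longlonglongrightarrow> 0"
    by (rule tendsto_sandwich[OF _ _ tendsto_const *]) (simp_all add: assms dist_padic_def padic_norm_nonneg)
  then show ?thesis by (simp only: tendsto_dist_iff[of s x])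
qed

text \<open>A representing Cauchy sequence supplies a rational \<open>r = u / v\<close> close to
  \<open>x\<close>. As its norm is at most 1, \<open>p\<close> does not divide \<open>v\<close>, so
  with \<open>w\<close> inverse to \<open>v\<close> modulo \<open>p^N\<close> the integer
  \<open>u * w\<close> is close to \<open>r\<close>.\<close>

lemma padic_int_dense:
  assumes "padic_norm (x :: 'p::prime_card padic) \<le> 1"
  obtains a :: int where "padic_norm (x - of_int a) \<le> 1 / real CARD('p) ^ N"
proof -
  define p where "p = CARD('p)"
  have p: "prime p" unfolding p_def by (rule prime_card)
  have p1: "real p > 1" using prime_gt_1_nat[OF p] by simp
  define e where "e = 1 / real p ^ N"
  have e: "e > 0" "e \<le> 1" using p1 by (simp_all add: e_def)
  define X where "X = rep_padic x"
  have X: "x = abs_padic X" unfolding X_def by (rule Quotient_abs_rep[OF Quotient_padic, symmetric])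
  define c where "c r = (Abs_padic_seq (\<lambda>n. r) :: 'p padic_seq)" for r
  have c: "Rep_padic_seq (c r) = (\<lambda>n. r)" for r
    unfolding c_def by (rule Abs_padic_seq_inverse) (simp add: padic_cauchy_const[OF prime_card])
  have "padic_cauchy p (Rep_padic_seq X)" using Rep_padic_seq[of X] by (simp add: p_def)
  then obtain M where M: "\<And>m n. m \<ge> M \<Longrightarrow> n \<ge> M \<Longrightarrow>
      padic_abs p (Rep_padic_seq X m - Rep_padic_seq X n) < e"
    using e unfolding padic_cauchy_def by meson
  define r where "r = Rep_padic_seq X M"
  have close: "padic_norm (x - abs_padic (c r)) \<le> e"
  proof -
    have "x - abs_padic (c r) = abs_padic (X - c r)" by (simp add: X minus_padic.abs_eq)
    then have "padic_norm (x - abs_padic (c r)) = padic_seq_abs (X - c r)"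
      by (simp add: padic_norm.abs_eq)
    moreover have "padic_seq_abs (X - c r) \<le> e"
      using padic_seq_abs_lim[of "X - c r"]
      by (rule LIMSEQ_le_const2) (use M in \<open>auto simp: minus_padic_seq.rep_eq c r_def p_def intro!: less_imp_le\<close>)
    ultimately show ?thesis by simp
  qed
  \<comment> \<open>Since \<open>e \<le> 1\<close>, the approximant stays in the unit ball, which is
    what controls its denominator.\<close>
  have "padic_norm (abs_padic (c r)) \<le> 1"
    using padic_norm_le_trans[of "abs_padic (c r)" x 1 0] close e(2) assms
      padic_norm_diff_commute[of x "abs_padic (c r)"] by simp
  then have r1: "padic_abs p r \<le> 1" by (simp add: padic_norm_abs_const[OF c] p_def)
  obtain u v where uv: "quotient_of r = (u, v)" by (cases "quotient_of r")
  have v: "v > 0" using uv by (rule quotient_of_denom_pos)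
  have r: "r = of_int u / of_int v" using uv by (rule quotient_of_div)
  have cop: "coprime u v" using uv by (rule quotient_of_coprime)
  have pp: "prime (int p)" using p by simp
  have "\<not> int p dvd v"
  proof
    assume d: "int p dvd v"
    then have nu: "\<not> int p dvd u" using cop pp by (metis coprime_common_divisor not_prime_unit)
    then have u0: "u \<noteq> 0" by auto
    have "multiplicity (int p) u = 0" using nu by (rule not_dvd_imp_multiplicity_0)
    moreover have "multiplicity (int p) v > 0"
      using d v pp by (simp add: prime_multiplicity_gt_zero_iff)
    ultimately have "padic_abs p r > 1"
      unfolding r padic_abs_divide[OF p u0 less_imp_neq[OF v, symmetric]]
      using p1 by simp
    then show False using r1 by simp
  qed
  then have "coprime v (int p ^ N)"
    using prime_imp_coprime[OF pp, of v] by (simp add: coprime_commute)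
  then obtain w where w: "[v * w = 1] (mod int p ^ N)"
    using cong_solve_coprime_int by blast
  have "r - of_int (u * w) = r * of_int (1 - v * w)"
    using v by (simp add: r field_simps)
  then have "padic_abs p (r - of_int (u * w)) = padic_abs p r * padic_abs p (of_int (1 - v * w))"
    by (simp only: padic_abs_mult[OF p])
  also have "\<dots> \<le> 1 * e"
  proof (rule mult_mono[OF r1])
    have "int p ^ N dvd 1 - v * w" using cong_sym[OF w] by (simp add: cong_iff_dvd_diff)
    then show "padic_abs p (of_int (1 - v * w)) \<le> e"
      unfolding e_def by (subst padic_abs_of_int_le_iff[OF p])
  qed simp_all
  finally have a: "padic_abs p (r - of_int (u * w)) \<le> e" by simp
  have "abs_padic (c r) - of_int (u * w) = abs_padic (c r - of_int (u * w))"
    by (subst padic_of_int_eq_abs) (simp add: minus_padic.abs_eq)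
  moreover have "Rep_padic_seq (c r - of_int (u * w)) = (\<lambda>n. r - of_int (u * w))"
    by (simp add: minus_padic_seq.rep_eq c Rep_padic_seq_of_int del: of_int_mult)
  ultimately have "padic_norm (abs_padic (c r) - of_int (u * w)) \<le> e"
    using a padic_norm_abs_const[of "c r - of_int (u * w)"] by (simp add: p_def del: of_int_mult)
  from padic_norm_le_trans[OF close this] show thesis
    by (intro that) (simp only: e_def p_def)
qed

text \<open>The integers \<open>a j\<close> form a Cauchy sequence of rationals, so the limit is the
  class of that very sequence.\<close>

lemma padic_limit_of_compatible_ints:
  fixes a :: "nat \<Rightarrow> int" and K :: "nat \<Rightarrow> nat"
  assumes a: "\<And>j. [a (Suc j) = a j] (mod int CARD('p) ^ K j)" and K: "strict_mono K"
  obtains x :: "'p::prime_card padic" where "\<And>j. padic_norm (x - of_int (a j)) \<le> 1 / real CARD('p) ^ K j"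
proof -
  define p where "p = CARD('p)"
  have p: "prime p" unfolding p_def by (rule prime_card)
  have p1: "real p > 1" using prime_gt_1_nat[OF p] by simp
  have cong: "[a (j + d) = a j] (mod int p ^ K j)" for j d
  proof (induction d)
    case (Suc d)
    have "K j \<le> K (j + d)" using K by (simp add: strict_mono_less_eq)
    then have "[a (Suc (j + d)) = a (j + d)] (mod int p ^ K j)"
      using a[of "j + d"] unfolding p_def by (meson cong_dvd_modulus le_imp_power_dvd)
    then show ?case using Suc by (auto intro: cong_trans)
  qed simp
  have close: "padic_abs p (of_int (a m) - of_int (a j)) \<le> 1 / real p ^ K j" if "m \<ge> j" for m j
  proof -
    have "int p ^ K j dvd a m - a j"
      using cong[of j "m - j"] that by (simp add: cong_iff_dvd_diff)
    then have "padic_abs p (of_int (a m - a j)) \<le> 1 / real p ^ K j"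
      by (subst padic_abs_of_int_le_iff[OF p])
    then show ?thesis by simp
  qed
  have lim: "(\<lambda>j. 1 / real p ^ K j) \<longlonglongrightarrow> 0"
    using LIMSEQ_subseq_LIMSEQ[OF LIMSEQ_divide_realpow_zero[OF p1, of 1] K] by (simp add: o_def)
  have cau: "padic_cauchy p (\<lambda>j. of_int (a j))"
    unfolding padic_cauchy_def
  proof (intro allI impI)
    fix e :: real assume "e > 0"
    then obtain M where M: "1 / real p ^ K M < e"
      using order_tendstoD(2)[OF lim] unfolding eventually_sequentially by blast
    show "\<exists>M. \<forall>m\<ge>M. \<forall>n\<ge>M. padic_abs p (of_int (a m) - of_int (a n)) < e"
    proof (intro exI allI impI)
      fix m n assume mn: "M \<le> m" "M \<le> n"
      have "padic_abs p (of_int (a m) - of_int (a n))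
          \<le> max (padic_abs p (of_int (a m) - of_int (a M))) (padic_abs p (of_int (a M) - of_int (a n)))"
        using padic_abs_add_le_max[OF p, of "of_int (a m) - of_int (a M)" "of_int (a M) - of_int (a n)"]
        by simp
      also have "\<dots> < e"
        using close[OF mn(1)] close[OF mn(2)] M
          padic_abs_minus_commute[of p "of_int (a M)" "of_int (a n)"] by simp
      finally show "padic_abs p (of_int (a m) - of_int (a n)) < e" .
    qed
  qed
  define X where "X = (Abs_padic_seq (\<lambda>j. of_int (a j)) :: 'p padic_seq)"
  have X: "Rep_padic_seq X = (\<lambda>j. of_int (a j))"
    unfolding X_def by (rule Abs_padic_seq_inverse) (use cau p_def in simp)
  show thesis
  proof (rule that[of "abs_padic X"])
    fix j
    have "abs_padic X - of_int (a j) = (abs_padic (X - of_int (a j)) :: 'p padic)"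
      by (subst padic_of_int_eq_abs) (simp add: minus_padic.abs_eq)
    then have "padic_norm (abs_padic X - of_int (a j)) = padic_seq_abs (X - of_int (a j))"
      by (simp add: padic_norm.abs_eq)
    also have "\<dots> \<le> 1 / real CARD('p) ^ K j"
      using padic_seq_abs_lim[of "X - of_int (a j)"]
      by (rule LIMSEQ_le_const2)
        (use close in \<open>auto simp: minus_padic_seq.rep_eq X Rep_padic_seq_of_int p_def\<close>)
    finally show "padic_norm (abs_padic X - of_int (a j)) \<le> 1 / real CARD('p) ^ K j" .
  qed
qed

section \<open>Expansions and fractional parts\<close>

lemma padic_int_approx:
  assumes "padic_norm (y :: 'p::prime_card padic) \<le> 1"
  obtains a :: "nat \<Rightarrow> int" where
    "\<And>N. 0 \<le> a N" "\<And>N. a N < int CARD('p) ^ N"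
    "\<And>N. padic_norm (y - of_int (a N)) \<le> 1 / real CARD('p) ^ N"
proof -
  have "\<exists>a. 0 \<le> a \<and> a < int CARD('p) ^ N \<and> padic_norm (y - of_int a) \<le> 1 / real CARD('p) ^ N" for N
  proof -
    obtain a where a: "padic_norm (y - of_int a) \<le> 1 / real CARD('p) ^ N"
      using padic_int_dense[OF assms] by blast
    define b where "b = a mod int CARD('p) ^ N"
    have "padic_norm (of_int (a - b) :: 'p padic) \<le> 1 / real CARD('p) ^ N"
      by (subst padic_norm_of_int_le_iff) (simp add: b_def mod_eq_dvd_iff[symmetric])
    then have "padic_norm (of_int a - of_int b :: 'p padic) \<le> 1 / real CARD('p) ^ N" by simp
    from padic_norm_le_trans[OF a this] show ?thesis
      by (intro exI[of _ b]) (simp add: b_def)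
  qed
  then show thesis using that by metis
qed

text \<open>After scaling into the unit ball by \<open>P^L\<close>, the canonical residues
  \<open>a N\<close> modulo \<open>p^N\<close> are the partial sums of the expansion, and the digits
  are read off from their differences.\<close>

lemma padic_expansion_exists:
  "\<exists>M c. padic_expansion (x :: 'p::prime_card padic) M c"
proof -
  define p where "p = CARD('p)"
  have p1: "real p > 1" using prime_card_gt_1[where 'p = 'p] by (simp add: p_def)
  define P where "P = (of_nat p :: 'p padic)"
  have P0: "P \<noteq> 0" unfolding P_def p_def by (rule padic_of_nat_card_nonzero)
  obtain L where L: "padic_norm x < real p ^ L" using real_arch_pow[OF p1] by blast
  define y where "y = x * P ^ L"
  have "padic_norm y = padic_norm x / real p ^ L"
    by (simp add: y_def P_def p_def padic_norm_mult padic_norm_card_power)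
  then have y1: "padic_norm y \<le> 1" using L p1 by simp
  obtain a where a0: "\<And>N. 0 \<le> a N" and a1: "\<And>N. a N < int p ^ N"
    and a: "\<And>N. padic_norm (y - of_int (a N)) \<le> 1 / real p ^ N"
    using padic_int_approx[OF y1] unfolding p_def by blast
  have step: "a (Suc N) mod int p ^ N = a N" for N
  proof -
    have "1 / real p ^ Suc N \<le> 1 / real p ^ N" using p1 by (simp add: field_simps)
    then have "padic_norm (of_int (a (Suc N)) - of_int (a N) :: 'p padic) \<le> 1 / real p ^ N"
      using padic_norm_le_trans[of "of_int (a (Suc N))" y "1 / real p ^ N" "of_int (a N)"]
        a[of N] a[of "Suc N"] padic_norm_diff_commute[of y "of_int (a (Suc N))"] by linarith
    then have "padic_norm (of_int (a (Suc N) - a N) :: 'p padic) \<le> 1 / real p ^ N" by simp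
    then have "int p ^ N dvd a (Suc N) - a N"
      unfolding p_def by (subst (asm) padic_norm_of_int_le_iff)
    then show ?thesis using a0[of N] a1[of N] by (metis mod_eq_dvd_iff mod_pos_pos_trivial)
  qed
  define d where "d N = nat (a (Suc N) div int p ^ N)" for N
  have d: "int (d N) * int p ^ N = a (Suc N) - a N" for N
    using minus_mod_eq_div_mult[of "a (Suc N)" "int p ^ N"] step[of N] a0[of "Suc N"] p1
    by (simp add: d_def pos_imp_zdiv_nonneg_iff)
  have d_less: "d N < p" for N
  proof -
    have "int (d N) * int p ^ N < int p * int p ^ N"
      using d[of N] a1[of "Suc N"] a0[of N] by simp
    then have "int (d N) < int p" using p1 by (subst (asm) mult_less_cancel_right_pos) simp_all
    then show ?thesis by simp
  qed
  have sum: "(\<Sum>i<N. of_nat (d i) * P ^ i) = of_int (a N)" for N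
  proof (induction N)
    case 0
    have "a 0 = 0" using a0[of 0] a1[of 0] by simp
    then show ?case by simp
  next
    case (Suc N)
    have "of_nat (d N) * P ^ N = (of_int (int (d N) * int p ^ N) :: 'p padic)"
      by (simp add: P_def)
    then show ?case using Suc d[of N] by simp
  qed
  define c where "c j = (if j < - int L then 0 else d (nat (j + int L)))" for j
  have "padic_expansion x (- int L) c"
    unfolding padic_expansion_def
  proof (intro conjI allI)
    show "c j < CARD('p)" for j using d_less p1 by (simp add: c_def p_def)
    have eq: "(\<Sum>j\<in>{- int L..int N}. of_nat (c j) * P powi j) = of_int (a (Suc (N + L))) / P ^ L" for N
    proof -
      have "(\<Sum>j\<in>{- int L..int N}. of_nat (c j) * P powi j)
          = (\<Sum>i<Suc (N + L). of_nat (d i) * P powi (int i - int L))"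
        by (rule sum.reindex_bij_witness[of _ "\<lambda>i. int i - int L" "\<lambda>j. nat (j + int L)"])
          (auto simp: c_def)
      also have "\<dots> = (\<Sum>i<Suc (N + L). of_nat (d i) * P ^ i) / P ^ L"
        using P0 by (simp add: sum_divide_distrib power_int_diff add_divide_distrib)
      finally show ?thesis by (simp only: sum)
    qed
    have "(\<lambda>N. of_int (a (Suc (N + L))) / P ^ L) \<longlonglongrightarrow> x"
    proof (rule padic_tendstoI)
      fix N
      have "of_int (a (Suc (N + L))) / P ^ L - x = (of_int (a (Suc (N + L))) - y) / P ^ L"
        using P0 by (simp add: y_def field_simps)
      then have "padic_norm (of_int (a (Suc (N + L))) / P ^ L - x)
          = padic_norm (y - of_int (a (Suc (N + L)))) * real p ^ L"
        using padic_norm_diff_commute[of y "of_int (a (Suc (N + L)))"]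
        by (simp add: padic_norm_divide P_def p_def padic_norm_card_power)
      also have "\<dots> \<le> (1 / real p ^ (Suc (N + L))) * real p ^ L"
        by (rule mult_right_mono[OF a]) simp
      also have "\<dots> \<le> 1 / real p ^ N" using p1 by (simp add: power_add field_simps)
      finally show "padic_norm (of_int (a (Suc (N + L))) / P ^ L - x) \<le> 1 / real CARD('p) ^ N"
        by (simp add: p_def)
    qed
    then show "(\<lambda>N. \<Sum>j\<in>{- int L..int N}. of_nat (c j) * of_nat CARD('p) powi j) \<longlonglongrightarrow> x"
      unfolding eq[unfolded P_def p_def] by (simp only: P_def p_def)
  qed
  then show ?thesis by blast
qed

text \<open>The digits at negative positions sum to \<open>B / p^L\<close> with
  \<open>B < p^L\<close>. This differs from \<open>b / p^l\<close> by a p-adic integer whose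
  denominator is a power of \<open>p\<close>, hence by an integer. As \<open>M\<close> and
  \<open>c\<close> are arbitrary, uniqueness in \<open>padic_frac\<close> follows as well.\<close>

lemma padic_expansion_frac:
  fixes x :: "'p::prime_card padic"
  assumes exp: "padic_expansion x M c"
    and b: "padic_norm (x - of_int b / of_nat CARD('p) ^ l) \<le> 1"
  shows "(\<Sum>j\<in>{M..-1}. real (c j) * real CARD('p) powi j) = frac (real_of_int b / real CARD('p) ^ l)"
proof -
  define p where "p = CARD('p)"
  have p1: "real p > 1" using prime_card_gt_1[where 'p = 'p] by (simp add: p_def)
  define P where "P = (of_nat p :: 'p padic)"
  have P0: "P \<noteq> 0" unfolding P_def p_def by (rule padic_of_nat_card_nonzero)
  have c: "c j < p" for j using exp by (simp add: padic_expansion_def p_def)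
  define L where "L = nat (- M)"
  define d where "d i = c (int i - int L)" for i
  define B where "B = (\<Sum>i<L. d i * p ^ i)"
  have shift: "(\<Sum>j\<in>{M..-1}. f (c j) * g j) = (\<Sum>i<L. f (d i) * g (int i - int L))"
    for f :: "nat \<Rightarrow> 'c::comm_ring_1" and g
    by (rule sum.reindex_bij_witness[of _ "\<lambda>i. int i - int L" "\<lambda>j. nat (j + int L)"])
      (auto simp: d_def L_def)
  have t: "(\<Sum>j\<in>{M..-1}. real (c j) * real p powi j) = real B / real p ^ L"
    using p1 unfolding shift B_def by (simp add: sum_divide_distrib power_int_diff)
  have B_padic: "(\<Sum>j\<in>{M..-1}. of_nat (c j) * P powi j) = of_int (int B) / P ^ L"
    using P0 unfolding shift B_def by (simp add: sum_divide_distrib power_int_diff P_def)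
  have "(\<Sum>i<n. d i * p ^ i) < p ^ n" for n
  proof (induction n)
    case (Suc n)
    have "d n + 1 \<le> p" using c by (simp add: d_def Suc_leI)
    then have "(d n + 1) * p ^ n \<le> p * p ^ n" by (rule mult_le_mono1)
    then show ?case using Suc by simp
  qed simp
  then have B_less: "B < p ^ L" by (simp add: B_def)
  have "padic_norm (x - of_int (int B) / P ^ L) \<le> 1"
  proof (rule padic_norm_le_closed)
    show "(\<lambda>N. \<Sum>j\<in>{M..int N}. of_nat (c j) * P powi j) \<longlonglongrightarrow> x"
      using exp by (simp add: padic_expansion_def P_def p_def)
    fix N
    have fin: "finite {max M 0..int N}" by simp
    \<comment> \<open>If \<open>int N < M\<close> then \<open>M > 0\<close>, so \<open>L\<close> and
      \<open>B\<close> are 0 and both sums are empty.\<close>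
    have "{M..int N} = {M..-1} \<union> {max M 0..int N} \<or> int N < M" by auto
    then have "(\<Sum>j\<in>{M..int N}. of_nat (c j) * P powi j) - of_int (int B) / P ^ L
       = (\<Sum>j\<in>{max M 0..int N}. of_nat (c j) * P powi j)"
    proof
      assume *: "{M..int N} = {M..-1} \<union> {max M 0..int N}"
      show ?thesis unfolding B_padic[symmetric] *
        by (subst sum.union_disjoint) auto
    qed (simp add: B_def L_def)
    also have "padic_norm \<dots> \<le> 1"
    proof (rule padic_norm_sum_le[OF fin])
      fix j assume "j \<in> {max M 0..int N}"
      then have "of_nat (c j) * P powi j = of_int (int (c j) * int p ^ nat j)"
        by (simp add: P_def power_int_def)
      then show "padic_norm (of_nat (c j) * P powi j) \<le> 1"
        using padic_norm_of_int_le_1 by metis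
    qed simp
    finally show "padic_norm ((\<Sum>j\<in>{M..int N}. of_nat (c j) * P powi j) - of_int (int B) / P ^ L) \<le> 1" .
  qed simp
  then have "padic_norm (of_int b / P ^ l - of_int (int B) / P ^ L) \<le> 1"
    using padic_norm_le_trans[of "of_int b / P ^ l" x 1] b
      padic_norm_diff_commute[of x "of_int b / P ^ l"] by (simp add: P_def p_def)
  moreover have "of_int b / P ^ l - of_int (int B) / P ^ L
      = of_int (b * int p ^ L - int B * int p ^ l) / P ^ (l + L)"
    using P0 by (simp add: P_def power_add field_simps)
  ultimately have "padic_norm (of_int (b * int p ^ L - int B * int p ^ l) :: 'p padic) * real p ^ (l + L) \<le> 1"
    unfolding P_def p_def by (simp only: padic_norm_divide padic_norm_card_power) simp
  then have "padic_norm (of_int (b * int p ^ L - int B * int p ^ l) :: 'p padic) \<le> 1 / real p ^ (l + L)"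
    using p1 by (simp only: pos_le_divide_eq zero_less_power) 
  then have "int p ^ (l + L) dvd b * int p ^ L - int B * int p ^ l"
    unfolding p_def by (subst (asm) padic_norm_of_int_le_iff)
  then obtain m where "b * int p ^ L - int B * int p ^ l = int p ^ (l + L) * m" by (elim dvdE)
  then have "real_of_int (b * int p ^ L - int B * int p ^ l) = real_of_int (int p ^ (l + L) * m)"
    by (simp only:)
  then have "real_of_int b / real p ^ l = of_int m + real B / real p ^ L"
    using p1 by (simp add: field_simps power_add)
  then have "frac (real_of_int b / real p ^ l) = frac (real B / real p ^ L)"
    by (simp add: frac_def)
  also have "\<dots> = real B / real p ^ L"
    using B_less p1 by (subst frac_eq) (simp add: field_simps flip: of_nat_power)
  finally show ?thesis using t by (simp add: p_def)
qed

lemma padic_frac_eq: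
  assumes "padic_norm (x - of_int b / of_nat CARD('p) ^ l :: 'p::prime_card padic) \<le> 1"
  shows "padic_frac x = frac (real_of_int b / real CARD('p) ^ l)"
proof -
  obtain M c where c: "padic_expansion x M c" using padic_expansion_exists by blast
  show ?thesis
    unfolding padic_frac_def
  proof (rule the_equality)
    show "\<exists>M c. padic_expansion x M c \<and> frac (real_of_int b / real CARD('p) ^ l) =
        (\<Sum>j\<in>{M..-1}. real (c j) * real CARD('p) powi j)"
      using c padic_expansion_frac[OF c assms, symmetric] by blast
  qed (auto simp: padic_expansion_frac[OF _ assms])
qed

section \<open>Topology and characters of vectors\<close>

lemma padic_approx_rational:
  fixes z :: "'p::prime_card padic"
  assumes "padic_norm z \<le> real CARD('p) ^ l"
  obtains b :: int where "padic_norm (z - of_int b / of_nat CARD('p) ^ l) \<le> 1"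
proof -
  define P where "P = (of_nat CARD('p) :: 'p padic)"
  have P0: "P \<noteq> 0" unfolding P_def by (rule padic_of_nat_card_nonzero)
  have p: "real CARD('p) > 0" using prime_card_gt_1[where 'p = 'p] by simp
  have "padic_norm (z * P ^ l) \<le> 1"
    using assms p by (simp add: padic_norm_mult P_def padic_norm_card_power)
  then obtain b where b: "padic_norm (z * P ^ l - of_int b) \<le> 1 / real CARD('p) ^ l"
    by (rule padic_int_dense)
  have "z - of_int b / P ^ l = (z * P ^ l - of_int b) / P ^ l"
    using P0 by (simp add: field_simps)
  then have "padic_norm (z - of_int b / P ^ l) = padic_norm (z * P ^ l - of_int b) * real CARD('p) ^ l"
    by (simp add: padic_norm_divide P_def padic_norm_card_power)
  also have "\<dots> \<le> (1 / real CARD('p) ^ l) * real CARD('p) ^ l"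
    by (rule mult_right_mono[OF b]) simp
  also have "\<dots> = 1" using p by simp
  finally show thesis using that by (simp add: P_def)
qed

text \<open>The same fraction \<open>b / p^l\<close> approximates both arguments. This makes the
  characters trivial on p-adic integers.\<close>

lemma padic_frac_cong:
  fixes z w :: "'p::prime_card padic"
  assumes "padic_norm (z - w) \<le> 1"
  shows "padic_frac z = padic_frac w"
proof -
  have p1: "real CARD('p) > 1" using prime_card_gt_1[where 'p = 'p] by simp
  obtain l where "padic_norm w < real CARD('p) ^ l" using real_arch_pow[OF p1] by blast
  then have "padic_norm w \<le> real CARD('p) ^ l" by simp
  then obtain b where b: "padic_norm (w - of_int b / of_nat CARD('p) ^ l) \<le> 1"
    by (rule padic_approx_rational)
  show ?thesis
    using padic_frac_eq[OF b] padic_frac_eq[OF padic_norm_le_trans[OF assms b]] by simp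
qed

lemma exp_frac: "exp (2 * of_real pi * \<i> * of_real (frac x)) = exp (2 * of_real pi * \<i> * of_real x)"
proof -
  have "2 * of_real pi * \<i> * of_real x
      = 2 * of_real pi * \<i> * of_real (frac x) + complex_of_real (2 * pi * of_int \<lfloor>x\<rfloor>) * \<i>"
    by (simp add: frac_def algebra_simps)
  moreover have "exp (complex_of_real (2 * pi * of_int \<lfloor>x\<rfloor>) * \<i>) = 1"
    using exp_integer_2pi[of "of_int \<lfloor>x\<rfloor>"] by (simp add: mult_ac)
  ultimately show ?thesis by (simp add: exp_add)
qed

section \<open>Cylinders as a base of the product topology\<close>

definition padic_cyl :: "'i set \<Rightarrow> ('i \<Rightarrow> 'p::prime_card padic) \<Rightarrow> nat \<Rightarrow> ('i \<Rightarrow> 'p padic) set" where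
  "padic_cyl I x N = {y \<in> vecs I. \<forall>i\<in>I. padic_norm (y i - x i) \<le> 1 / real CARD('p) ^ N}"

lemma padic_cyl_trans:
  assumes "y \<in> padic_cyl I x N" "N \<le> M" "z \<in> padic_cyl I y M"
  shows "z \<in> padic_cyl I (x :: 'i \<Rightarrow> 'p::prime_card padic) N"
proof -
  have "1 / real CARD('p) ^ M \<le> 1 / real CARD('p) ^ N"
    using assms(2) prime_card_gt_1[where 'p = 'p] by (intro divide_left_mono power_increasing) auto
  then have "padic_norm (z i - x i) \<le> 1 / real CARD('p) ^ N" if "i \<in> I" for i
    using assms that padic_norm_le_trans[of "z i" "y i" "1 / real CARD('p) ^ N" "x i"]
    by (force simp: padic_cyl_def)
  then show ?thesis using assms by (simp add: padic_cyl_def)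
qed

lemma padic_cyl_sym:
  assumes "y \<in> padic_cyl I x N" "x \<in> vecs I"
  shows "x \<in> padic_cyl I (y :: 'i \<Rightarrow> 'p::prime_card padic) N"
  using assms by (auto simp: padic_cyl_def padic_norm_diff_commute)

lemma openin_padic_vec_topology:
  fixes U :: "('i \<Rightarrow> 'p::prime_card padic) set"
  assumes I: "finite I"
  shows "openin (padic_vec_topology I) U \<longleftrightarrow> U \<subseteq> vecs I \<and> (\<forall>x\<in>U. \<exists>N. padic_cyl I x N \<subseteq> U)"
proof (intro iffI conjI ballI)
  assume U: "openin (padic_vec_topology I) U"
  show "U \<subseteq> vecs I" using openin_subset[OF U] by (simp add: PiE_def)
  fix x assume "x \<in> U"
  then obtain V where "\<forall>i\<in>I. openin euclidean (V i)" and V': "x \<in> Pi\<^sub>E I V" "Pi\<^sub>E I V \<subseteq> U"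
    using U unfolding openin_product_topology_alt by blast
  then have V: "\<And>i. i \<in> I \<Longrightarrow> open (V i)" by simp
  have "\<exists>N. \<forall>z. padic_norm (z - x i) \<le> 1 / real CARD('p) ^ N \<longrightarrow> z \<in> V i" if i: "i \<in> I" for i
  proof -
    obtain e where e: "e > 0" "\<And>z. dist z (x i) < e \<Longrightarrow> z \<in> V i"
      using V[OF i] PiE_mem[OF V'(1) i] unfolding open_dist by blast
    have lim: "(\<lambda>N. 1 / real CARD('p) ^ N) \<longlonglongrightarrow> 0"
      using prime_card_gt_1[where 'p = 'p] by (intro LIMSEQ_divide_realpow_zero) simp
    then obtain N where "1 / real CARD('p) ^ N < e"
      using order_tendstoD(2)[OF lim e(1)] unfolding eventually_sequentially by blast
    then show ?thesis
      using e(2) by (intro exI[of _ N]) (auto simp: dist_padic_def)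
  qed
  then obtain n where n: "\<And>i z. i \<in> I \<Longrightarrow> padic_norm (z - x i) \<le> 1 / real CARD('p) ^ n i \<Longrightarrow> z \<in> V i"
    by metis
  show "\<exists>N. padic_cyl I x N \<subseteq> U"
  proof (intro exI subsetI)
    \<comment> \<open>The sum of the exponents \<open>n i\<close> is a common precision for all
      coordinates, also when \<open>I\<close> is empty.\<close>
    fix y assume y: "y \<in> padic_cyl I x (sum n I)"
    have "y i \<in> V i" if i: "i \<in> I" for i
    proof (rule n[OF i])
      have "n i \<le> sum n I" by (rule member_le_sum) (use I i in auto)
      then have "1 / real CARD('p) ^ sum n I \<le> 1 / real CARD('p) ^ n i"
        using prime_card_gt_1[where 'p = 'p] by (intro divide_left_mono power_increasing) auto
      then show "padic_norm (y i - x i) \<le> 1 / real CARD('p) ^ n i"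
        using y i by (force simp: padic_cyl_def)
    qed
    then have "y \<in> Pi\<^sub>E I V" using y by (auto simp: padic_cyl_def PiE_iff)
    then show "y \<in> U" using V'(2) by blast
  qed
next
  assume U: "U \<subseteq> vecs I \<and> (\<forall>x\<in>U. \<exists>N. padic_cyl I x N \<subseteq> U)"
  show "openin (padic_vec_topology I) U"
    unfolding openin_product_topology_alt
  proof
    fix x assume x: "x \<in> U"
    obtain N where N: "padic_cyl I x N \<subseteq> U" using U x by blast
    define e where "e = 1 / real CARD('p) ^ N"
    have e: "e > 0" using prime_card_gt_1[where 'p = 'p] by (simp add: e_def)
    show "\<exists>V. finite {i \<in> I. V i \<noteq> topspace euclidean} \<and> (\<forall>i\<in>I. openin euclidean (V i)) \<and>
        x \<in> Pi\<^sub>E I V \<and> Pi\<^sub>E I V \<subseteq> U"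
    proof (intro exI conjI)
      show "finite {i \<in> I. ball (x i) e \<noteq> topspace euclidean}" using I by simp
      show "\<forall>i\<in>I. openin euclidean (ball (x i) e)" by simp
      show "x \<in> (\<Pi>\<^sub>E i\<in>I. ball (x i) e)" using U x e by (auto simp: PiE_iff)
      have "(\<Pi>\<^sub>E i\<in>I. ball (x i) e) \<subseteq> padic_cyl I x N"
        by (auto simp: padic_cyl_def PiE_iff dist_padic_def padic_norm_diff_commute e_def less_imp_le)
      then show "(\<Pi>\<^sub>E i\<in>I. ball (x i) e) \<subseteq> U" using N by blast
    qed
  qed
qed

lemma openin_padic_cyl:
  assumes "finite I"
  shows "openin (padic_vec_topology I) (padic_cyl I x N)"
  unfolding openin_padic_vec_topology[OF assms]
proof (intro conjI ballI exI subsetI)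
  show "y \<in> vecs I" if "y \<in> padic_cyl I x N" for y using that by (simp add: padic_cyl_def)
qed (rule padic_cyl_trans[OF _ order_refl])

section \<open>Local constancy and measurability of characters\<close>

lemma space_borel_sigma: "space (borel_sigma T) = topspace T"
  by (simp add: borel_sigma_def space_measure_of_conv)

lemma openin_imp_sets_borel_sigma: "openin T U \<Longrightarrow> U \<in> sets (borel_sigma T)"
  unfolding borel_sigma_def by (subst sets_measure_of) (auto dest: openin_subset)

text \<open>Thus a character at a frequency of norm at most \<open>p^l\<close> is constant on
  cylinders of level \<open>l\<close>: the error of the dot product is a p-adic integer.\<close>

lemma padic_dot_diff_le:
  fixes x y \<xi> :: "'i \<Rightarrow> 'p::prime_card padic"
  assumes "finite I" "\<And>i. i \<in> I \<Longrightarrow> padic_norm (\<xi> i) \<le> real CARD('p) ^ l"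
    and "\<And>i. i \<in> I \<Longrightarrow> padic_norm (x i - y i) \<le> 1 / real CARD('p) ^ l"
  shows "padic_norm ((\<Sum>i\<in>I. x i * \<xi> i) - (\<Sum>i\<in>I. y i * \<xi> i)) \<le> 1"
proof -
  have p: "real CARD('p) > 0" using prime_card_gt_1[where 'p = 'p] by simp
  have "padic_norm (\<Sum>i\<in>I. (x i - y i) * \<xi> i) \<le> 1"
  proof (rule padic_norm_sum_le[OF assms(1)])
    fix i assume i: "i \<in> I"
    have "padic_norm ((x i - y i) * \<xi> i) \<le> 1 / real CARD('p) ^ l * real CARD('p) ^ l"
      unfolding padic_norm_mult using assms(2,3)[OF i] by (intro mult_mono) (auto simp: padic_norm_nonneg)
    then show "padic_norm ((x i - y i) * \<xi> i) \<le> 1" using p by simp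
  qed simp
  then show ?thesis by (simp add: left_diff_distrib sum_subtractf)
qed

lemma padic_vec_norm_bound:
  assumes "finite (I :: 'i set)"
  obtains l where "\<And>i. i \<in> I \<Longrightarrow> padic_norm (\<xi> i :: 'p::prime_card padic) \<le> real CARD('p) ^ l"
proof -
  have p1: "real CARD('p) > 1" using prime_card_gt_1[where 'p = 'p] by simp
  obtain l where l: "(\<Sum>i\<in>I. padic_norm (\<xi> i)) < real CARD('p) ^ l" using real_arch_pow[OF p1] by blast
  have "padic_norm (\<xi> i) \<le> (\<Sum>i\<in>I. padic_norm (\<xi> i))" if "i \<in> I" for i
    using that assms by (intro member_le_sum) (auto simp: padic_norm_nonneg)
  then show thesis using that l by (meson less_imp_le order_trans)
qed

abbreviation padic_char :: "'i set \<Rightarrow> ('i \<Rightarrow> 'p::prime_card padic) \<Rightarrow> ('i \<Rightarrow> 'p padic) \<Rightarrow> complex" where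
  "padic_char I \<xi> x \<equiv> exp (2 * of_real pi * \<i> * of_real (padic_frac (\<Sum>i\<in>I. x i * \<xi> i)))"

text \<open>Local constancy makes the preimage of every set open.\<close>

lemma padic_char_measurable:
  assumes I: "finite I"
  shows "padic_char I \<xi> \<in> borel_measurable (borel_sigma (padic_vec_topology I))"
proof (rule measurableI)
  fix A :: "complex set" assume "A \<in> sets borel"
  obtain l where l: "\<And>i. i \<in> I \<Longrightarrow> padic_norm (\<xi> i) \<le> real CARD('b) ^ l"
    using padic_vec_norm_bound[OF I, of \<xi>] by blast
  have "openin (padic_vec_topology I) (padic_char I \<xi> -` A \<inter> vecs I)"
    unfolding openin_padic_vec_topology[OF I]
  proof (intro conjI ballI exI subsetI)
    fix x y assume x: "x \<in> padic_char I \<xi> -` A \<inter> vecs I" and y: "y \<in> padic_cyl I x l"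
    have "padic_frac (\<Sum>i\<in>I. y i * \<xi> i) = padic_frac (\<Sum>i\<in>I. x i * \<xi> i)"
      using y by (intro padic_frac_cong padic_dot_diff_le[OF I l]) (auto simp: padic_cyl_def)
    then show "y \<in> padic_char I \<xi> -` A \<inter> vecs I" using x y by (simp only: padic_cyl_def vimage_def Int_iff mem_Collect_eq)
  qed (rule IntD2)
  then show "padic_char I \<xi> -` A \<inter> space (borel_sigma (padic_vec_topology I))
      \<in> sets (borel_sigma (padic_vec_topology I))"
    by (intro openin_imp_sets_borel_sigma) (simp add: space_borel_sigma)
qed simp

text \<open>Replacing \<open>x\<close> by \<open>a\<close> and then \<open>\<xi>\<close> by
  \<open>b / p^l\<close> changes the dot product by p-adic integers only.\<close>

lemma padic_char_rational:
  fixes \<xi> x :: "'i \<Rightarrow> 'p::prime_card padic" and a b :: "'i \<Rightarrow> int"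
  assumes I: "finite I"
    and \<xi>: "\<And>i. i \<in> I \<Longrightarrow> padic_norm (\<xi> i - of_int (b i) / of_nat CARD('p) ^ l) \<le> 1"
    and x: "\<And>i. i \<in> I \<Longrightarrow> padic_norm (x i - of_int (a i)) \<le> 1 / real CARD('p) ^ l"
  shows "padic_char I \<xi> x
    = exp (2 * of_real pi * \<i> * of_real (of_int (\<Sum>i\<in>I. a i * b i) / real CARD('p) ^ l))"
proof -
  define P where "P = (of_nat CARD('p) :: 'p padic)"
  have p1: "real CARD('p) \<ge> 1" using prime_card_gt_1[where 'p = 'p] by simp
  have b: "padic_norm (of_int (b i) / P ^ l) \<le> real CARD('p) ^ l" for i
    using padic_norm_of_int_le_1[where 'p = 'p, of "b i"] p1
    by (simp add: padic_norm_divide P_def padic_norm_card_power mult_left_le_one_le padic_norm_nonneg)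
  have "padic_norm ((\<Sum>i\<in>I. x i * \<xi> i) - (\<Sum>i\<in>I. of_int (a i) * \<xi> i)) \<le> 1"
  proof (rule padic_dot_diff_le[OF I _ x])
    fix i assume i: "i \<in> I"
    have "padic_norm ((\<xi> i - of_int (b i) / P ^ l) + of_int (b i) / P ^ l) \<le> real CARD('p) ^ l"
      using padic_norm_ultrametric[of "\<xi> i - of_int (b i) / P ^ l" "of_int (b i) / P ^ l"]
        \<xi>[OF i, folded P_def] b[of i] one_le_power[OF p1, of l] by linarith
    then show "padic_norm (\<xi> i) \<le> real CARD('p) ^ l" by simp
  qed
  moreover have "padic_norm ((\<Sum>i\<in>I. of_int (a i) * \<xi> i) - (\<Sum>i\<in>I. of_int (a i) * (of_int (b i) / P ^ l))) \<le> 1"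
  proof -
    have "padic_norm (\<Sum>i\<in>I. of_int (a i) * (\<xi> i - of_int (b i) / P ^ l)) \<le> 1"
    proof (rule padic_norm_sum_le[OF I])
      fix i assume "i \<in> I"
      then show "padic_norm (of_int (a i) * (\<xi> i - of_int (b i) / P ^ l)) \<le> 1"
        unfolding padic_norm_mult P_def
        by (intro mult_le_one \<xi> padic_norm_of_int_le_1 padic_norm_nonneg)
    qed simp
    then show ?thesis by (simp add: right_diff_distrib sum_subtractf)
  qed
  ultimately have "padic_norm ((\<Sum>i\<in>I. x i * \<xi> i) - (\<Sum>i\<in>I. of_int (a i) * (of_int (b i) / P ^ l))) \<le> 1"
    by (rule padic_norm_le_trans)
  moreover have "(\<Sum>i\<in>I. of_int (a i) * (of_int (b i) / P ^ l)) = of_int (\<Sum>i\<in>I. a i * b i) / P ^ l"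
    by (simp add: sum_divide_distrib)
  ultimately have "padic_norm ((\<Sum>i\<in>I. x i * \<xi> i) - of_int (\<Sum>i\<in>I. a i * b i) / of_nat CARD('p) ^ l) \<le> 1"
    by (simp only: P_def)
  from padic_frac_eq[OF this] show ?thesis by (simp only: exp_frac)
qed

section \<open>The law of a limit of random integer vectors\<close>

text \<open>The integral of a non-integrable function is 0 by convention, and
  \<open>B \<ge> 0\<close> covers that case.\<close>

lemma (in prob_space) norm_integral_le:
  fixes f :: "'a \<Rightarrow> 'b::{banach, second_countable_topology}"
  assumes "\<And>x. x \<in> space M \<Longrightarrow> norm (f x) \<le> B" "B \<ge> 0"
  shows "norm (integral\<^sup>L M f) \<le> B"
proof (cases "integrable M f")
  case True
  have "norm (integral\<^sup>L M f) \<le> (\<integral>x. norm (f x) \<partial>M)" by (rule integral_norm_bound)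
  also have "\<dots> \<le> (\<integral>x. B \<partial>M)" by (rule integral_mono) (use True assms in auto)
  finally show ?thesis by (simp add: prob_space)
qed (simp add: not_integrable_integral_eq assms)

text \<open>\<open>\<omega> j\<close> is the random seed of step \<open>j\<close>. Seeds are plain
  numbers, whatever a step draws with them, so that one product space serves all steps.\<close>

primrec chain :: "(nat \<Rightarrow> ('i \<Rightarrow> int) \<Rightarrow> nat \<Rightarrow> ('i \<Rightarrow> int)) \<Rightarrow> (nat \<Rightarrow> nat) \<Rightarrow> nat \<Rightarrow> ('i \<Rightarrow> int)" where
  "chain G \<omega> 0 = (\<lambda>_. 0)"
| "chain G \<omega> (Suc j) = G j (chain G \<omega> j) (\<omega> j)"

lemma chain_cong:
  "(\<And>i. i < j \<Longrightarrow> \<omega> i = \<omega>' i) \<Longrightarrow> chain G \<omega> j = chain G \<omega>' j"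
  by (induction j) auto

text \<open>The state type may be uncountable, but the seed is not: fixing its value leaves a
  function of the previous state, and countably many such cases are glued.\<close>

lemma chain_measurable:
  assumes "{..<j} \<subseteq> J" "\<And>i. i \<in> J \<Longrightarrow> sets (M i) = UNIV"
  shows "(\<lambda>\<omega>. chain G \<omega> j) \<in> measurable (PiM J M) (count_space UNIV)"
  using assms(1)
proof (induction j)
  case (Suc j)
  have j: "j \<in> J" using Suc.prems by auto
  have "space (M j) = UNIV" using sets.top[of "M j"] assms(2)[OF j] sets.sets_into_space[of UNIV "M j"] by auto
  then have "sets (M j) = sets (count_space UNIV)" using assms(2)[OF j] by simp
  then have \<omega>: "(\<lambda>\<omega>. \<omega> j) \<in> measurable (PiM J M) (count_space UNIV)"
    using measurable_component_singleton[OF j, of M] measurable_cong_sets by blast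
  have "{..<j} \<subseteq> J" using Suc.prems by auto
  from Suc.IH[OF this] have "(\<lambda>\<omega>. G j (chain G \<omega> j) i) \<in> measurable (PiM J M) (count_space UNIV)" for i
    by (rule measurable_compose) simp
  then have "(\<lambda>\<omega>. G j (chain G \<omega> j) (\<omega> j)) \<in> measurable (PiM J M) (count_space UNIV)"
    using \<omega> by (rule measurable_compose_countable)
  then show ?case by simp
qed simp

abbreviation unit_char :: "real \<Rightarrow> complex" where
  "unit_char t \<equiv> exp (2 * of_real pi * \<i> * of_real t)"

lemma norm_unit_char [simp]: "cmod (unit_char t) = 1"
proof -
  have "2 * of_real pi * \<i> * of_real t = \<i> * of_real (2 * pi * t)" by simp
  then show ?thesis by (simp only: norm_exp_i_times)
qed

text \<open>Fubini: with the seeds before \<open>j\<close> fixed the state is fixed, and the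
  integral over seed \<open>j\<close> is the finite average that \<open>B\<close> bounds for every
  state.\<close>

lemma chain_integral_bound:
  fixes N :: "nat \<Rightarrow> nat" and f :: "('i \<Rightarrow> int) \<Rightarrow> complex"
  defines "M \<equiv> \<lambda>j. measure_pmf (pmf_of_set {..<N j})"
  assumes N: "\<And>j. N j > 0" and f: "\<And>x. cmod (f x) \<le> 1"
    and B: "\<And>x. cmod (\<Sum>u<N j. f (G j x u)) \<le> real (N j) * B"
  shows "cmod (\<integral>\<omega>. f (chain G \<omega> (Suc j)) \<partial>(PiM UNIV M)) \<le> B"
proof -
  have prob: "prob_space (M i)" for i unfolding M_def by (rule prob_space_measure_pmf)
  have setsM: "sets (M i) = UNIV" for i by (simp add: M_def)
  interpret product_prob_space M UNIV by (rule product_prob_spaceI[OF prob])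
  interpret A: prob_space "PiM {..<j} M" by (rule prob_space_PiM[OF prob])
  interpret B: prob_space "PiM (insert j {..<j}) M" by (rule prob_space_PiM[OF prob])
  have B0: "B \<ge> 0"
    using order_trans[OF norm_ge_zero B[of undefined]] N[of j] by (simp add: zero_le_mult_iff)
  have meas: "(\<lambda>\<omega>. f (chain G \<omega> (Suc j))) \<in> borel_measurable (PiM (insert j {..<j}) M)"
    using chain_measurable[of "Suc j" "insert j {..<j}" M G] setsM
    by (intro measurable_compose[of "\<lambda>\<omega>. chain G \<omega> (Suc j)" _ "count_space UNIV" f borel])
      (auto simp: lessThan_Suc)
  \<comment> \<open>Only finitely many seeds matter; passing to their finite product allows the last
    one to be split off.\<close>
  have "(\<integral>\<omega>. f (chain G \<omega> (Suc j)) \<partial>(PiM UNIV M))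
      = (\<integral>\<omega>. f (chain G (restrict \<omega> (insert j {..<j})) (Suc j)) \<partial>(PiM UNIV M))"
    by (intro Bochner_Integration.integral_cong refl arg_cong[where f = f] chain_cong) auto
  also have "\<dots> = (\<integral>\<omega>. f (chain G \<omega> (Suc j)) \<partial>(distr (PiM UNIV M) (PiM (insert j {..<j}) M) (\<lambda>\<omega>. restrict \<omega> (insert j {..<j}))))"
    by (rule integral_distr[OF measurable_restrict_subset meas, symmetric]) simp
  also have "\<dots> = (\<integral>\<omega>. f (chain G \<omega> (Suc j)) \<partial>(PiM (insert j {..<j}) M))"
    by (subst distr_PiM_restrict_finite) simp_all
  also have "\<dots> = (\<integral>\<omega>. (\<integral>u. f (chain G (fun_upd \<omega> j u) (Suc j)) \<partial>(M j)) \<partial>(PiM {..<j} M))"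
    by (rule product_integral_insert)
      (use f meas in \<open>auto intro!: B.integrable_const_bound[of _ 1]\<close>)
  also have "cmod \<dots> \<le> B"
  proof (rule A.norm_integral_le[OF _ B0])
    fix \<omega> :: "nat \<Rightarrow> nat"
    have "chain G (fun_upd \<omega> j u) (Suc j) = G j (chain G \<omega> j) u" for u
      using chain_cong[of j "fun_upd \<omega> j u" \<omega> G] by simp
    then have "(\<integral>u. f (chain G (fun_upd \<omega> j u) (Suc j)) \<partial>(M j)) = (\<integral>u. f (G j (chain G \<omega> j) u) \<partial>(M j))"
      by simp
    also have "\<dots> = (\<Sum>u<N j. f (G j (chain G \<omega> j) u)) / of_nat (N j)"
      unfolding M_def using N[of j]
      by (subst integral_measure_pmf[where A = "{..<N j}"])
        (auto simp: lessThan_empty_iff scaleR_conv_of_real sum_divide_distrib)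
    also have "cmod \<dots> \<le> B"
      using B[of "chain G \<omega> j"] N[of j] by (simp add: norm_divide field_simps)
    finally show "cmod (\<integral>u. f (chain G (fun_upd \<omega> j u) (Suc j)) \<partial>(M j)) \<le> B" .
  qed
  finally show ?thesis .
qed

text \<open>The measure is the law of \<open>X\<close>, the limit of
  \<open>chain G \<omega>\<close>. The seeds \<open>\<omega>\<close> attached to a point of the
  support depend on \<open>j\<close>, because the point is only approximated by values of
  \<open>X\<close>. In the Fourier bound, \<open>l \<le> K (Suc j)\<close> allows \<open>X\<close>
  to be replaced by the integers reached after step \<open>j\<close>.\<close>

lemma chain_measure_exists:
  fixes I :: "'i set" and K N :: "nat \<Rightarrow> nat"
    and G :: "nat \<Rightarrow> ('i \<Rightarrow> int) \<Rightarrow> nat \<Rightarrow> ('i \<Rightarrow> int)"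
  assumes I: "finite I" and K: "strict_mono K" and N: "\<And>j. N j > 0"
    and G: "\<And>j x u i. i \<in> I \<Longrightarrow> [G j x u i = x i] (mod int CARD('p) ^ K j)"
  shows "\<exists>\<mu> :: ('i \<Rightarrow> 'p::prime_card padic) measure.
    sets \<mu> = sets (borel_sigma (padic_vec_topology I)) \<and> prob_space \<mu> \<and>
    (\<forall>x \<in> closed_support (padic_vec_topology I) \<mu>. x \<in> vecs I \<and>
       (\<forall>j. \<exists>\<omega>. \<forall>i\<in>I. padic_norm (x i - of_int (chain G \<omega> j i)) \<le> 1 / real CARD('p) ^ K j)) \<and>
    (\<forall>\<xi> b l j B. (\<forall>i\<in>I. padic_norm (\<xi> i - of_int (b i) / of_nat CARD('p) ^ l) \<le> 1) \<longrightarrow> l \<le> K (Suc j) \<longrightarrow>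
       (\<forall>x. cmod (\<Sum>u<N j. unit_char (of_int (\<Sum>i\<in>I. G j x u i * b i) / real CARD('p) ^ l)) \<le> real (N j) * B) \<longrightarrow>
       cmod (padic_fourier I \<mu> \<xi>) \<le> B)"
proof -
  define T where "T = (padic_vec_topology I :: ('i \<Rightarrow> 'p padic) topology)"
  define M where "M = (\<lambda>j. measure_pmf (pmf_of_set {..<N j}))"
  define \<Omega> where "\<Omega> = PiM UNIV M"
  have prob: "prob_space (M i)" for i unfolding M_def by (rule prob_space_measure_pmf)
  interpret \<Omega>: prob_space \<Omega> unfolding \<Omega>_def by (rule prob_space_PiM[OF prob])
  have space\<Omega>: "space \<Omega> = UNIV" by (auto simp: \<Omega>_def M_def space_PiM PiE_iff)
  have "\<exists>z :: 'p padic. \<forall>j. padic_norm (z - of_int (chain G \<omega> j i)) \<le> 1 / real CARD('p) ^ K j"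
    if i: "i \<in> I" for \<omega> i
  proof (rule padic_limit_of_compatible_ints)
    show "[chain G \<omega> (Suc j) i = chain G \<omega> j i] (mod int CARD('p) ^ K j)" for j
      using G[OF i] by simp
  qed (use K in auto)
  note lim = this
  define Z where
    "Z \<omega> i = (SOME z :: 'p padic. \<forall>j. padic_norm (z - of_int (chain G \<omega> j i)) \<le> 1 / real CARD('p) ^ K j)" for \<omega> i
  have Z: "padic_norm (Z \<omega> i - of_int (chain G \<omega> j i)) \<le> 1 / real CARD('p) ^ K j" if "i \<in> I" for \<omega> i j
    using someI_ex[OF lim[OF that]] unfolding Z_def by blast
  define X where "X \<omega> = restrict (Z \<omega>) I" for \<omega>
  define c where "c \<omega> j = (\<lambda>i\<in>I. of_int (chain G \<omega> j i) :: 'p padic)" for \<omega> j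
  have X: "X \<omega> \<in> padic_cyl I (c \<omega> j) (K j)" for \<omega> j
    using Z by (auto simp: X_def c_def padic_cyl_def)
  have cX: "c \<omega> j \<in> padic_cyl I (X \<omega>) (K j)" for \<omega> j
    by (rule padic_cyl_sym[OF X]) (simp add: c_def)
  have Xmeas: "X \<in> measurable \<Omega> (borel_sigma T)"
    unfolding borel_sigma_def
  proof (rule measurable_measure_of)
    show "{U. openin T U} \<subseteq> Pow (topspace T)" by (auto dest: openin_subset)
    show "X \<in> space \<Omega> \<rightarrow> topspace T" by (auto simp: X_def T_def)
    fix U assume "U \<in> {U. openin T U}"
    then have U: "\<And>x. x \<in> U \<Longrightarrow> \<exists>n. padic_cyl I x n \<subseteq> U" by (simp add: T_def openin_padic_vec_topology[OF I])
    \<comment> \<open>Every point of a cylinder is a centre of it, so the cylinders around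
      \<open>X \<omega>\<close> may be centred at integer vectors; the event is thereby expressed
      through countably many discrete states.\<close>
    have "X -` U = (\<Union>j. (\<lambda>\<omega>. chain G \<omega> j) -` {a. padic_cyl I (\<lambda>i\<in>I. of_int (a i)) (K j) \<subseteq> U})"
    proof (intro equalityI subsetI)
      fix \<omega> assume "\<omega> \<in> X -` U"
      then obtain n where n: "padic_cyl I (X \<omega>) n \<subseteq> U" using U by auto
      have "n \<le> K n" by (rule strict_mono_imp_increasing[OF K])
      have "X \<omega> \<in> padic_cyl I (X \<omega>) n" by (simp add: padic_cyl_def X_def)
      then have "padic_cyl I (X \<omega>) (K n) \<subseteq> padic_cyl I (X \<omega>) n"
        using \<open>n \<le> K n\<close> by (blast intro: padic_cyl_trans)
      then have "padic_cyl I (c \<omega> n) (K n) \<subseteq> padic_cyl I (X \<omega>) n"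
        using padic_cyl_trans[OF cX order_refl] by blast
      then show "\<omega> \<in> (\<Union>j. (\<lambda>\<omega>. chain G \<omega> j) -` {a. padic_cyl I (\<lambda>i\<in>I. of_int (a i)) (K j) \<subseteq> U})"
        using n unfolding c_def by blast
    next
      fix \<omega> assume "\<omega> \<in> (\<Union>j. (\<lambda>\<omega>. chain G \<omega> j) -` {a. padic_cyl I (\<lambda>i\<in>I. of_int (a i)) (K j) \<subseteq> U})"
      then show "\<omega> \<in> X -` U" using X[of \<omega>] unfolding c_def by blast
    qed
    moreover have "(\<lambda>\<omega>. chain G \<omega> j) -` A \<in> sets \<Omega>" for j A
      using measurable_sets[OF chain_measurable[of j UNIV M G], of A] space\<Omega>
      by (simp add: \<Omega>_def M_def)
    ultimately show "X -` U \<inter> space \<Omega> \<in> sets \<Omega>"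
      by (simp only: space\<Omega> Int_UNIV_right sets.countable_UN image_subset_iff ball_UNIV simp_thms)
  qed
  define \<mu> where "\<mu> = distr \<Omega> (borel_sigma T) X"
  show ?thesis
  proof (intro exI[of _ \<mu>] conjI ballI allI impI)
    show "sets \<mu> = sets (borel_sigma (padic_vec_topology I))" by (simp add: \<mu>_def T_def)
    show "prob_space \<mu>" unfolding \<mu>_def by (rule \<Omega>.prob_space_distr[OF Xmeas])
    fix x assume x: "x \<in> closed_support (padic_vec_topology I) \<mu>"
    then show xv: "x \<in> vecs I" by (simp add: closed_support_def)
    fix j
    have op: "openin T (padic_cyl I x (K j))" unfolding T_def by (rule openin_padic_cyl[OF I])
    have "x \<in> padic_cyl I x (K j)" using xv by (simp add: padic_cyl_def)
    then have "emeasure \<mu> (padic_cyl I x (K j)) > 0"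
      using x op by (simp add: closed_support_def T_def)
    then have "emeasure \<Omega> (X -` padic_cyl I x (K j)) > 0"
      using emeasure_distr[OF Xmeas openin_imp_sets_borel_sigma[OF op]] by (simp add: \<mu>_def space\<Omega>)
    then have "X -` padic_cyl I x (K j) \<noteq> {}" by auto
    then obtain \<omega> where "X \<omega> \<in> padic_cyl I x (K j)" by blast
    then have "x \<in> padic_cyl I (X \<omega>) (K j)" by (rule padic_cyl_sym[OF _ xv])
    then have "x \<in> padic_cyl I (c \<omega> j) (K j)" by (rule padic_cyl_trans[OF X order_refl])
    then show "\<exists>\<omega>. \<forall>i\<in>I. padic_norm (x i - of_int (chain G \<omega> j i)) \<le> 1 / real CARD('p) ^ K j"
      by (auto simp: padic_cyl_def c_def)
  next
    fix \<xi> :: "'i \<Rightarrow> 'p padic" and b l j B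
    assume \<xi>: "\<forall>i\<in>I. padic_norm (\<xi> i - of_int (b i) / of_nat CARD('p) ^ l) \<le> 1" and l: "l \<le> K (Suc j)"
      and B: "\<forall>x. cmod (\<Sum>u<N j. unit_char (of_int (\<Sum>i\<in>I. G j x u i * b i) / real CARD('p) ^ l)) \<le> real (N j) * B"
    define f where "f a = unit_char (of_int (\<Sum>i\<in>I. a i * b i) / real CARD('p) ^ l)" for a
    have "1 / real CARD('p) ^ K (Suc j) \<le> 1 / real CARD('p) ^ l"
      using prime_card_gt_1[where 'p = 'p] l by (intro divide_left_mono power_increasing) auto
    then have "padic_norm (X \<omega> i - of_int (chain G \<omega> (Suc j) i)) \<le> 1 / real CARD('p) ^ l" if "i \<in> I" for \<omega> i
      using order_trans[OF Z[OF that, of \<omega> "Suc j"]] that by (simp add: X_def)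
    then have char: "padic_char I \<xi> (X \<omega>) = f (chain G \<omega> (Suc j))" for \<omega>
      unfolding f_def by (intro padic_char_rational[OF I]) (use \<xi> in auto)
    have "padic_fourier I \<mu> \<xi> = (\<integral>\<omega>. padic_char I \<xi> (X \<omega>) \<partial>\<Omega>)"
      unfolding padic_fourier_def \<mu>_def
      by (rule integral_distr[OF Xmeas]) (simp only: T_def padic_char_measurable[OF I])
    also have "\<dots> = (\<integral>\<omega>. f (chain G \<omega> (Suc j)) \<partial>\<Omega>)" by (simp only: char)
    also have "cmod \<dots> \<le> B"
      unfolding \<Omega>_def M_def
      by (rule chain_integral_bound[OF N]) (use B in \<open>simp_all only: f_def norm_unit_char order_refl\<close>)
    finally show "cmod (padic_fourier I \<mu> \<xi>) \<le> B" .
  qed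
qed

section \<open>A lower bound for the number of primes\<close>

text \<open>The entries of the Leibniz harmonic triangle satisfy
  \<open>1 / ((k+1) C(n,k+1)) = 1 / (k C(n-1,k)) - 1 / (k C(n,k))\<close>.\<close>

lemma Lcm_over_binomial_Ints:
  assumes "1 \<le> k" "k \<le> n"
  shows "real (Lcm {1..n}) / (real k * real (n choose k)) \<in> \<int>"
  using assms
proof (induction k arbitrary: n rule: dec_induct)
  case base
  have "n dvd Lcm {1..n}" using base by (intro dvd_Lcm) auto
  then show ?case by (auto elim!: dvdE)
next
  case (step k)
  then obtain N where n: "n = Suc N" "k \<le> N" by (cases n) auto
  have pos: "real (N choose k) > 0" "real (n choose k) > 0" "real k > 0" using n step by auto
  have "Lcm {1..N} dvd Lcm {1..n}" by (rule Lcm_subset) (use n in auto)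
  then obtain d where d: "Lcm {1..n} = Lcm {1..N} * d" by (elim dvdE)
  have "real (Lcm {1..n}) / (real k * real (N choose k))
      = real d * (real (Lcm {1..N}) / (real k * real (N choose k)))"
    unfolding d by simp
  also have "\<dots> \<in> \<int>" using step.IH[OF n(2)] by (intro Ints_mult) auto
  finally have 1: "real (Lcm {1..n}) / (real k * real (N choose k)) \<in> \<int>" .
  have 2: "real (Lcm {1..n}) / (real k * real (n choose k)) \<in> \<int>" using step n by simp
  have a: "real (Suc k) * real (n choose Suc k) = real n * real (N choose k)"
    using Suc_times_binomial[of k N] unfolding n by (simp only: of_nat_mult[symmetric])
  have "(n - k) * (n choose k) = n * (N choose k)" using binomial_absorb_comp[of n k] n by simp
  then have b: "(real n - real k) * real (n choose k) = real n * real (N choose k)"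
    using n by (simp only: of_nat_mult[symmetric] of_nat_diff[symmetric] le_SucI)
  have nk: "real n - real k > 0" using n by simp
  have "1 / (real (Suc k) * real (n choose Suc k)) = 1 / (real k * real (N choose k)) - 1 / (real k * real (n choose k))"
  proof -
    have "1 / (r * X) = 1 / (s * X) - 1 / (s * Y)"
      if "(r - s) * Y = r * X" "X > 0" "Y > 0" "s > 0" "r > 0" for r s X Y :: real
    proof -
      have "1 / (s * X) - 1 / (s * Y) = (Y - X) / (s * X * Y)" using that by (simp add: field_simps)
      also have "Y - X = s * Y / r" using that by (simp add: field_simps)
      also have "s * Y / r / (s * X * Y) = 1 / (r * X)" using that by (simp add: field_simps)
      finally show ?thesis by simp
    qed
    from this[OF b pos] show ?thesis unfolding a using nk pos by simp
  qed
  then have "real (Lcm {1..n}) / (real (Suc k) * real (n choose Suc k))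
     = real (Lcm {1..n}) / (real k * real (N choose k)) - real (Lcm {1..n}) / (real k * real (n choose k))"
    by (metis (no_types, opaque_lifting) mult.right_neutral right_diff_distrib times_divide_eq_right)
  then show ?case using 1 2 by simp
qed

text \<open>A positive integer is at least 1; the factor \<open>k\<close> of the triangle entry is
  dropped.\<close>

lemma binomial_le_Lcm:
  assumes "1 \<le> k" "k \<le> n"
  shows "n choose k \<le> Lcm {1..n}"
proof -
  define x where "x = real (Lcm {1..n}) / (real k * real (n choose k))"
  have "Lcm {1..n} > 0" by (simp add: Lcm_0_iff zero_less_iff_neq_zero)
  then have "x > 0" using assms by (simp add: x_def)
  then have "x \<ge> 1" using Lcm_over_binomial_Ints[OF assms] unfolding x_def[symmetric]
    by (auto elim!: Ints_cases)
  then have "real k * real (n choose k) \<le> real (Lcm {1..n})"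
    using assms by (simp add: x_def field_simps)
  moreover have "1 * real (n choose k) \<le> real k * real (n choose k)"
    using assms by (intro mult_right_mono) auto
  ultimately show ?thesis by simp
qed

lemma prime_power_dvd_Lcm:
  fixes A :: "nat set"
  assumes "finite A" "prime q" "e > 0" "0 \<notin> A" "q ^ e dvd Lcm A"
  shows "\<exists>a\<in>A. q ^ e dvd a"
  using assms(1,4,5)
proof (induction A rule: finite_induct)
  case empty
  then show ?case using assms(2,3) by (auto dest: prime_gt_1_nat)
next
  case (insert a A)
  have nz: "a \<noteq> 0" "Lcm A \<noteq> 0" using insert by (auto simp: Lcm_0_iff)
  have u: "\<not> is_unit q" using assms(2) not_prime_unit by blast
  have "e \<le> multiplicity q (lcm a (Lcm A))"
    using insert.prems nz u by (subst (asm) power_dvd_iff_le_multiplicity) (auto simp: lcm_eq_0_iff)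
  also have "\<dots> = max (multiplicity q a) (multiplicity q (Lcm A))"
    using nz assms(2) by (intro multiplicity_lcm) auto
  finally have "q ^ e dvd a \<or> q ^ e dvd Lcm A"
    using nz u by (auto simp: power_dvd_iff_le_multiplicity le_max_iff_disj)
  then show ?case using insert by auto
qed

text \<open>Each full prime power in the lcm divides one of \<open>1..n\<close>, so it is at most
  \<open>n\<close>, and only primes up to \<open>n\<close> occur.\<close>

lemma Lcm_le_power_card_primes:
  "Lcm {1..n} \<le> n ^ card {q :: nat. prime q \<and> q \<le> n}"
proof -
  define L :: nat where "L = Lcm {1..n}"
  have L: "L \<noteq> 0" by (simp add: L_def Lcm_0_iff)
  have le: "q ^ multiplicity q L \<le> n" if q: "q \<in> prime_factors L" for q
  proof -
    have pr: "prime q" "multiplicity q L > 0" using q by (auto simp: prime_factors_multiplicity)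
    have "\<exists>a\<in>{1..n}. q ^ multiplicity q L dvd a"
      by (rule prime_power_dvd_Lcm) (use pr multiplicity_dvd[of q L] in \<open>auto simp: L_def\<close>)
    then show ?thesis by (auto dest!: dvd_imp_le)
  qed
  have sub: "prime_factors L \<subseteq> {q. prime q \<and> q \<le> n}"
  proof
    fix q assume q: "q \<in> prime_factors L"
    then have "prime q" "multiplicity q L > 0" by (auto simp: prime_factors_multiplicity)
    then have "q ^ 1 \<le> q ^ multiplicity q L" by (intro power_increasing) (auto dest: prime_gt_0_nat)
    then show "q \<in> {q. prime q \<and> q \<le> n}" using le[OF q] \<open>prime q\<close> by simp
  qed
  show ?thesis
  proof (cases "n = 0")
    case False
    have "L = (\<Prod>q\<in>prime_factors L. q ^ multiplicity q L)" using L by (simp add: prod_prime_factors)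
    also have "\<dots> \<le> (\<Prod>q\<in>prime_factors L. n)" by (intro prod_mono) (use le in auto)
    also have "\<dots> = n ^ card (prime_factors L)" by simp
    also have "\<dots> \<le> n ^ card {q. prime q \<and> q \<le> n}"
      using False by (intro power_increasing card_mono sub) auto
    finally show ?thesis by (simp add: L_def)
  next
    \<comment> \<open>Both sides are 1 here, the right one by \<open>0 ^ 0 = 1\<close>.\<close>
    case True
    then have empty: "{q :: nat. prime q \<and> q \<le> n} = {}" by (auto dest: prime_gt_0_nat)
    show ?thesis unfolding empty using True by simp
  qed
qed

text \<open>Logarithms of the chain from \<open>4^N / (2N)\<close> through the central binomial
  coefficient and the lcm of \<open>1..2N\<close> to a power of \<open>2N\<close>.\<close>

lemma card_primes_lower_bound:
  assumes "N \<ge> 1"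
  shows "real N * ln 4 - ln (2 * real N) \<le> real (card {q :: nat. prime q \<and> q \<le> 2 * N}) * ln (2 * real N)"
proof -
  define c where "c = card {q. prime q \<and> q \<le> 2 * N}"
  have "4 ^ N / (2 * real N) \<le> real (2 * N choose N)"
    using central_binomial_lower_bound[of N] assms by simp
  also have "\<dots> \<le> real (Lcm {1..2 * N})"
    using binomial_le_Lcm[of N "2 * N"] assms by simp
  also have "\<dots> \<le> real ((2 * N) ^ c)" unfolding c_def by (intro of_nat_mono Lcm_le_power_card_primes)
  finally have "4 ^ N / (2 * real N) \<le> (2 * real N) ^ c" by simp
  then have "ln (4 ^ N / (2 * real N)) \<le> ln ((2 * real N) ^ c)"
    using assms by (subst ln_le_cancel_iff) auto
  moreover have "ln ((2 * real N) ^ c) = real c * ln (2 * real N)" by (rule ln_realpow)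
  ultimately show ?thesis using assms by (simp add: ln_div ln_realpow c_def[symmetric])
qed

text \<open>Half of Chebyshev's constant \<open>ln 2\<close> is given up to pay for
  \<open>p\<close>, for the primes below \<open>p^h\<close> (at most the square root of
  \<open>p^(2h)\<close> in number) and for lower order terms. Up to a constant, \<open>1 / h\<close>
  is \<open>1 / ln (p^(2h))\<close>.\<close>

lemma card_primes_between_powers:
  assumes p: "prime p"
  obtains c :: real and H where "c > 0"
    "\<And>h. h \<ge> H \<Longrightarrow> real (card {q. prime q \<and> q \<noteq> p \<and> p ^ h \<le> q \<and> q < p ^ (2 * h)}) \<ge> c * real p ^ (2 * h) / real h"
proof -
  have p2: "p \<ge> 2" using p by (rule prime_ge_2_nat)
  define c where "c = ln 2 / 4 / ln (real p)"
  \<comment> \<open>With \<open>x = p^(2h)\<close>: \<open>(x - 1) / 2\<close> bounds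
    \<open>N\<close> from below, \<open>2 * ln 2\<close> is \<open>ln 4\<close>, and
    \<open>sqrt x + 1\<close> counts the numbers below \<open>p^h\<close> together with
    \<open>p\<close>.\<close>
  have "eventually (\<lambda>x::real. ((x - 1) / 2 * (2 * ln 2) - ln x) / ln x - sqrt x - 1 \<ge> (ln 2 / 2) * x / ln x) at_top"
    by real_asymp
  moreover have "filterlim (\<lambda>h::nat. real p ^ (2 * h)) at_top at_top" using p2 by real_asymp
  ultimately have "eventually (\<lambda>h::nat. ((real p ^ (2 * h) - 1) / 2 * (2 * ln 2) - ln (real p ^ (2 * h))) / ln (real p ^ (2 * h))
      - sqrt (real p ^ (2 * h)) - 1 \<ge> (ln 2 / 2) * real p ^ (2 * h) / ln (real p ^ (2 * h))) at_top"
    by (rule eventually_compose_filterlim)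
  then obtain H where H: "\<And>h. h \<ge> H \<Longrightarrow> ((real p ^ (2 * h) - 1) / 2 * (2 * ln 2) - ln (real p ^ (2 * h))) / ln (real p ^ (2 * h))
      - sqrt (real p ^ (2 * h)) - 1 \<ge> (ln 2 / 2) * real p ^ (2 * h) / ln (real p ^ (2 * h))"
    unfolding eventually_sequentially by blast
  show thesis
  proof (rule that[of c "max H 1"])
    show "c > 0" using p2 by (simp add: c_def)
    fix h assume h: "max H 1 \<le> h"
    define x where "x = real p ^ (2 * h)"
    define N where "N = p ^ (2 * h) div 2"
    define A where "A = {q. prime q \<and> q \<le> 2 * N}"
    define B where "B = {q. prime q \<and> q \<noteq> p \<and> p ^ h \<le> q \<and> q < p ^ (2 * h)}"
    have big: "p ^ (2 * h) \<ge> p ^ 2" using p2 h by (intro power_increasing) auto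
    have "p ^ 2 \<ge> 2 ^ 2" using p2 by (rule power_mono) simp
    then have "p ^ (2 * h) \<ge> 4" using big by simp
    then have N1: "N \<ge> 1" and N2: "2 * N \<le> p ^ (2 * h)" "p ^ (2 * h) \<le> 2 * N + 1" by (auto simp: N_def)
    have x: "2 * real N \<le> x" "x \<le> 2 * real N + 1"
      using of_nat_mono[OF N2(1), where 'a = real] of_nat_mono[OF N2(2), where 'a = real] by (simp_all add: x_def)
    have lnN: "ln (2 * real N) \<le> ln x" "ln (2 * real N) > 0" using N1 x by auto
    have lnx: "ln x = 2 * real h * ln (real p)" "ln x > 0" using lnN p2 by (simp_all add: x_def ln_realpow)
    have ln4: "ln 4 = 2 * ln (2::real)" using ln_realpow[of 2 2] by simp
    have "(x - 1) / 2 * (2 * ln 2) - ln x \<le> real N * ln 4 - ln (2 * real N)"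
      using x lnN(1) unfolding ln4 by (intro diff_mono mult_right_mono) auto
    also have "\<dots> \<le> real (card A) * ln (2 * real N)" unfolding A_def by (rule card_primes_lower_bound[OF N1])
    also have "\<dots> \<le> real (card A) * ln x" using lnN by (intro mult_left_mono) auto
    finally have cA: "((x - 1) / 2 * (2 * ln 2) - ln x) / ln x \<le> real (card A)"
      using lnx by (simp add: field_simps)
    have "A \<subseteq> B \<union> {..<p ^ h} \<union> {p}"
    proof
      fix q assume q: "q \<in> A"
      \<comment> \<open>\<open>A\<close> may reach \<open>p^(2h)\<close>, whereas \<open>B\<close>
        stays below it; the endpoint is a proper power, hence not prime.\<close>
      have "q \<noteq> p ^ (2 * h)"
        using q h by (auto simp: A_def prime_power_iff)
      then show "q \<in> B \<union> {..<p ^ h} \<union> {p}" using q N2 by (auto simp: A_def B_def)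
    qed
    then have "card A \<le> card (B \<union> {..<p ^ h} \<union> {p})"
      by (rule card_mono[rotated]) (auto simp: B_def)
    also have "\<dots> \<le> card B + card {..<p ^ h} + card {p}"
      by (intro order_trans[OF card_Un_le] add_mono) auto
    finally have "real (card A) \<le> real (card B) + real p ^ h + 1"
      by (simp flip: of_nat_power)
    moreover have "sqrt x = real p ^ h" unfolding x_def by (simp add: power_mult power2_eq_square mult.commute[of 2] real_sqrt_power)
    ultimately have "(ln 2 / 2) * x / ln x \<le> real (card B)"
      using cA H[of h] h unfolding x_def by simp
    moreover have "c * x / real h = (ln 2 / 2) * x / ln x" unfolding lnx c_def by simp
    ultimately show "c * real p ^ (2 * h) / real h \<le> real (card {q. prime q \<and> q \<noteq> p \<and> p ^ h \<le> q \<and> q < p ^ (2 * h)})"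
      by (simp add: x_def B_def)
  qed
qed

section \<open>Dirichlet kernels at quotients by primes\<close>

lemma unit_char_add: "unit_char (s + t) = unit_char s * unit_char t"
  by (simp add: distrib_left exp_add)

lemma unit_char_of_int: "unit_char (of_int k) = 1"
  using exp_frac[of "of_int k"] by simp

lemma unit_char_mult_of_nat: "unit_char (real u * t) = unit_char t ^ u"
  by (simp add: exp_of_nat_mult[symmetric] mult_ac)

lemma unit_char_cong:
  assumes "[a = b] (mod q)" "q \<noteq> 0"
  shows "unit_char (of_int a / of_int q) = unit_char (of_int b / of_int q)"
proof -
  obtain k where "a - b = q * k" using assms(1) by (auto simp: cong_iff_dvd_diff elim!: dvdE)
  then have "real_of_int a = of_int b + of_int q * of_int k"
    by (metis add.commute diff_add_cancel of_int_add of_int_mult)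
  then have "real_of_int a / of_int q = of_int b / of_int q + of_int k"
    using assms(2) by (simp add: field_simps)
  then show ?thesis by (simp only: unit_char_add unit_char_of_int mult_1_right)
qed

lemma unit_char_eq_1_imp_dvd:
  assumes "unit_char (of_int a / of_int q) = 1" "q \<noteq> 0"
  shows "q dvd a"
proof -
  have "exp (\<i> * of_real (2 * pi * (of_int a / of_int q))) = 1" using assms(1) by (simp add: mult_ac)
  then obtain k where "2 * pi * (of_int a / of_int q) = of_int (2 * k) * pi"
    by (auto simp: exp_eq_1)
  then have "real_of_int a = of_int (q * k)" using assms(2) by (simp add: field_simps)
  then have "a = q * k" by (simp only: of_int_eq_iff)
  then show ?thesis by simp
qed

text \<open>The Dirichlet kernel up to a unimodular factor: \<open>n\<close> times the
  characteristic function of a uniform variable on \<open>0..<n\<close>.\<close>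

definition geom_char :: "nat \<Rightarrow> real \<Rightarrow> complex" where
  "geom_char n t = (\<Sum>u<n. unit_char (real u * t))"

lemma cmod_geom_char_le: "cmod (geom_char n t) \<le> real n"
  unfolding geom_char_def by (rule order_trans[OF norm_sum]) simp

lemma geom_char_eq_0:
  assumes "unit_char t \<noteq> 1" "unit_char (real n * t) = 1"
  shows "geom_char n t = 0"
proof -
  have "geom_char n t = (\<Sum>u<n. unit_char t ^ u)"
    unfolding geom_char_def by (simp only: unit_char_mult_of_nat)
  also have "\<dots> = (unit_char t ^ n - 1) / (unit_char t - 1)" using assms(1) by (rule geometric_sum)
  also have "unit_char t ^ n = 1" using assms(2) by (simp only: unit_char_mult_of_nat)
  finally show ?thesis by simp
qed

lemma geom_char_cong:
  assumes "unit_char s = unit_char t" shows "geom_char n s = geom_char n t"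
  unfolding geom_char_def unit_char_mult_of_nat assms ..

text \<open>Double the angle \<open>y / 2\<close> and apply the mean value theorem to
  \<open>sin (y / 2)\<close>: both cosines that arise are at least
  \<open>sqrt 2 / 2\<close>.\<close>

lemma sin_ge_half:
  assumes "0 \<le> y" "y \<le> pi / 2"
  shows "sin y \<ge> y / 2"
proof (cases "y = 0")
  case False
  then have "y / 2 > 0" using assms by simp
  then obtain z where z: "0 < z" "z < y / 2" "sin (y / 2) - sin 0 = (y / 2 - 0) * cos z"
    using MVT2[of 0 "y / 2" sin cos] DERIV_sin by blast
  have c: "cos x \<ge> sqrt 2 / 2" if "0 \<le> x" "x \<le> pi / 4" for x
    using cos_monotone_0_pi_le[of x "pi / 4"] that by (simp add: cos_45)
  have "sqrt 2 / 2 * (sqrt 2 / 2) \<le> cos z * cos (y / 2)"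
    using z assms by (intro mult_mono c) (auto intro!: cos_ge_zero)
  then have "y * (1 / 2) \<le> y * (cos z * cos (y / 2))"
    using assms by (intro mult_left_mono) auto
  also have "\<dots> = sin (2 * (y / 2))" using z(3) by (subst sin_double) simp
  finally show ?thesis by simp
qed simp

text \<open>In the geometric sum the numerator is at most 2 and the denominator
  \<open>2 |sin (pi t)|\<close> is at least \<open>2 |t|\<close>. The product form includes
  \<open>t = 0\<close>.\<close>

lemma cmod_geom_char_mult_le:
  assumes "\<bar>t\<bar> \<le> 1 / 2"
  shows "cmod (geom_char n t) * \<bar>t\<bar> \<le> 1"
proof (cases "t = 0")
  case False
  have eq: "2 * of_real pi * \<i> * of_real t = \<i> * of_real (2 * pi * t)" by simp
  have "cmod (unit_char t - 1) = 2 * \<bar>sin (pi * t)\<bar>"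
    unfolding eq dist_exp_i_1 by simp
  also have "\<bar>sin (pi * t)\<bar> = sin (pi * \<bar>t\<bar>)"
  proof -
    have "sin (pi * \<bar>t\<bar>) \<ge> 0" using assms by (intro sin_ge_zero) auto
    then show ?thesis by (cases "t \<ge> 0") auto
  qed
  finally have e: "cmod (unit_char t - 1) \<ge> pi * \<bar>t\<bar>"
    using sin_ge_half[of "pi * \<bar>t\<bar>"] assms by simp
  have "pi * \<bar>t\<bar> \<ge> 2 * \<bar>t\<bar>" using pi_ge_two by (intro mult_right_mono) auto
  then have e2: "cmod (unit_char t - 1) \<ge> 2 * \<bar>t\<bar>" using e by simp
  then have ne: "unit_char t \<noteq> 1" using False by auto
  have "geom_char n t = (\<Sum>u<n. unit_char t ^ u)"
    unfolding geom_char_def by (simp only: unit_char_mult_of_nat)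
  also have "\<dots> = (unit_char t ^ n - 1) / (unit_char t - 1)" using ne by (rule geometric_sum)
  finally have "cmod (geom_char n t) * cmod (unit_char t - 1) = cmod (unit_char t ^ n - 1)"
    using ne by (simp add: norm_divide)
  also have "\<dots> \<le> cmod (unit_char t ^ n) + cmod 1" by (rule norm_triangle_ineq4)
  also have "\<dots> = 2" by (simp only: norm_power norm_unit_char power_one norm_one)
  finally have "cmod (geom_char n t) * cmod (unit_char t - 1) \<le> 2" .
  moreover have "cmod (geom_char n t) * (2 * \<bar>t\<bar>) \<le> cmod (geom_char n t) * cmod (unit_char t - 1)"
    using e2 by (rule mult_left_mono) simp
  ultimately show ?thesis by simp
qed simp

section \<open>Prime divisors and the sum of the squared kernel over primes\<close>

lemma prod_primes_dvd:
  fixes A :: "nat set"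
  assumes "finite A" "\<And>q. q \<in> A \<Longrightarrow> prime q" "\<And>q. q \<in> A \<Longrightarrow> q dvd n"
  shows "\<Prod>A dvd n"
  using assms
proof (induction A rule: finite_induct)
  case (insert q A)
  have "coprime q (\<Prod>A)"
    by (rule prod_coprime_right) (use insert in \<open>metis insert_iff primes_coprime\<close>)
  then show ?case using insert by (auto intro!: divides_mult)
qed simp

text \<open>The product of the primes in \<open>A\<close> divides \<open>n\<close> and is at least
  \<open>Y ^ card A\<close>.\<close>

lemma card_prime_divisors_le:
  fixes A :: "nat set"
  assumes "finite A" "\<And>q. q \<in> A \<Longrightarrow> prime q \<and> q dvd n \<and> Y \<le> q" "n \<noteq> 0" "n \<le> Y ^ c" "Y \<ge> 2"
  shows "card A \<le> c"
proof -
  have "Y ^ card A = (\<Prod>q\<in>A. Y)" by simp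
  also have "\<dots> \<le> \<Prod>A" by (rule prod_mono) (use assms in auto)
  also have "\<dots> \<le> n" using prod_primes_dvd[of A n] assms by (intro dvd_imp_le) auto
  also have "\<dots> \<le> Y ^ c" by (rule assms)
  finally show ?thesis using assms(5) by simp
qed

text \<open>Telescoping, by comparison with \<open>1 / (s - 1) - 1 / s\<close>.\<close>

lemma sum_inverse_squares_le: "(\<Sum>s=2..M. 1 / real s ^ 2) \<le> 1"
proof -
  have "(\<Sum>s=2..M. 1 / real s ^ 2) \<le> 1 - 1 / real M" if "M \<ge> 1"
    using that
  proof (induction M rule: nat_induct_at_least)
    case (Suc M)
    have "1 / real (Suc M) ^ 2 \<le> 1 / (real M * real (Suc M))"
      using Suc by (intro divide_left_mono) (auto simp: power2_eq_square)
    also have "\<dots> = 1 / real M - 1 / real (Suc M)" using Suc by (simp add: field_simps)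
    finally show ?case using Suc by simp
  qed simp
  then show ?thesis by (cases "M = 0") (auto intro: order_trans)
qed

text \<open>The weight is the bound used for the squared normalised kernel. The 11 is 3 for
  \<open>t\<close> in -1, 0, 1 plus 4 for each sign.\<close>

lemma sum_int_inverse_squares_le:
  fixes T :: "int set"
  assumes "finite T"
  shows "(\<Sum>t\<in>T. if \<bar>t\<bar> \<le> 1 then 1 else 4 / real_of_int t ^ 2) \<le> 11"
proof -
  define w where "w t = (if \<bar>t\<bar> \<le> 1 then 1 else 4 / real_of_int t ^ 2)" for t :: int
  define M where "M = (\<Sum>t\<in>T. nat \<bar>t\<bar>)"
  have "T \<subseteq> {-1, 0, 1} \<union> (int ` {2..M} \<union> (\<lambda>s. - int s) ` {2..M})"
  proof
    fix t assume t: "t \<in> T"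
    have "nat \<bar>t\<bar> \<le> M" unfolding M_def by (rule member_le_sum[OF t _ assms]) simp
    moreover have "t = int (nat \<bar>t\<bar>) \<or> t = - int (nat \<bar>t\<bar>)" by auto
    moreover have "nat \<bar>t\<bar> \<ge> 2 \<or> t \<in> {-1, 0, 1}" by auto
    ultimately show "t \<in> {-1, 0, 1} \<union> (int ` {2..M} \<union> (\<lambda>s. - int s) ` {2..M})"
      by (metis Un_iff atLeastAtMost_iff image_eqI)
  qed
  then have "sum w T \<le> sum w ({-1, 0, 1} \<union> (int ` {2..M} \<union> (\<lambda>s. - int s) ` {2..M}))"
    by (intro sum_mono2) (auto simp: w_def)
  also have "\<dots> \<le> sum w {-1, 0, 1} + sum w (int ` {2..M} \<union> (\<lambda>s. - int s) ` {2..M})"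
    by (subst sum_Un) (auto intro!: sum_nonneg simp: w_def)
  also have "sum w (int ` {2..M} \<union> (\<lambda>s. - int s) ` {2..M}) \<le> sum w (int ` {2..M}) + sum w ((\<lambda>s. - int s) ` {2..M})"
    by (subst sum_Un) (auto intro!: sum_nonneg simp: w_def)
  also have "sum w (int ` {2..M}) = (\<Sum>s=2..M. 4 / real s ^ 2)"
    by (subst sum.reindex) (auto simp: inj_on_def w_def intro!: sum.cong)
  also have "sum w ((\<lambda>s. - int s) ` {2..M}) = (\<Sum>s=2..M. 4 / real s ^ 2)"
    by (subst sum.reindex) (auto simp: inj_on_def w_def intro!: sum.cong)
  also have "(\<Sum>s=2..M. 4 / real s ^ 2) = 4 * (\<Sum>s=2..M. 1 / real s ^ 2)" by (simp add: sum_distrib_left)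
  also have "sum w {-1, 0, 1} = 3" by (simp add: w_def)
  finally show ?thesis using sum_inverse_squares_le[of M] by (simp add: w_def)
qed

text \<open>Normalise \<open>a q\<close> to \<open>\<bar>a q\<bar> \<le> p^l / 2\<close> and write \<open>a q * q = b + t p^l\<close>. Then the normalised kernel is at
  most \<open>2 / \<bar>t\<bar>\<close> if \<open>\<bar>t\<bar> > 1\<close>, and at most \<open>c\<close> of the primes \<open>q\<close> divide a given \<open>b + t p^l\<close>.\<close>

lemma sum_kernel_over_primes_le:
  fixes p h l c :: nat and b :: int and a :: "nat \<Rightarrow> int" and A :: "nat set"
  assumes p: "prime p" and A: "finite A" "\<And>q. q \<in> A \<Longrightarrow> prime q \<and> p ^ h \<le> q \<and> q < p ^ (2 * h)"
    and h: "h \<ge> 1" and l: "l \<ge> 1" and b: "\<not> int p dvd b"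
    and a: "\<And>q. q \<in> A \<Longrightarrow> [a q * int q = b] (mod int p ^ l)" and c: "l + 2 * h \<le> h * c"
  shows "(\<Sum>q\<in>A. (cmod (geom_char (p ^ (2 * h)) (of_int (a q) / real p ^ l)) / real p ^ (2 * h)) ^ 2) \<le> 11 * real c"
proof -
  have p2: "p \<ge> 2" using p by (rule prime_ge_2_nat)
  define Q where "Q = int p ^ l"
  have Q: "Q > 0" using p2 by (simp add: Q_def)
  define b' where "b' = b mod Q"
  have b': "0 \<le> b'" "b' < Q" using Q by (simp_all add: b'_def)
  define H where "H = real p ^ (2 * h)"
  have H: "H > 0" using p2 by (simp add: H_def)
  define a' where "a' q = (if 2 * (a q mod Q) \<le> Q then a q mod Q else a q mod Q - Q)" for q
  have a'_le: "2 * \<bar>a' q\<bar> \<le> Q" for q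
    using pos_mod_bound[OF Q, of "a q"] pos_mod_sign[OF Q, of "a q"] by (auto simp: a'_def)
  have a'_cong: "[a' q = a q] (mod Q)" for q
    unfolding a'_def by (auto simp: cong_def) 
  define t where "t q = (a' q * int q - b') div Q" for q
  have aq: "a' q * int q = b' + t q * Q" if "q \<in> A" for q
  proof -
    have "[a' q * int q = a q * int q] (mod Q)" by (intro cong_mult a'_cong cong_refl)
    also have "[a q * int q = b] (mod Q)" using a[OF that] by (simp add: Q_def)
    also have "[b = b'] (mod Q)" by (simp add: b'_def cong_def)
    finally have "Q dvd a' q * int q - b'" by (simp add: cong_iff_dvd_diff)
    then show ?thesis by (simp add: t_def)
  qed
  define w where "w t = (if \<bar>t\<bar> \<le> 1 then 1 else 4 / real_of_int t ^ 2)" for t :: int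
  define D where "D q = cmod (geom_char (p ^ (2 * h)) (of_int (a q) / real p ^ l)) / H" for q
  have "D q ^ 2 \<le> w (t q)" if q: "q \<in> A" for q
  proof -
    define \<theta> where "\<theta> = real_of_int (a' q) / real p ^ l"
    have D_eq: "D q = cmod (geom_char (p ^ (2 * h)) \<theta>) / H"
      using geom_char_cong[OF unit_char_cong[OF a'_cong[of q]]] Q by (simp add: D_def \<theta>_def Q_def)
    have D0: "D q \<ge> 0" using H by (simp add: D_def)
    have D1: "D q \<le> 1"
      using cmod_geom_char_le[of "p ^ (2 * h)" \<theta>] H unfolding D_eq by (simp add: H_def)
    show ?thesis
    proof (cases "\<bar>t q\<bar> \<le> 1")
      case True
      then show ?thesis using D0 D1 by (simp add: w_def power_le_one)
    next
      case False
      have "real_of_int (2 * \<bar>a' q\<bar>) \<le> real_of_int Q" using a'_le[of q] by (simp only: of_int_le_iff)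
      then have "\<bar>\<theta>\<bar> \<le> 1 / 2" using p2 by (simp add: \<theta>_def Q_def field_simps abs_divide)
      from cmod_geom_char_mult_le[OF this] have 1: "D q * H * \<bar>\<theta>\<bar> \<le> 1" using H by (simp add: D_eq)
      \<comment> \<open>As \<open>b'\<close> lies between 0 and \<open>Q\<close>, one unit of
        \<open>\<bar>t q\<bar>\<close> is lost; this is why \<open>\<bar>t q\<bar> \<le> 1\<close>
        is treated by the trivial bound.\<close>
      have "(\<bar>t q\<bar> - 1) * Q \<le> \<bar>a' q * int q\<bar>"
        using aq[OF q] b' Q by (cases "t q \<ge> 0") (auto simp: algebra_simps abs_if)
      also have "\<dots> \<le> \<bar>a' q\<bar> * int p ^ (2 * h)"
        unfolding abs_mult using A(2)[OF q] by (intro mult_left_mono) (auto simp flip: of_nat_power)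
      finally have "real_of_int ((\<bar>t q\<bar> - 1) * Q) \<le> real_of_int (\<bar>a' q\<bar> * int p ^ (2 * h))"
        by (simp only: of_int_le_iff)
      then have "(\<bar>real_of_int (t q)\<bar> - 1) \<le> \<bar>\<theta>\<bar> * H"
        using p2 by (simp add: \<theta>_def Q_def H_def field_simps abs_divide)
      moreover have "\<bar>real_of_int (t q)\<bar> / 2 \<le> \<bar>real_of_int (t q)\<bar> - 1" using False by linarith
      ultimately have "\<bar>real_of_int (t q)\<bar> / 2 \<le> \<bar>\<theta>\<bar> * H" by linarith
      then have "D q * (\<bar>real_of_int (t q)\<bar> / 2) \<le> D q * (\<bar>\<theta>\<bar> * H)" using D0 by (rule mult_left_mono)
      then have "D q * (\<bar>real_of_int (t q)\<bar> / 2) \<le> 1" using 1 by (simp add: mult_ac)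
      then have "D q \<le> 2 / \<bar>real_of_int (t q)\<bar>" using False by (simp add: field_simps)
      then have "D q ^ 2 \<le> (2 / \<bar>real_of_int (t q)\<bar>) ^ 2" using D0 by (rule power_mono)
      then show ?thesis using False by (simp add: w_def power_divide)
    qed
  qed
  then have "(\<Sum>q\<in>A. D q ^ 2) \<le> (\<Sum>q\<in>A. w (t q))" by (rule sum_mono)
  also have "\<dots> = (\<Sum>s\<in>t ` A. \<Sum>q\<in>{q\<in>A. t q = s}. w (t q))" by (rule sum.image_gen[OF A(1)])
  also have "\<dots> = (\<Sum>s\<in>t ` A. real (card {q\<in>A. t q = s}) * w s)" by (intro sum.cong) auto
  also have "\<dots> \<le> (\<Sum>s\<in>t ` A. real c * w s)"
  proof (intro sum_mono mult_right_mono)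
    fix s assume s: "s \<in> t ` A"
    define N where "N = b' + s * Q"
    \<comment> \<open>This excludes \<open>N = 0\<close>, which every prime would divide.\<close>
    have "\<not> int p dvd N"
    proof
      assume "int p dvd N"
      moreover have "int p dvd Q" using l by (simp add: Q_def)
      ultimately have "int p dvd b mod Q" unfolding N_def b'_def by (simp add: dvd_add_left_iff)
      then have "int p dvd b" using \<open>int p dvd Q\<close> by (simp add: dvd_mod_iff)
      then show False using b by simp
    qed
    then have N0: "N \<noteq> 0" by auto
    have "card {q\<in>A. t q = s} \<le> c"
    proof (rule card_prime_divisors_le)
      show "finite {q\<in>A. t q = s}" using A by simp
      fix q assume q: "q \<in> {q\<in>A. t q = s}"
      then have "N = a' q * int q" using aq by (simp add: N_def)
      then have "nat \<bar>N\<bar> = nat \<bar>a' q\<bar> * q" by (simp add: abs_mult nat_mult_distrib)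
      then show "prime q \<and> q dvd nat \<bar>N\<bar> \<and> p ^ h \<le> q" using A(2) q by auto
    next
      show "nat \<bar>N\<bar> \<noteq> 0" using N0 by simp
      obtain q where q: "q \<in> A" "s = t q" using s by auto
      then have "N = a' q * int q" using aq by (simp add: N_def)
      then have "\<bar>N\<bar> = \<bar>a' q\<bar> * int q" by (simp add: abs_mult)
      \<comment> \<open>The size \<open>p^(l + 2h)\<close> is at most \<open>(p^h)^c\<close>, so at
        most \<open>c\<close> primes from \<open>p^h\<close> on can divide \<open>N\<close>.\<close>
      also have "\<dots> \<le> Q * int (p ^ (2 * h))"
        using a'_le[of q] A(2)[OF q(1)] by (intro mult_mono) auto
      also have "\<dots> = int (p ^ (l + 2 * h))" by (simp add: Q_def power_add)
      finally have "nat \<bar>N\<bar> \<le> p ^ (l + 2 * h)" by (simp only: nat_le_iff)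
      also have "\<dots> \<le> p ^ (h * c)" using c p2 by (intro power_increasing) auto
      finally show "nat \<bar>N\<bar> \<le> (p ^ h) ^ c" by (simp add: power_mult)
      show "p ^ h \<ge> 2" using p2 h by (metis power_increasing power_one_right order_trans one_le_numeral)
    qed
    then show "real (card {q\<in>A. t q = s}) \<le> real c" by simp
  qed (simp add: w_def)
  also have "\<dots> = real c * (\<Sum>s\<in>t ` A. w s)" by (simp add: sum_distrib_left)
  also have "\<dots> \<le> real c * 11"
    unfolding w_def using A(1) by (intro mult_left_mono sum_int_inverse_squares_le) auto
  finally show ?thesis by (simp add: D_def H_def)
qed

section \<open>Random solutions of linear congruences\<close>

lemma unit_char_sum: "unit_char (\<Sum>k\<in>J. f k) = (\<Prod>k\<in>J. unit_char (f k))"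
proof (induction J rule: infinite_finite_induct)
  case (insert k J)
  show ?case
    unfolding sum.insert[OF insert.hyps] prod.insert[OF insert.hyps] unit_char_add insert.IH ..
qed simp_all

lemma sum_PiE_unit_char:
  assumes "finite J"
  shows "(\<Sum>v\<in>PiE J (\<lambda>_. {0..<int M}). unit_char (\<Sum>k\<in>J. real_of_int (v k) * t k)) = (\<Prod>k\<in>J. geom_char M (t k))"
proof -
  have "geom_char M s = (\<Sum>v\<in>{0..<int M}. unit_char (real_of_int v * s))" for s
    unfolding geom_char_def
    by (rule sum.reindex_bij_witness[of _ nat int]) auto
  then have "(\<Prod>k\<in>J. geom_char M (t k)) = (\<Prod>k\<in>J. \<Sum>v\<in>{0..<int M}. unit_char (real_of_int v * t k))" by simp
  also have "\<dots> = (\<Sum>v\<in>PiE J (\<lambda>_. {0..<int M}). \<Prod>k\<in>J. unit_char (real_of_int (v k) * t k))"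
    by (rule prod_sum_PiE) (use assms in auto)
  finally show ?thesis by (simp only: unit_char_sum)
qed

text \<open>Columns \<open>j > 0\<close> hold the free entries \<open>v\<close>; column 0 is solved
  from the congruence, \<open>w\<close> being the inverse of \<open>q 0\<close>. \<open>g\<close> is
  the carry of the previous matrix times \<open>q\<close>, and \<open>u + u'\<close> is the free
  part of \<open>r\<close>.\<close>

definition row_solution ::
  "nat \<Rightarrow> int \<Rightarrow> (nat \<Rightarrow> int) \<Rightarrow> (nat \<Rightarrow> int) \<Rightarrow> (nat \<times> nat \<Rightarrow> int) \<Rightarrow> (nat \<Rightarrow> int) \<Rightarrow> (nat \<Rightarrow> int) \<Rightarrow> nat \<times> nat \<Rightarrow> int" where
  "row_solution n w q g v u u' = (\<lambda>(i, j). if j = 0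
     then w * (u i + u' i - g i - (\<Sum>j'\<in>{1..<n}. v (i, j') * q j')) else v (i, j))"

lemma lessThan_eq_insert_0: "n \<ge> 1 \<Longrightarrow> {..<n} = insert 0 {1..<n::nat}"
  by auto

lemma row_solution_cong:
  assumes "n \<ge> 1" "[w * q 0 = 1] (mod P)"
  shows "[(\<Sum>j<n. row_solution n w q g v u u' (i, j) * q j) = u i + u' i - g i] (mod P)"
proof -
  define s where "s = (\<Sum>j\<in>{1..<n}. v (i, j) * q j)"
  have "(\<Sum>j\<in>{1..<n}. row_solution n w q g v u u' (i, j) * q j) = s"
    unfolding s_def by (rule sum.cong) (auto simp: row_solution_def)
  then have "(\<Sum>j<n. row_solution n w q g v u u' (i, j) * q j) = (w * q 0) * (u i + u' i - g i - s) + s"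
    unfolding lessThan_eq_insert_0[OF assms(1)]
    by (subst sum.insert) (auto simp: row_solution_def s_def mult_ac)
  moreover have "[(w * q 0) * (u i + u' i - g i - s) + s = 1 * (u i + u' i - g i - s) + s] (mod P)"
    by (intro cong_add cong_mult assms cong_refl)
  ultimately show ?thesis by simp
qed

text \<open>Substituting column 0 makes the dot product affine in the random data. The coefficient
  of a free entry measures how far row \<open>i\<close> of \<open>b\<close> is from the multiple of
  \<open>q\<close> with multiplier \<open>b (i, 0) * w\<close>; the coefficient of
  \<open>u i\<close> and \<open>u' i\<close> is this multiplier.\<close>

lemma row_solution_dot:
  assumes n: "n \<ge> 1"
  shows "(\<Sum>k\<in>{..<m} \<times> {..<n}. row_solution n w q g v u u' k * b k)
    = (\<Sum>k\<in>{..<m} \<times> {1..<n}. v k * (b k - b (fst k, 0) * w * q (snd k)))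
      + (\<Sum>i<m. u i * (b (i, 0) * w)) + (\<Sum>i<m. u' i * (b (i, 0) * w)) - (\<Sum>i<m. g i * (b (i, 0) * w))"
proof -
  have row: "(\<Sum>j<n. row_solution n w q g v u u' (i, j) * b (i, j))
     = (\<Sum>j\<in>{1..<n}. v (i, j) * (b (i, j) - b (i, 0) * w * q j)) + u i * (b (i, 0) * w)
        + u' i * (b (i, 0) * w) - g i * (b (i, 0) * w)" for i
  proof -
    have "(\<Sum>j\<in>{1..<n}. row_solution n w q g v u u' (i, j) * b (i, j)) = (\<Sum>j\<in>{1..<n}. v (i, j) * b (i, j))"
      by (rule sum.cong) (auto simp: row_solution_def)
    then show ?thesis
      unfolding lessThan_eq_insert_0[OF n]
      by (subst sum.insert)
        (auto simp: row_solution_def algebra_simps sum_distrib_left sum_distrib_right sum_subtractf sum.distrib)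
  qed
  have double: "(\<Sum>k\<in>{..<m} \<times> B. f k) = (\<Sum>i<m. \<Sum>j\<in>B. f (i, j))" for B :: "nat set" and f :: "nat \<times> nat \<Rightarrow> int"
    by (simp add: sum.cartesian_product)
  show ?thesis
    unfolding double by (simp add: row sum.distrib sum_subtractf)
qed

text \<open>The carry \<open>g\<close> contributes only a unimodular constant, and \<open>u\<close>,
  \<open>u'\<close> contribute equal factors, whence the square.\<close>

lemma cmod_sum_row_solution:
  assumes n: "n \<ge> 1"
  shows "cmod (\<Sum>(v, u, u')\<in>PiE ({..<m} \<times> {1..<n}) (\<lambda>_. {0..<int M}) \<times> PiE {..<m} (\<lambda>_. {0..<int H}) \<times> PiE {..<m} (\<lambda>_. {0..<int H}).
       unit_char (of_int (\<Sum>k\<in>{..<m} \<times> {..<n}. row_solution n w q g v u u' k * b k) / Q))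
    = (\<Prod>k\<in>{..<m} \<times> {1..<n}. cmod (geom_char M (of_int (b k - b (fst k, 0) * w * q (snd k)) / Q)))
      * (\<Prod>i<m. cmod (geom_char H (of_int (b (i, 0) * w) / Q))) ^ 2"
proof -
  define J where "J = {..<m} \<times> {1..<n}"
  define V where "V = PiE J (\<lambda>_. {0..<int M})"
  define U where "U = PiE {..<m} (\<lambda>_. {0..<int H})"
  define A where "A v = unit_char (\<Sum>k\<in>J. real_of_int (v k) * (of_int (b k - b (fst k, 0) * w * q (snd k)) / Q))" for v
  define B where "B u = unit_char (\<Sum>i<m. real_of_int (u i) * (of_int (b (i, 0) * w) / Q))" for u
  define c where "c = unit_char (- (of_int (\<Sum>i<m. g i * (b (i, 0) * w)) / Q))"
  have split: "unit_char (of_int (\<Sum>k\<in>{..<m} \<times> {..<n}. row_solution n w q g v u u' k * b k) / Q) = c * A v * B u * B u'" for v u u'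
  proof -
    have "real_of_int (\<Sum>k\<in>{..<m} \<times> {..<n}. row_solution n w q g v u u' k * b k) / Q
        = - (of_int (\<Sum>i<m. g i * (b (i, 0) * w)) / Q)
          + (\<Sum>k\<in>J. real_of_int (v k) * (of_int (b k - b (fst k, 0) * w * q (snd k)) / Q))
          + (\<Sum>i<m. real_of_int (u i) * (of_int (b (i, 0) * w) / Q))
          + (\<Sum>i<m. real_of_int (u' i) * (of_int (b (i, 0) * w) / Q))"
    proof -
      have gen: "(\<Sum>k\<in>K. real_of_int (x k) * (of_int (y k) / Q)) = of_int (\<Sum>k\<in>K. x k * y k) / Q"
        for K :: "'a set" and x y
        by (simp add: sum_divide_distrib)
      have "of_int (S1 + S2 + S3 - S4) / Q = - (of_int S4 / Q) + of_int S1 / Q + of_int S2 / Q + of_int S3 / Q"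
        for S1 S2 S3 S4
        by (simp add: add_divide_distrib diff_divide_distrib)
      then show ?thesis unfolding row_solution_dot[OF n] J_def gen by blast
    qed
    then show ?thesis by (simp only: unit_char_add A_def B_def c_def)
  qed
  have "(\<Sum>(v, u, u')\<in>V \<times> U \<times> U. unit_char (of_int (\<Sum>k\<in>{..<m} \<times> {..<n}. row_solution n w q g v u u' k * b k) / Q))
      = (\<Sum>v\<in>V. \<Sum>u\<in>U. \<Sum>u'\<in>U. c * A v * B u * B u')"
    by (simp only: split sum.cartesian_product)
  also have "\<dots> = c * (\<Sum>v\<in>V. A v) * (\<Sum>u\<in>U. B u) * (\<Sum>u\<in>U. B u)"
    by (simp add: sum_distrib_left sum_distrib_right mult_ac)
  also have "cmod \<dots> = cmod (\<Sum>v\<in>V. A v) * cmod (\<Sum>u\<in>U. B u) ^ 2"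
    by (simp add: norm_mult power2_eq_square c_def del: of_real_minus)
  also have "(\<Sum>v\<in>V. A v) = (\<Prod>k\<in>J. geom_char M (of_int (b k - b (fst k, 0) * w * q (snd k)) / Q))"
    unfolding V_def A_def by (rule sum_PiE_unit_char) (simp add: J_def)
  also have "(\<Sum>u\<in>U. B u) = (\<Prod>i<m. geom_char H (of_int (b (i, 0) * w) / Q))"
    unfolding U_def B_def by (rule sum_PiE_unit_char) simp
  finally show ?thesis by (simp only: prod_norm[symmetric] V_def U_def J_def)
qed

text \<open>The summation runs over whole periods of a nontrivial character, as \<open>p^l\<close>
  divides \<open>p^k\<close>.\<close>

lemma geom_char_power_eq_0:
  assumes "p > 0" "l \<le> k" "\<not> int p ^ l dvd d"
  shows "geom_char (p ^ k) (of_int d / real p ^ l) = 0"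
proof (rule geom_char_eq_0)
  show "unit_char (of_int d / real p ^ l) \<noteq> 1"
    using unit_char_eq_1_imp_dvd[of d "int p ^ l"] assms by auto
  have "real p ^ k = real p ^ (k - l) * real p ^ l"
    using assms by (simp flip: power_add)
  then have "real (p ^ k) * (of_int d / real p ^ l) = of_int (int p ^ (k - l) * d)"
    using assms by simp
  then show "unit_char (real (p ^ k) * (of_int d / real p ^ l)) = 1"
    by (simp only: unit_char_of_int)
qed

text \<open>The kernel in the free entries forces row \<open>i0\<close> of \<open>b\<close> to be congruent to a multiple of \<open>q\<close>,
  so a single coordinate of \<open>q\<close> determines the others.\<close>

lemma sum_over_directions_le:
  fixes p h k l c m n :: nat and b :: "nat \<times> nat \<Rightarrow> int" and w :: "int \<Rightarrow> int" and g :: "(nat \<Rightarrow> int) \<Rightarrow> nat \<Rightarrow> int"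
    and A :: "nat set"
  defines "Qs \<equiv> PiE {..<n} (\<lambda>j. if j = 0 then int ` A else {0..<int p ^ (2 * h)})"
    and "V \<equiv> PiE ({..<m} \<times> {1..<n}) (\<lambda>_. {0..<int (p ^ k)})" and "U \<equiv> PiE {..<m} (\<lambda>_. {0..<int (p ^ (2 * h))})"
  assumes p: "prime p" and A: "finite A" "\<And>q. q \<in> A \<Longrightarrow> prime q \<and> q \<noteq> p \<and> p ^ h \<le> q \<and> q < p ^ (2 * h)"
    and h: "h \<ge> 1" and l: "1 \<le> l" "l \<le> k" and n: "n \<ge> 1"
    and w: "\<And>q. q \<in> A \<Longrightarrow> [w (int q) * int q = 1] (mod int p ^ k)" and c: "l + 2 * h \<le> h * c"
    and b: "i0 < m" "j0 < n" "\<not> int p dvd b (i0, j0)"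
  shows "cmod (\<Sum>q\<in>Qs. \<Sum>(v, u, u')\<in>V \<times> U \<times> U.
       unit_char (of_int (\<Sum>k\<in>{..<m} \<times> {..<n}. row_solution n (w (q 0)) q (g q) v u u' k * b k) / real p ^ l))
     \<le> (if l \<le> 2 * h then 0 else real (card V) * real (card U) ^ 2 * (11 * real c))"
proof -
  have p0: "p > 0" using p prime_gt_0_nat by blast
  define Z where "Z = int p ^ l"
  define N where "N = real (card V) * real (card U) ^ 2"
  define good where "good q \<longleftrightarrow> (\<forall>j<n. [b (i0, j) = b (i0, 0) * w (q 0) * q j] (mod Z))" for q
  define D where "D a = (cmod (geom_char (p ^ (2 * h)) (of_int (b (i0, 0) * w a) / real p ^ l)) / real p ^ (2 * h)) ^ 2" for a
  define S where "S q = (\<Sum>(v, u, u')\<in>V \<times> U \<times> U.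
       unit_char (of_int (\<Sum>k\<in>{..<m} \<times> {..<n}. row_solution n (w (q 0)) q (g q) v u u' k * b k) / real p ^ l))" for q
  have wZ: "[w (int q) * int q = 1] (mod Z)" if "q \<in> A" for q
    using w[OF that] l(2) unfolding Z_def by (meson cong_dvd_modulus le_imp_power_dvd)
  have q0: "\<exists>a\<in>A. q 0 = int a" if "q \<in> Qs" for q
    using that n unfolding Qs_def by (auto dest!: PiE_mem[of _ _ _ 0])
  have S_le: "cmod (S q) \<le> (if good q then N * D (q 0) else 0)" if q: "q \<in> Qs" for q
  proof -
    have cmodS: "cmod (S q) = (\<Prod>k'\<in>{..<m} \<times> {1..<n}. cmod (geom_char (p ^ k) (of_int (b k' - b (fst k', 0) * w (q 0) * q (snd k')) / real p ^ l)))
      * (\<Prod>i<m. cmod (geom_char (p ^ (2 * h)) (of_int (b (i, 0) * w (q 0)) / real p ^ l))) ^ 2"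
      unfolding S_def V_def U_def by (rule cmod_sum_row_solution[OF n])
    show ?thesis
    proof (cases "good q")
      case True
      have "(\<Prod>k'\<in>{..<m} \<times> {1..<n}. cmod (geom_char (p ^ k) (of_int (b k' - b (fst k', 0) * w (q 0) * q (snd k')) / real p ^ l)))
          \<le> (\<Prod>k'\<in>{..<m} \<times> {1..<n}. real (p ^ k))"
        by (intro prod_mono conjI cmod_geom_char_le norm_ge_zero)
      also have "\<dots> = real (card V)" by (simp add: V_def card_PiE)
      finally have 1: "(\<Prod>k'\<in>{..<m} \<times> {1..<n}. cmod (geom_char (p ^ k) (of_int (b k' - b (fst k', 0) * w (q 0) * q (snd k')) / real p ^ l)))
          \<le> real (card V)" .
      define F where "F i = cmod (geom_char (p ^ (2 * h)) (of_int (b (i, 0) * w (q 0)) / real p ^ l))" for i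
      have F: "0 \<le> F i" "F i \<le> real (p ^ (2 * h))" for i
        unfolding F_def using cmod_geom_char_le[of "p ^ (2 * h)"] by auto
      \<comment> \<open>Only row \<open>i0\<close> keeps its kernel; the other rows are bounded
        trivially.\<close>
      have "(\<Prod>i<m. F i) = F i0 * (\<Prod>i\<in>{..<m} - {i0}. F i)" by (rule prod.remove) (use b in auto)
      also have "\<dots> \<le> F i0 * (\<Prod>i\<in>{..<m} - {i0}. real (p ^ (2 * h)))"
        using F by (intro mult_left_mono prod_mono) auto
      also have "\<dots> = F i0 / real p ^ (2 * h) * (real (p ^ (2 * h)) * (\<Prod>i\<in>{..<m} - {i0}. real (p ^ (2 * h))))"
        using p0 by simp
      also have "real (p ^ (2 * h)) * (\<Prod>i\<in>{..<m} - {i0}. real (p ^ (2 * h))) = (\<Prod>i<m. real (p ^ (2 * h)))"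
        by (rule prod.remove[symmetric]) (use b in auto)
      also have "\<dots> = real (card U)" by (simp add: U_def card_PiE)
      finally have "(\<Prod>i<m. F i) \<le> F i0 / real p ^ (2 * h) * real (card U)" .
      then have "(\<Prod>i<m. F i) ^ 2 \<le> (F i0 / real p ^ (2 * h) * real (card U)) ^ 2"
        using F by (intro power_mono prod_nonneg) auto
      also have "\<dots> = real (card U) ^ 2 * D (q 0)" by (simp only: D_def F_def power_mult_distrib mult.commute)
      finally have "cmod (S q) \<le> real (card V) * (real (card U) ^ 2 * D (q 0))"
        unfolding cmodS using 1 by (intro mult_mono) (simp_all add: F_def)
      then show ?thesis using True by (simp add: N_def mult_ac)
    next
      case False
      then obtain j where j: "j < n" "\<not> [b (i0, j) = b (i0, 0) * w (q 0) * q j] (mod Z)" by (auto simp: good_def)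
      \<comment> \<open>Column 0 satisfies the congruence automatically, so the failure is at a free
        entry, whose kernel vanishes.\<close>
      have "j \<noteq> 0"
      proof
        assume "j = 0"
        obtain a where a: "a \<in> A" "q 0 = int a" using q0[OF q] by blast
        have "[b (i0, 0) * (w (int a) * int a) = b (i0, 0) * 1] (mod Z)" by (intro cong_mult cong_refl wZ a)
        then show False using j(2) \<open>j = 0\<close> a(2) by (simp add: cong_sym_eq mult_ac)
      qed
      moreover have "geom_char (p ^ k) (of_int (b (i0, j) - b (i0, 0) * w (q 0) * q j) / real p ^ l) = 0"
        by (rule geom_char_power_eq_0[OF p0 l(2)]) (use j(2) in \<open>simp add: cong_iff_dvd_diff Z_def\<close>)
      ultimately have prod0: "(\<Prod>k'\<in>{..<m} \<times> {1..<n}. cmod (geom_char (p ^ k) (of_int (b k' - b (fst k', 0) * w (q 0) * q (snd k')) / real p ^ l))) = 0"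
        using b(1) j(1) by (intro prod_zero bexI[of _ "(i0, j)"]) auto
      show ?thesis unfolding cmodS prod0 using False by simp
    qed
  qed
  \<comment> \<open>The multiplier of row \<open>i0\<close> is a unit, because one of its multiples
    is congruent to the unit \<open>b (i0, j0)\<close> modulo \<open>p\<close>.\<close>
  have unit: "\<not> int p dvd b (i0, 0) * w (q 0)" if "good q" for q
  proof
    assume "int p dvd b (i0, 0) * w (q 0)"
    moreover have "[b (i0, j0) = b (i0, 0) * w (q 0) * q j0] (mod int p)"
      using that b(2) l(1) unfolding good_def Z_def by (meson cong_dvd_modulus dvd_power order_less_le_trans zero_less_one)
    ultimately have "int p dvd b (i0, j0)" by (metis cong_dvd_iff dvd_mult2)
    then show False using b(3) by simp
  qed
  have fin: "finite Qs" using A(1) by (auto simp: Qs_def intro!: finite_PiE)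
  have "cmod (\<Sum>q\<in>Qs. S q) \<le> (\<Sum>q\<in>Qs. cmod (S q))" by (rule norm_sum)
  also have "\<dots> \<le> (\<Sum>q\<in>Qs. if good q then N * D (q 0) else 0)" by (rule sum_mono[OF S_le])
  also have "\<dots> = (\<Sum>q\<in>{q\<in>Qs. good q}. N * D (q 0))"
    using fin by (simp add: sum.inter_filter)
  also have "\<dots> \<le> (if l \<le> 2 * h then 0 else N * (11 * real c))"
  proof (cases "l \<le> 2 * h")
    case True
    \<comment> \<open>For \<open>l \<le> 2 * h\<close> the vector \<open>u\<close> runs over whole
      periods of the character.\<close>
    have "D (q 0) = 0" if "good q" for q
    proof -
      have nd: "\<not> int p ^ l dvd b (i0, 0) * w (q 0)"
        using unit[OF that] l(1) by (meson dvd_power dvd_trans order_less_le_trans zero_less_one)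
      show ?thesis unfolding D_def geom_char_power_eq_0[OF p0 True nd] by simp
    qed
    then show ?thesis using True by simp
  next
    case False
    define R where "R = {q\<in>Qs. good q}"
    \<comment> \<open>The unit multiplier cancels, so \<open>q 0\<close> determines each
      \<open>q j\<close> modulo \<open>p^l\<close>; congruent entries below
      \<open>p^(2h) \<le> p^l\<close> are equal.\<close>
    have inj: "inj_on (\<lambda>q. nat (q 0)) R"
    proof (rule inj_onI)
      fix q q' assume qq: "q \<in> R" "q' \<in> R" "nat (q 0) = nat (q' 0)"
      then have R: "q \<in> Qs" "q' \<in> Qs" "good q" "good q'" by (auto simp: R_def)
      have e0: "q 0 = q' 0" using q0[OF R(1)] q0[OF R(2)] qq(3) by auto
      show "q = q'"
      proof (rule PiE_ext[OF R(1,2)[unfolded Qs_def]])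
        fix j assume j: "j \<in> {..<n}"
        show "q j = q' j"
        proof (cases "j = 0")
          case False
          have bd: "0 \<le> q j" "q j < int p ^ (2 * h)" "0 \<le> q' j" "q' j < int p ^ (2 * h)"
            using PiE_mem[OF R(1)[unfolded Qs_def] j] PiE_mem[OF R(2)[unfolded Qs_def] j] False by auto
          have "int p ^ (2 * h) \<le> Z" unfolding Z_def using \<open>\<not> l \<le> 2 * h\<close> p0 by (intro power_increasing) auto
          moreover have "[q j = q' j] (mod Z)"
          proof -
            have "[b (i0, 0) * w (q 0) * q j = b (i0, 0) * w (q 0) * q' j] (mod Z)"
              using R(3,4) j e0 unfolding good_def by (metis cong_sym cong_trans lessThan_iff)
            moreover have "coprime (b (i0, 0) * w (q 0)) Z"
              unfolding Z_def using unit[OF R(3)] p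
              by (metis coprime_commute coprime_power_right_iff prime_imp_coprime prime_int_nat_transfer prime_nat_int_transfer)
            ultimately show ?thesis by (simp add: cong_mult_lcancel)
          qed
          ultimately show ?thesis using bd by (simp add: cong_def)
        qed (use e0 in simp)
      qed
    qed
    have q0': "int (nat (q 0)) = q 0 \<and> nat (q 0) \<in> A" if "q \<in> R" for q
      using q0[of q] that by (auto simp: R_def)
    then have sub: "(\<lambda>q. nat (q 0)) ` R \<subseteq> A" by blast
    have "(\<Sum>q\<in>R. D (q 0)) = (\<Sum>q\<in>R. D (int (nat (q 0))))"
      by (rule sum.cong) (simp_all only: q0')
    also have "\<dots> = (\<Sum>a\<in>(\<lambda>q. nat (q 0)) ` R. D (int a))" by (subst sum.reindex[OF inj]) simp
    also have "\<dots> \<le> 11 * real c"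
    proof (cases "R = {}")
      case False
      then obtain q where q: "good q" by (auto simp: R_def)
      have nb: "\<not> int p dvd b (i0, 0)" using unit[OF q] by auto
      have "(\<Sum>a\<in>(\<lambda>q. nat (q 0)) ` R. D (int a)) \<le> (\<Sum>a\<in>A. D (int a))"
        by (rule sum_mono2[OF A(1) sub]) (simp add: D_def)
      also have "\<dots> \<le> 11 * real c"
        unfolding D_def
      proof (rule sum_kernel_over_primes_le[OF p A(1) _ h l(1) nb _ c])
        fix a assume a: "a \<in> A"
        then show "prime a \<and> p ^ h \<le> a \<and> a < p ^ (2 * h)" using A(2) by blast
        have "[b (i0, 0) * (w (int a) * int a) = b (i0, 0) * 1] (mod Z)" by (intro cong_mult cong_refl wZ a)
        then show "[b (i0, 0) * w (int a) * int a = b (i0, 0)] (mod int p ^ l)" by (simp add: Z_def mult_ac)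
      qed
      finally show ?thesis .
    qed simp
    finally have "N * (\<Sum>q\<in>R. D (q 0)) \<le> N * (11 * real c)"
      by (intro mult_left_mono) (auto simp: N_def)
    then show ?thesis using False by (simp add: R_def sum_distrib_left)
  qed
  finally show ?thesis by (simp only: S_def N_def)
qed

section \<open>One step of the construction\<close>

text \<open>As \<open>l \<le> k\<close>, the power is at least \<open>p^(- n (K + 2h + 3))\<close>,
  where rounding in \<open>k\<close> turned 2 into 3. The logarithm is at least \<open>h\<close> and
  supplies \<open>h^2\<close>: one factor cancels the density \<open>1 / h\<close> in
  \<open>B\<close>, the other absorbs \<open>p^(n (K + 3))\<close> and the constants by
  \<open>hc\<close>.\<close>

lemma decay_bound:
  fixes p n K h k l c :: nat and \<tau> c0 B :: real
  assumes p: "p \<ge> 2" and n: "n \<ge> 1" and \<tau>: "\<tau> > 1" and h: "h \<ge> 1"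
    and k: "real k \<le> \<tau> * real (K + 2 * h + 2) + 1" and l: "2 * h \<le> l" "l \<le> k"
    and c0: "c0 > 0" and hc: "real h \<ge> 11 * real c * real p ^ (n * (K + 3)) / c0"
    and B: "B \<ge> c0 * real p ^ (2 * h) / real h * real p ^ (2 * h * (n - 1))"
  shows "11 * real c / B \<le> (real p ^ l) powr (- real n / \<tau>) * ln (1 + real p ^ l) ^ (n + 1)"
proof -
  have p0: "real p > 0" using p by simp
  have pw: "real p ^ (2 * h) * real p ^ (2 * h * (n - 1)) = real p ^ (2 * h * n)"
    using n by (cases n) (simp_all add: power_add)
  have B': "B \<ge> c0 * real p ^ (2 * h * n) / real h"
    using B by (simp add: pw[symmetric])
  have pos: "c0 * real p ^ (2 * h * n) / real h > 0" using c0 p0 h by simp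
  have "11 * real c / B \<le> 11 * real c / (c0 * real p ^ (2 * h * n) / real h)"
    using B' pos by (intro divide_left_mono mult_pos_pos) auto
  also have "\<dots> = (11 * real c * real p ^ (n * (K + 3)) / c0) * (real h / (real p ^ (2 * h * n) * real p ^ (n * (K + 3))))"
    using c0 p0 by simp
  also have "\<dots> \<le> real h * (real h / (real p ^ (2 * h * n) * real p ^ (n * (K + 3))))"
    using hc p0 by (intro mult_right_mono) auto
  also have "\<dots> = (1 / real p ^ (n * (K + 2 * h + 3))) * real h ^ 2"
    by (simp add: power2_eq_square power_add[symmetric] algebra_simps)
  also have "\<dots> \<le> (real p ^ l) powr (- real n / \<tau>) * ln (1 + real p ^ l) ^ (n + 1)"
  proof (rule mult_mono)
    have "real l \<le> \<tau> * real (K + 2 * h + 2) + 1" using l k by simp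
    also have "\<dots> \<le> \<tau> * real (K + 2 * h + 3)" using \<tau> by (simp add: algebra_simps)
    finally have "real l / \<tau> \<le> real (K + 2 * h + 3)" using \<tau> by (simp add: field_simps)
    then have "real n * (real l / \<tau>) \<le> real n * real (K + 2 * h + 3)" by (rule mult_left_mono) simp
    then have "real p powr (- real (n * (K + 2 * h + 3))) \<le> real p powr (real l * (- real n / \<tau>))"
      using p by (intro powr_mono) (auto simp: mult.commute)
    also have "\<dots> = (real p ^ l) powr (- real n / \<tau>)"
      by (simp only: powr_powr powr_realpow[OF p0, symmetric])
    finally show "1 / real p ^ (n * (K + 2 * h + 3)) \<le> (real p ^ l) powr (- real n / \<tau>)"
      using p0 by (simp only: powr_minus powr_realpow inverse_eq_divide)
    have "1 \<le> ln (4 :: real)" using exp_le by (subst ln_ge_iff) auto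
    also have "ln (4 :: real) = 2 * ln 2" using ln_realpow[of "2 :: real" 2] by simp
    finally have "real h * 1 \<le> real h * (2 * ln 2)" by (rule mult_left_mono) simp
    then have "real h \<le> real (2 * h) * ln 2" by (simp add: mult_ac)
    also have "\<dots> \<le> real l * ln (real p)" using l p by (intro mult_mono) auto
    also have "\<dots> = ln (real p ^ l)" using p0 by (simp add: ln_realpow)
    also have "\<dots> \<le> ln (1 + real p ^ l)" using p0 by (subst ln_le_cancel_iff) (auto intro: add_pos_nonneg)
    finally have hl: "real h \<le> ln (1 + real p ^ l)" .
    have "real h ^ 2 \<le> real h ^ (n + 1)" using h n by (intro power_increasing) auto
    also have "\<dots> \<le> ln (1 + real p ^ l) ^ (n + 1)" using hl by (intro power_mono) auto
    finally show "real h ^ 2 \<le> ln (1 + real p ^ l) ^ (n + 1)" .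
  qed auto
  finally show ?thesis .
qed

text \<open>One step of the construction: \<open>G x u\<close> refines the matrix \<open>x\<close>, known modulo \<open>p^K\<close>, to a matrix
  modulo \<open>p^k\<close>, where \<open>u < N\<close> is uniformly random.\<close>

definition refinement_step ::
  "nat \<Rightarrow> nat \<Rightarrow> nat \<Rightarrow> real \<Rightarrow> nat \<Rightarrow> nat \<Rightarrow> nat \<Rightarrow> nat \<Rightarrow> ((nat \<times> nat \<Rightarrow> int) \<Rightarrow> nat \<Rightarrow> nat \<times> nat \<Rightarrow> int) \<Rightarrow> bool" where
  "refinement_step p m n \<tau> K k N s G \<longleftrightarrow> K < k \<and> N > 0 \<and> \<tau> * real s \<le> real k \<and>
    (\<forall>x u ij. [G x u ij = x ij] (mod int p ^ K)) \<and>
    (\<forall>x u. \<exists>q r. q 0 > int K \<and> (\<forall>j<n. 0 \<le> q j \<and> q j \<le> int p ^ s) \<and> (\<forall>i<m. 0 \<le> r i \<and> r i \<le> int p ^ s) \<and>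
       (\<forall>i<m. [(\<Sum>j<n. G x u (i, j) * q j) = r i] (mod int p ^ k))) \<and>
    (\<forall>b l x. K < l \<longrightarrow> l \<le> k \<longrightarrow> (\<exists>i<m. \<exists>j<n. \<not> int p dvd b (i, j)) \<longrightarrow>
       cmod (\<Sum>u<N. unit_char (of_int (\<Sum>ij\<in>{..<m} \<times> {..<n}. G x u ij * b ij) / real p ^ l))
         \<le> real N * ((real p ^ l) powr (- real n / \<tau>) * ln (1 + real p ^ l) ^ (n + 1)))"

text \<open>\<open>c\<close> depends on \<open>\<tau>\<close> alone and \<open>c0\<close> on
  \<open>p\<close> alone, so \<open>h\<close> can be chosen after every constant it has to beat;
  \<open>s\<close>, \<open>k\<close> and the sample set \<open>S\<close> follow from
  \<open>h\<close>.\<close>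

lemma refinement_step_exists:
  fixes p m n K :: nat and \<tau> :: real
  assumes p: "prime p" and n: "n \<ge> 1" and \<tau>: "\<tau> > 1"
  shows "\<exists>k N s G. refinement_step p m n \<tau> K k N s G"
proof -
  have p2: "p \<ge> 2" using p by (rule prime_ge_2_nat)
  obtain c0 H where c0: "c0 > 0" and H: "\<And>h. h \<ge> H \<Longrightarrow>
      real (card {q. prime q \<and> q \<noteq> p \<and> p ^ h \<le> q \<and> q < p ^ (2 * h)}) \<ge> c0 * real p ^ (2 * h) / real h"
    by (rule card_primes_between_powers[OF p]) (rule that, simp_all)
  \<comment> \<open>From \<open>s \<le> 3 * h\<close> one gets
    \<open>k \<le> 4 * \<tau> * h\<close>; the extra 2 accounts for \<open>2 * h\<close> in
    \<open>k + 2 * h \<le> h * c\<close>.\<close>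
  define c where "c = nat \<lceil>4 * \<tau>\<rceil> + 2"
  obtain h0 where h0: "real h0 \<ge> 11 * real c * real p ^ (n * (K + 3)) / c0" using real_arch_simple by blast
  \<comment> \<open>\<open>H\<close> ensures enough primes, \<open>h0\<close> absorbs the constants,
    and \<open>K + 2\<close> gives \<open>s \<le> 3 * h\<close> and \<open>q 0 > K\<close>.\<close>
  define h where "h = max H (max (K + 2) h0)"
  have h: "h \<ge> H" "h \<ge> K + 2" "h \<ge> h0" by (auto simp: h_def)
  have h1: "h \<ge> 1" using h by simp
  have hc: "real h \<ge> 11 * real c * real p ^ (n * (K + 3)) / c0" using h0 h by (meson of_nat_mono order_trans)
  \<comment> \<open>The entries of \<open>r\<close> are at most \<open>4 p^(K + 2h)\<close>; the
    final 2 is for \<open>4 \<le> p^2\<close>.\<close>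
  define s where "s = K + 2 * h + 2"
  \<comment> \<open>The precision at which an error \<open>p^(-k)\<close> is at most
    \<open>(p^s)^(-\<tau>)\<close>.\<close>
  define k where "k = nat \<lceil>\<tau> * real s\<rceil>"
  have k_ge: "\<tau> * real s \<le> real k" unfolding k_def by linarith
  have k_le: "real k \<le> \<tau> * real s + 1" using \<tau> unfolding k_def by (simp add: of_nat_nat)
  have "1 * real s \<le> \<tau> * real s" using \<tau> by (intro mult_right_mono) auto
  then have sk: "s \<le> k" using k_ge by simp
  define k' where "k' = k - K"
  have kK: "k = K + k'" "k' \<ge> 1" using sk by (auto simp: k'_def s_def)
  have c: "k + 2 * h \<le> h * c"
  proof -
    have "real s \<le> 3 * real h" using h by (simp add: s_def)
    then have "\<tau> * real s \<le> \<tau> * (3 * real h)" using \<tau> by (intro mult_left_mono) auto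
    moreover have "1 * 1 \<le> \<tau> * real h" using \<tau> h1 by (intro mult_mono) auto
    ultimately have "real k \<le> 4 * \<tau> * real h" using k_le by simp
    also have "\<dots> \<le> real (nat \<lceil>4 * \<tau>\<rceil>) * real h" by (intro mult_right_mono) linarith+
    finally have "real (k + 2 * h) \<le> real (h * c)" by (simp add: c_def algebra_simps)
    then show ?thesis by (simp only: of_nat_le_iff)
  qed
  define A where "A = {q. prime q \<and> q \<noteq> p \<and> p ^ h \<le> q \<and> q < p ^ (2 * h)}"
  have finA: "finite A" by (rule finite_subset[of _ "{..<p ^ (2 * h)}"]) (auto simp: A_def)
  have A: "prime q \<and> q \<noteq> p \<and> p ^ h \<le> q \<and> q < p ^ (2 * h)" if "q \<in> A" for q using that by (simp add: A_def)
  have cardA: "real (card A) \<ge> c0 * real p ^ (2 * h) / real h" unfolding A_def by (rule H[OF h(1)])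
  moreover have "c0 * real p ^ (2 * h) / real h > 0" using c0 p2 h1 by simp
  ultimately have "A \<noteq> {}" by auto
  define Qs where "Qs = PiE {..<n} (\<lambda>j. if j = 0 then int ` A else {0..<int p ^ (2 * h)})"
  define V where "V = PiE ({..<m} \<times> {1..<n}) (\<lambda>_. {0..<int (p ^ k')})"
  define U where "U = PiE {..<m} (\<lambda>_. {0..<int (p ^ (2 * h))})"
  define S where "S = Qs \<times> V \<times> U \<times> U"
  have fin: "finite Qs" "finite V" "finite U" using finA by (auto simp: Qs_def V_def U_def intro!: finite_PiE)
  have ne: "Qs \<noteq> {}" "V \<noteq> {}" "U \<noteq> {}"
    using \<open>A \<noteq> {}\<close> p2 by (auto simp: Qs_def V_def U_def PiE_eq_empty_iff)
  define N where "N = card S"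
  have N: "N > 0" unfolding N_def using fin ne by (simp add: card_gt_0_iff S_def)
  have Nprod: "real N = real (card Qs) * (real (card V) * real (card U) ^ 2)"
    by (simp add: N_def S_def card_cartesian_product power2_eq_square)
  have "card Qs = (\<Prod>j<n. card (if j = 0 then int ` A else {0..<int p ^ (2 * h)}))"
    unfolding Qs_def by (rule card_PiE) simp
  also have "\<dots> = card A * (\<Prod>j\<in>{1..<n}. card {0..<int p ^ (2 * h)})"
    unfolding lessThan_eq_insert_0[OF n] by (subst prod.insert) (auto simp: card_image intro!: arg_cong2[where f = "(*)"] prod.cong)
  also have "\<dots> = card A * p ^ (2 * h * (n - 1))"
    by (simp add: power_mult nat_power_eq)
  finally have cardQ: "real (card Qs) = real (card A) * real p ^ (2 * h * (n - 1))" by simp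
  \<comment> \<open>An enumeration turns the uniform choice of \<open>(q, v, a, a')\<close> into a
    uniform seed below \<open>N\<close>.\<close>
  obtain f where f: "bij_betw f {0..<N} S"
    using ex_bij_betw_nat_finite[of S] fin unfolding N_def S_def by blast
  define w where "w a = (SOME y. [y * a = 1] (mod int p ^ k'))" for a
  have w: "[w (int q) * int q = 1] (mod int p ^ k')" if "q \<in> A" for q
  proof -
    have "coprime q p" using A[OF that] p by (intro primes_coprime) auto
    then have "coprime (int q) (int p ^ k')" by simp
    then have "\<exists>y. [y * int q = 1] (mod int p ^ k')"
      using cong_solve_coprime_int by (metis mult.commute)
    then show ?thesis unfolding w_def by (rule someI_ex)
  qed
  define g where "g x q i = (\<Sum>j<n. x (i, j) * q j) div int p ^ K" for x :: "nat \<times> nat \<Rightarrow> int" and q i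
  \<comment> \<open>\<open>mod N\<close> gives every seed a meaning, as the congruences are claimed
    for all \<open>u\<close>.\<close>
  define G where "G x u = (case f (u mod N) of (q, v, a, a') \<Rightarrow>
     \<lambda>ij. x ij + int p ^ K * row_solution n (w (q 0)) q (g x q) v a a' ij)" for x u
  have "refinement_step p m n \<tau> K k N s G"
    unfolding refinement_step_def
  proof (intro conjI allI impI)
    show "K < k" using kK by simp
    show "N > 0" by (rule N)
    show "\<tau> * real s \<le> real k" by (rule k_ge)
    show "[G x u ij = x ij] (mod int p ^ K)" for x u ij
      by (auto simp: G_def cong_iff_dvd_diff split: prod.splits)
  next
    fix x u
    obtain q v a a' where fu: "f (u mod N) = (q, v, a, a')" by (metis prod_cases4)
    have "f (u mod N) \<in> S" using bij_betw_apply[OF f] N by simp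
    then have mem: "q \<in> Qs" "a \<in> U" "a' \<in> U" by (auto simp: fu S_def)
    have "q 0 \<in> int ` A" using PiE_mem[OF mem(1)[unfolded Qs_def], of 0] n by simp
    then obtain q0 where q0: "q0 \<in> A" "q 0 = int q0" by blast
    \<comment> \<open>The residue modulo \<open>p^K\<close> is forced by \<open>x\<close>;
      randomness enters above it.\<close>
    define r where "r i = (\<Sum>j<n. x (i, j) * q j) mod int p ^ K + int p ^ K * (a i + a' i)" for i
    have two: "2 ^ j \<le> int p ^ j" for j using p2 by (intro power_mono) auto
    have ps: "int p ^ s = int p ^ K * (int p ^ (2 * h) * int p ^ 2)" by (simp only: s_def power_add mult.assoc)
    have K0: "int p ^ K > 0" "int p ^ (2 * h) > 0" using p2 by auto
    show "\<exists>q r. q 0 > int K \<and> (\<forall>j<n. 0 \<le> q j \<and> q j \<le> int p ^ s) \<and> (\<forall>i<m. 0 \<le> r i \<and> r i \<le> int p ^ s) \<and>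
       (\<forall>i<m. [(\<Sum>j<n. G x u (i, j) * q j) = r i] (mod int p ^ k))"
    proof (rule exI[of _ q], rule exI[of _ r], intro conjI allI impI)
      have "K < 2 ^ K" by (rule less_exp)
      also have "\<dots> \<le> 2 ^ h" using h by (intro power_increasing) auto
      also have "\<dots> \<le> p ^ h" using p2 by (rule power_mono) simp
      also have "\<dots> \<le> q0" using A[OF q0(1)] by simp
      finally show "int K < q 0" using q0 by simp
    next
      fix j assume j: "j < n"
      have qj: "q j \<in> (if j = 0 then int ` A else {0..<int p ^ (2 * h)})"
        using PiE_mem[OF mem(1)[unfolded Qs_def]] j by blast
      have "\<exists>y. q j = int y \<and> y < p ^ (2 * h)"
      proof (cases "j = 0")
        case True
        then show ?thesis using q0 A[OF q0(1)] by (intro exI[of _ q0]) simp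
      next
        case False
        then show ?thesis using qj by (intro exI[of _ "nat (q j)"]) (simp add: nat_less_iff)
      qed
      then obtain y where y: "q j = int y" "y < p ^ (2 * h)" by blast
      have "y \<le> p ^ (2 * h)" using y by simp
      also have "\<dots> \<le> p ^ s" using p2 by (intro power_increasing) (auto simp: s_def)
      finally show "q j \<le> int p ^ s" using y by (simp flip: of_nat_power)
      show "0 \<le> q j" using y by simp
    next
      fix i assume i: "i < m"
      have ai: "0 \<le> a i" "a i < int p ^ (2 * h)" "0 \<le> a' i" "a' i < int p ^ (2 * h)"
        using PiE_mem[OF mem(2)[unfolded U_def]] PiE_mem[OF mem(3)[unfolded U_def]] i by auto
      show "0 \<le> r i" using ai K0 by (auto simp: r_def)
      have "r i \<le> int p ^ K * 1 + int p ^ K * (a i + a' i)"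
        using K0 by (simp add: r_def less_imp_le)
      also have "\<dots> = int p ^ K * (1 + a i + a' i)" by (simp add: algebra_simps)
      also have "\<dots> \<le> int p ^ K * (int p ^ (2 * h) * 2 ^ 2)"
        using ai K0 by (intro mult_left_mono) auto
      also have "\<dots> \<le> int p ^ s" unfolding ps using two[of 2] K0 by (intro mult_left_mono) auto
      finally show "r i \<le> int p ^ s" .
      define z where "z j = row_solution n (w (q 0)) q (g x q) v a a' (i, j)" for j
      have "[w (q 0) * q 0 = 1] (mod int p ^ k')" using w[OF q0(1)] by (simp add: q0(2))
      then have "[(\<Sum>j<n. z j * q j) = a i + a' i - g x q i] (mod int p ^ k')"
        unfolding z_def by (rule row_solution_cong[OF n])
      then have "[int p ^ K * (\<Sum>j<n. z j * q j) = int p ^ K * (a i + a' i - g x q i)] (mod int p ^ k)"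
        by (simp add: cong_iff_dvd_diff kK(1) power_add right_diff_distrib[symmetric])
      then have "[(\<Sum>j<n. x (i, j) * q j) + int p ^ K * (\<Sum>j<n. z j * q j)
          = (\<Sum>j<n. x (i, j) * q j) + int p ^ K * (a i + a' i - g x q i)] (mod int p ^ k)"
        by (intro cong_add cong_refl)
      moreover have "(\<Sum>j<n. x (i, j) * q j) + int p ^ K * (a i + a' i - g x q i) = r i"
      proof -
        have "(\<Sum>j<n. x (i, j) * q j) = int p ^ K * g x q i + (\<Sum>j<n. x (i, j) * q j) mod int p ^ K"
          unfolding g_def by simp
        then show ?thesis unfolding r_def by (simp add: algebra_simps)
      qed
      moreover have "(\<Sum>j<n. G x u (i, j) * q j) = (\<Sum>j<n. x (i, j) * q j) + int p ^ K * (\<Sum>j<n. z j * q j)"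
        by (simp only: G_def fu case_prod_conv z_def distrib_right sum.distrib sum_distrib_left mult.assoc)
      ultimately show "[(\<Sum>j<n. G x u (i, j) * q j) = r i] (mod int p ^ k)" by simp
    qed
  next
    fix b l x
    assume l: "K < l" "l \<le> k" and b: "\<exists>i<m. \<exists>j<n. \<not> int p dvd b (i, j)"
    obtain i0 j0 where ij: "i0 < m" "j0 < n" "\<not> int p dvd b (i0, j0)" using b by blast
    define l' where "l' = l - K"
    have l': "l = K + l'" "1 \<le> l'" "l' \<le> k'" using l kK by (auto simp: l'_def)
    have l'c: "l' + 2 * h \<le> h * c" using c l'(3) kK by simp
    define X where "X = unit_char (of_int (\<Sum>ij\<in>{..<m} \<times> {..<n}. x ij * b ij) / real p ^ l)"
    define \<Phi> where "\<Phi> q v a a' = unit_char (of_int (\<Sum>ij\<in>{..<m} \<times> {..<n}.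
        row_solution n (w (q 0)) q (g x q) v a a' ij * b ij) / real p ^ l')" for q v a a'
    \<comment> \<open>Pulling out \<open>p^K\<close> lowers the level from \<open>l\<close> to
      \<open>l'\<close>; the previous matrix leaves only the unimodular factor
      \<open>X\<close>.\<close>
    have split: "unit_char (of_int (\<Sum>ij\<in>{..<m} \<times> {..<n}.
        (x ij + int p ^ K * row_solution n (w (q 0)) q (g x q) v a a' ij) * b ij) / real p ^ l) = X * \<Phi> q v a a'"
      for q v a a'
    proof -
      have "(\<Sum>ij\<in>{..<m} \<times> {..<n}. (x ij + int p ^ K * row_solution n (w (q 0)) q (g x q) v a a' ij) * b ij)
        = (\<Sum>ij\<in>{..<m} \<times> {..<n}. x ij * b ij)
          + int p ^ K * (\<Sum>ij\<in>{..<m} \<times> {..<n}. row_solution n (w (q 0)) q (g x q) v a a' ij * b ij)"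
        by (simp only: distrib_right sum.distrib sum_distrib_left mult.assoc)
      moreover have "of_int (s1 + int p ^ K * s2) / real p ^ l = of_int s1 / real p ^ l + of_int s2 / real p ^ l'" for s1 s2
        using p2 by (simp add: l'(1) power_add field_simps)
      ultimately show ?thesis unfolding X_def \<Phi>_def by (simp only: unit_char_add)
    qed
    have "(\<Sum>u<N. unit_char (of_int (\<Sum>ij\<in>{..<m} \<times> {..<n}. G x u ij * b ij) / real p ^ l))
        = (\<Sum>u\<in>{0..<N}. case f u of (q, v, a, a') \<Rightarrow> X * \<Phi> q v a a')"
      unfolding atLeast0LessThan
      by (rule sum.cong) (simp_all only: G_def split case_prod_unfold mod_less lessThan_iff)
    also have "\<dots> = (\<Sum>(q, v, a, a')\<in>S. X * \<Phi> q v a a')" by (rule sum.reindex_bij_betw[OF f])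
    also have "\<dots> = X * (\<Sum>q\<in>Qs. \<Sum>(v, a, a')\<in>V \<times> U \<times> U. \<Phi> q v a a')"
      unfolding S_def by (simp add: sum.cartesian_product[symmetric] sum_distrib_left)
    also have "cmod \<dots> = cmod (\<Sum>q\<in>Qs. \<Sum>(v, a, a')\<in>V \<times> U \<times> U. \<Phi> q v a a')"
      by (simp only: norm_mult X_def norm_unit_char mult_1_left)
    also have "\<dots> \<le> (if l' \<le> 2 * h then 0 else real (card V) * real (card U) ^ 2 * (11 * real c))"
      unfolding \<Phi>_def Qs_def V_def U_def
      by (rule sum_over_directions_le[where b = b and w = w and A = A and g = "g x" and k = k' and l = l',
            OF p finA A h1 l'(2,3) n w l'c ij])
    also have "\<dots> \<le> real N * ((real p ^ l) powr (- real n / \<tau>) * ln (1 + real p ^ l) ^ (n + 1))"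
    proof (cases "l' \<le> 2 * h")
      case False
      define B where "B = real (card Qs)"
      have B: "B > 0" using fin ne by (simp add: B_def card_gt_0_iff)
      have "11 * real c / B \<le> (real p ^ l) powr (- real n / \<tau>) * ln (1 + real p ^ l) ^ (n + 1)"
      proof (rule decay_bound[OF p2 n \<tau> h1 _ _ l(2) c0 hc])
        show "real k \<le> \<tau> * real (K + 2 * h + 2) + 1" using k_le by (simp only: s_def)
        show "2 * h \<le> l" using False l' by simp
        show "c0 * real p ^ (2 * h) / real h * real p ^ (2 * h * (n - 1)) \<le> B"
          unfolding B_def cardQ using cardA by (intro mult_right_mono) auto
      qed
      then have "real N * (11 * real c / B) \<le> real N * ((real p ^ l) powr (- real n / \<tau>) * ln (1 + real p ^ l) ^ (n + 1))"
        by (rule mult_left_mono) simp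
      moreover have "real N * (11 * real c / B) = real (card V) * real (card U) ^ 2 * (11 * real c)"
        using B by (simp add: Nprod B_def)
      ultimately show ?thesis using False by simp
    next
      case True
      have "1 \<le> real p ^ l" using p2 by simp
      then have "ln (1 + real p ^ l) \<ge> 0" by simp
      then show ?thesis using True by simp
    qed
    finally show "cmod (\<Sum>u<N. unit_char (of_int (\<Sum>ij\<in>{..<m} \<times> {..<n}. G x u ij * b ij) / real p ^ l))
         \<le> real N * ((real p ^ l) powr (- real n / \<tau>) * ln (1 + real p ^ l) ^ (n + 1))" .
  qed
  then show ?thesis by blast
qed

section \<open>The measure\<close>

lemma padic_norm_of_int_unit:
  assumes "\<not> int CARD('p) dvd b"
  shows "padic_norm (of_int b :: 'p::prime_card padic) = 1"
proof -
  have "b \<noteq> 0" using assms by auto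
  then show ?thesis
    using padic_abs_divide[OF prime_card[where 'a = 'p], of b 1] not_dvd_imp_multiplicity_0[OF assms]
    by (simp add: padic_norm_of_int)
qed

text \<open>That the norm is a power of \<open>p\<close> is recovered here: \<open>l\<close> is the
  least exponent dominating it, and if \<open>p\<close> divided \<open>b\<close> at a maximal
  coordinate, \<open>l - 1\<close> would already do.\<close>

lemma padic_vec_rational_part:
  fixes \<xi> :: "'i \<Rightarrow> 'p::prime_card padic"
  assumes I: "finite I" "I \<noteq> {}" and gt: "padic_vec_norm I \<xi> > 1"
  obtains l b i where "l \<ge> 1" "padic_vec_norm I \<xi> = real CARD('p) ^ l"
    "\<And>i. i \<in> I \<Longrightarrow> padic_norm (\<xi> i - of_int (b i) / of_nat CARD('p) ^ l) \<le> 1"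
    "i \<in> I" "\<not> int CARD('p) dvd b i"
proof -
  define p where "p = CARD('p)"
  have p1: "real p > 1" using prime_card_gt_1[where 'p = 'p] by (simp add: p_def)
  define \<nu> where "\<nu> = padic_vec_norm I \<xi>"
  have "\<nu> \<in> (\<lambda>i. padic_norm (\<xi> i)) ` I" unfolding \<nu>_def padic_vec_norm_def by (rule Max_in) (use I in auto)
  then obtain i0 where i0: "i0 \<in> I" "\<nu> = padic_norm (\<xi> i0)" by blast
  have le: "padic_norm (\<xi> i) \<le> \<nu>" if "i \<in> I" for i
    unfolding \<nu>_def padic_vec_norm_def using that I by (intro Max_ge) auto
  obtain l' where "\<nu> < real p ^ l'" using real_arch_pow[OF p1] by blast
  then have ex: "\<nu> \<le> real p ^ l'" by simp
  define l where "l = (LEAST l. \<nu> \<le> real p ^ l)"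
  have l: "\<nu> \<le> real p ^ l" unfolding l_def by (rule LeastI[of "\<lambda>l. \<nu> \<le> real p ^ l", OF ex])
  have "l \<noteq> 0" using l gt by (intro notI) (simp add: \<nu>_def)
  then have l1: "l \<ge> 1" by simp
  have "\<not> \<nu> \<le> real p ^ (l - 1)" unfolding l_def by (rule not_less_Least) (use l1 in \<open>simp add: l_def\<close>)
  then have gt': "\<nu> > real p ^ (l - 1)" by simp
  have "\<exists>b. padic_norm (\<xi> i - of_int b / of_nat CARD('p) ^ l) \<le> 1" if "i \<in> I" for i
    by (rule padic_approx_rational[of "\<xi> i" l]) (use le[OF that] l in \<open>auto simp: p_def\<close>)
  then obtain b where b: "\<And>i. i \<in> I \<Longrightarrow> padic_norm (\<xi> i - of_int (b i) / of_nat CARD('p) ^ l) \<le> 1"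
    by metis
  define \<beta> where "\<beta> = (of_int (b i0) / of_nat CARD('p) ^ l :: 'p padic)"
  have \<beta>: "padic_norm \<beta> = padic_norm (of_int (b i0) :: 'p padic) * real p ^ l"
    unfolding \<beta>_def p_def by (simp add: padic_norm_divide padic_norm_card_power)
  have nd: "\<not> int CARD('p) dvd b i0"
  proof
    assume "int CARD('p) dvd b i0"
    then have "padic_norm (of_int (b i0) :: 'p padic) \<le> 1 / real p"
      using padic_norm_of_int_le_iff[of "b i0" 1, where 'p = 'p] by (simp add: p_def)
    then have "padic_norm \<beta> \<le> 1 / real p * real p ^ l"
      unfolding \<beta> by (rule mult_right_mono) simp
    also have "\<dots> = real p ^ (l - 1)" using l1 p1 by (cases l) simp_all
    finally have "padic_norm \<beta> \<le> real p ^ (l - 1)" .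
    moreover have "1 \<le> real p ^ (l - 1)" using p1 by (intro one_le_power) simp
    then have "padic_norm (\<xi> i0 - \<beta>) \<le> real p ^ (l - 1)"
      using b[OF i0(1)] unfolding \<beta>_def by (rule order_trans[rotated])
    ultimately have "padic_norm ((\<xi> i0 - \<beta>) + \<beta>) \<le> real p ^ (l - 1)"
      using padic_norm_ultrametric[of "\<xi> i0 - \<beta>" \<beta>] by linarith
    then show False using gt' i0(2) by simp
  qed
  have "real p ^ l = padic_norm (\<xi> i0 + (\<beta> - \<xi> i0))" by (simp add: \<beta> padic_norm_of_int_unit[OF nd])
  also have "\<dots> \<le> max \<nu> 1"
    using padic_norm_ultrametric[of "\<xi> i0" "\<beta> - \<xi> i0"] b[OF i0(1)] padic_norm_diff_commute[of "\<xi> i0" \<beta>]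
    by (auto simp: i0(2) \<beta>_def)
  also have "\<dots> = \<nu>" using gt by (simp add: \<nu>_def)
  finally have "\<nu> = real p ^ l" using l by simp
  then show thesis
    using that[OF l1 _ b i0(1) nd] by (simp add: \<nu>_def p_def)
qed

text \<open>As \<open>q 0 > K j \<ge> j\<close>, the pairs are infinitely many. The error
  \<open>p^(- K (Suc j))\<close> is at most \<open>(p^(s j))^(-\<tau>)\<close>, and the pair has
  size at most \<open>p^(s j)\<close>. The integer matrix \<open>y\<close> may change with
  \<open>j\<close>.\<close>

lemma well_approximable_of_chain:
  fixes x :: "nat \<times> nat \<Rightarrow> 'p::prime_card padic" and K s :: "nat \<Rightarrow> nat"
  assumes m: "m \<ge> 1" and n: "n \<ge> 1" and \<tau>: "\<tau> > 0" and K: "strict_mono K"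
    and x: "x \<in> vecs ({..<m} \<times> {..<n})" "\<And>ij. ij \<in> {..<m} \<times> {..<n} \<Longrightarrow> padic_norm (x ij) \<le> 1"
    and s: "\<And>j. \<tau> * real (s j) \<le> real (K (Suc j))"
    and approx: "\<And>j. \<exists>y q r. (\<forall>ij\<in>{..<m} \<times> {..<n}. padic_norm (x ij - of_int (y ij)) \<le> 1 / real CARD('p) ^ K (Suc j)) \<and>
       q 0 > int (K j) \<and> (\<forall>j'<n. 0 \<le> q j' \<and> q j' \<le> int CARD('p) ^ s j) \<and> (\<forall>i<m. 0 \<le> r i \<and> r i \<le> int CARD('p) ^ s j) \<and>
       (\<forall>i<m. [(\<Sum>j'<n. y (i, j') * q j') = r i] (mod int CARD('p) ^ K (Suc j)))"
  shows "x \<in> well_approximable m n \<tau>"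
proof -
  define p where "p = CARD('p)"
  have p1: "real p > 1" using prime_card_gt_1[where 'p = 'p] by (simp add: p_def)
  define S where "S = {(q, r) \<in> vecs {..<n} \<times> vecs {..<m}.
          padic_vec_norm {..<m} (\<lambda>i. (\<Sum>j<n. x (i, j) * of_int (q j)) - of_int (r i))
            \<le> real_of_int (max (int_vec_norm {..<n} q) (int_vec_norm {..<m} r)) powr (- \<tau>)}"
  have "\<exists>y\<in>S. fst y 0 > int j" for j
  proof -
    obtain y q r where y: "\<And>ij. ij \<in> {..<m} \<times> {..<n} \<Longrightarrow> padic_norm (x ij - of_int (y ij)) \<le> 1 / real p ^ K (Suc j)"
      and q0: "q 0 > int (K j)" and q: "\<And>j'. j' < n \<Longrightarrow> 0 \<le> q j' \<and> q j' \<le> int p ^ s j"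
      and r: "\<And>i. i < m \<Longrightarrow> 0 \<le> r i \<and> r i \<le> int p ^ s j"
      and yq: "\<And>i. i < m \<Longrightarrow> [(\<Sum>j'<n. y (i, j') * q j') = r i] (mod int p ^ K (Suc j))"
      using approx[of j] unfolding p_def by blast
    define q' where "q' = restrict q {..<n}"
    define r' where "r' = restrict r {..<m}"
    define M where "M = max (int_vec_norm {..<n} q') (int_vec_norm {..<m} r')"
    have fin: "{..<m} \<noteq> {}" "{..<n} \<noteq> {}" using m n by (auto simp: lessThan_empty_iff)
    have Mq: "int_vec_norm {..<n} q' \<le> int p ^ s j"
      unfolding int_vec_norm_def using fin q by (intro Max.boundedI) (auto simp: q'_def)
    have Mr: "int_vec_norm {..<m} r' \<le> int p ^ s j"
      unfolding int_vec_norm_def using fin r by (intro Max.boundedI) (auto simp: r'_def)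
    have "\<bar>q' 0\<bar> \<le> int_vec_norm {..<n} q'"
      unfolding int_vec_norm_def using n by (intro Max_ge) auto
    \<comment> \<open>Positivity matters: \<open>0 powr (- \<tau>)\<close> is 0, so negative powers
      are antitone only away from 0.\<close>
    then have M1: "M \<ge> 1" using q0 n by (simp add: M_def q'_def)
    have Mle: "M \<le> int p ^ s j" using Mq Mr by (simp add: M_def)
    have "real_of_int M \<le> real_of_int (int p ^ s j)" using Mle by (simp only: of_int_le_iff)
    then have "real_of_int M \<le> real p powr real (s j)" using p1 by (simp add: powr_realpow)
    then have "(real p powr real (s j)) powr (- \<tau>) \<le> real_of_int M powr (- \<tau>)"
      using M1 \<tau> by (intro powr_mono2') auto
    moreover have "real p powr (- real (K (Suc j))) \<le> (real p powr real (s j)) powr (- \<tau>)"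
      unfolding powr_powr using p1 s[of j] by (intro powr_mono) (auto simp: mult.commute)
    ultimately have pow: "1 / real p ^ K (Suc j) \<le> real_of_int M powr (- \<tau>)"
      using p1 by (simp add: powr_minus powr_realpow inverse_eq_divide)
    have "padic_norm ((\<Sum>j'<n. x (i, j') * of_int (q' j')) - of_int (r' i)) \<le> 1 / real p ^ K (Suc j)" if i: "i < m" for i
    proof -
      have "padic_norm (\<Sum>j'<n. (x (i, j') - of_int (y (i, j'))) * of_int (q j')) \<le> 1 / real p ^ K (Suc j)"
      proof (rule padic_norm_sum_le)
        fix j' assume "j' \<in> {..<n}"
        then have "padic_norm (x (i, j') - of_int (y (i, j'))) * padic_norm (of_int (q j') :: 'p padic) \<le> 1 / real p ^ K (Suc j) * 1"
          using i by (intro mult_mono y padic_norm_of_int_le_1) (auto simp: padic_norm_nonneg)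
        then show "padic_norm ((x (i, j') - of_int (y (i, j'))) * of_int (q j')) \<le> 1 / real p ^ K (Suc j)"
          by (simp add: padic_norm_mult)
      qed auto
      moreover have "padic_norm (of_int ((\<Sum>j'<n. y (i, j') * q j') - r i) :: 'p padic) \<le> 1 / real p ^ K (Suc j)"
        unfolding p_def by (subst padic_norm_of_int_le_iff) (use yq[OF i] in \<open>simp add: cong_iff_dvd_diff p_def\<close>)
      moreover have "(\<Sum>j'<n. x (i, j') * of_int (q' j')) - of_int (r' i)
          = (\<Sum>j'<n. (x (i, j') - of_int (y (i, j'))) * of_int (q j')) + of_int ((\<Sum>j'<n. y (i, j') * q j') - r i)"
        using i by (simp add: q'_def r'_def left_diff_distrib sum_subtractf)
      ultimately show ?thesis
        using padic_norm_ultrametric[of "\<Sum>j'<n. (x (i, j') - of_int (y (i, j'))) * of_int (q j')"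
            "of_int ((\<Sum>j'<n. y (i, j') * q j') - r i)"] by simp
    qed
    then have "padic_vec_norm {..<m} (\<lambda>i. (\<Sum>j<n. x (i, j) * of_int (q' j)) - of_int (r' i)) \<le> real_of_int M powr (- \<tau>)"
      unfolding padic_vec_norm_def using fin(1) pow by (intro Max.boundedI) (auto intro: order_trans)
    then have "(q', r') \<in> S" by (simp add: S_def M_def q'_def r'_def)
    moreover have "j \<le> K j" by (rule strict_mono_imp_increasing[OF K])
    then have "fst (q', r') 0 > int j" using q0 n by (simp add: q'_def)
    ultimately show ?thesis by blast
  qed
  note unbounded = this
  have "infinite S"
  proof
    assume fin: "finite S"
    define B where "B = Max ((\<lambda>y. fst y 0) ` S)"
    obtain y where y: "y \<in> S" "fst y 0 > int (nat B)" using unbounded by blast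
    have "fst y 0 \<le> B" unfolding B_def using fin y(1) by (intro Max_ge) auto
    then show False using y(2) by linarith
  qed
  moreover have "x \<in> {..<m} \<times> {..<n} \<rightarrow>\<^sub>E {z. padic_norm z \<le> 1}"
    using x by (auto simp: PiE_iff)
  ultimately show ?thesis by (simp add: well_approximable_def S_def)
qed

text \<open>The bound concerns frequencies of norm above 1. On the unit ball the transform of a
  measure on integral matrices is 1, while the right-hand side tends to 0 with \<open>\<xi>\<close>,
  since \<open>n + 1 > n / \<tau>\<close>. The constant can be 1 because the choice of
  \<open>h\<close> in each step absorbs all others.\<close>

theorem theorem1p5p2:
  shows "\<exists>C>0. \<forall>m\<ge>1. \<forall>n\<ge>1. \<forall>\<tau>::real. \<tau> > (real m + real n) / real m \<longrightarrow>
    (\<exists>\<mu> :: (nat \<times> nat \<Rightarrow> 'p::prime_card padic) measure.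
       sets \<mu> = sets (borel_sigma (padic_vec_topology ({..<m} \<times> {..<n}))) \<and>
       prob_space \<mu> \<and>
       closed_support (padic_vec_topology ({..<m} \<times> {..<n})) \<mu> \<subseteq> well_approximable m n \<tau> \<and>
       (\<forall>\<xi> \<in> vecs ({..<m} \<times> {..<n}). padic_vec_norm ({..<m} \<times> {..<n}) \<xi> > 1 \<longrightarrow>
          cmod (padic_fourier ({..<m} \<times> {..<n}) \<mu> \<xi>)
            \<le> C * padic_vec_norm ({..<m} \<times> {..<n}) \<xi> powr (- real n / \<tau>)
                * ln (1 + padic_vec_norm ({..<m} \<times> {..<n}) \<xi>) ^ (n + 1)))"
proof (intro exI[of _ 1] conjI allI impI)
  fix m n :: nat and \<tau> :: real
  assume m: "1 \<le> m" and n: "1 \<le> n" and \<tau>': "(real m + real n) / real m < \<tau>"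
  define p where "p = CARD('p)"
  have p: "prime p" unfolding p_def by (rule prime_card)
  define I where "I = {..<m} \<times> {..<n}"
  have I: "finite I" "I \<noteq> {}" using m n by (auto simp: I_def lessThan_empty_iff)
  have "1 \<le> (real m + real n) / real m" using m by (simp add: field_simps)
  then have \<tau>: "\<tau> > 1" using \<tau>' by simp
  have "\<exists>z. case z of (k, N, s, G) \<Rightarrow> refinement_step p m n \<tau> K k N s G" for K
    using refinement_step_exists[OF p n \<tau>, of m K] by auto
  then obtain z where z: "\<And>K. case z K of (k, N, s, G) \<Rightarrow> refinement_step p m n \<tau> K k N s G" by metis
  \<comment> \<open>Level 0 with the zero matrix: closeness at that level says that the entries lie
    in the unit ball.\<close>
  define K where "K = rec_nat 0 (\<lambda>_ k. fst (z k))"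
  have K0: "K 0 = 0" and KSuc: "K (Suc j) = fst (z (K j))" for j by (simp_all add: K_def)
  define N where "N j = fst (snd (z (K j)))" for j
  define s where "s j = fst (snd (snd (z (K j))))" for j
  define G where "G j = snd (snd (snd (z (K j))))" for j
  have step: "refinement_step p m n \<tau> (K j) (K (Suc j)) (N j) (s j) (G j)" for j
    using z[of "K j"] by (simp add: KSuc N_def s_def G_def case_prod_unfold)
  have K: "strict_mono K" using step by (simp add: strict_mono_Suc_iff refinement_step_def)
  have N: "N j > 0" for j using step by (simp add: refinement_step_def)
  have G: "[G j x u i = x i] (mod int CARD('p) ^ K j)" for j x u i
    using step[of j] unfolding refinement_step_def p_def by blast
  obtain \<mu> :: "(nat \<times> nat \<Rightarrow> 'p padic) measure" where
    \<mu>: "sets \<mu> = sets (borel_sigma (padic_vec_topology I))" "prob_space \<mu>"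
    and supp: "\<And>x. x \<in> closed_support (padic_vec_topology I) \<mu> \<Longrightarrow> x \<in> vecs I \<and>
       (\<forall>j. \<exists>\<omega>. \<forall>i\<in>I. padic_norm (x i - of_int (chain G \<omega> j i)) \<le> 1 / real CARD('p) ^ K j)"
    and four: "\<And>\<xi> b l j B. (\<forall>i\<in>I. padic_norm (\<xi> i - of_int (b i) / of_nat CARD('p) ^ l) \<le> 1) \<Longrightarrow> l \<le> K (Suc j) \<Longrightarrow>
       (\<forall>x. cmod (\<Sum>u<N j. unit_char (of_int (\<Sum>i\<in>I. G j x u i * b i) / real CARD('p) ^ l)) \<le> real (N j) * B) \<Longrightarrow>
       cmod (padic_fourier I \<mu> \<xi>) \<le> B"
    using chain_measure_exists[where 'p = 'p and I = I and K = K and N = N and G = G, OF I(1) K N G] by blast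
  have support: "closed_support (padic_vec_topology I) \<mu> \<subseteq> well_approximable m n \<tau>"
  proof
    fix x assume x: "x \<in> closed_support (padic_vec_topology I) \<mu>"
    have near: "\<exists>\<omega>. \<forall>i\<in>I. padic_norm (x i - of_int (chain G \<omega> j i)) \<le> 1 / real CARD('p) ^ K j" for j
      using supp[OF x] by blast
    show "x \<in> well_approximable m n \<tau>"
    proof (rule well_approximable_of_chain[OF m n _ K])
      show "x \<in> vecs ({..<m} \<times> {..<n})" using supp[OF x] by (simp add: I_def)
      show "padic_norm (x ij) \<le> 1" if "ij \<in> {..<m} \<times> {..<n}" for ij
        using near[of 0] that by (auto simp: K0 I_def)
      show "\<tau> * real (s j) \<le> real (K (Suc j))" for j using step[of j] by (simp add: refinement_step_def)
      fix j
      obtain \<omega> where \<omega>: "\<forall>i\<in>I. padic_norm (x i - of_int (chain G \<omega> (Suc j) i)) \<le> 1 / real CARD('p) ^ K (Suc j)"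
        using near by blast
      have "\<exists>q r. q 0 > int (K j) \<and> (\<forall>j'<n. 0 \<le> q j' \<and> q j' \<le> int p ^ s j) \<and> (\<forall>i<m. 0 \<le> r i \<and> r i \<le> int p ^ s j) \<and>
          (\<forall>i<m. [(\<Sum>j'<n. chain G \<omega> (Suc j) (i, j') * q j') = r i] (mod int p ^ K (Suc j)))"
        using step[of j] by (simp add: refinement_step_def)
      then show "\<exists>y q r. (\<forall>ij\<in>{..<m} \<times> {..<n}. padic_norm (x ij - of_int (y ij)) \<le> 1 / real CARD('p) ^ K (Suc j)) \<and>
         q 0 > int (K j) \<and> (\<forall>j'<n. 0 \<le> q j' \<and> q j' \<le> int CARD('p) ^ s j) \<and> (\<forall>i<m. 0 \<le> r i \<and> r i \<le> int CARD('p) ^ s j) \<and>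
         (\<forall>i<m. [(\<Sum>j'<n. y (i, j') * q j') = r i] (mod int CARD('p) ^ K (Suc j)))"
        using \<omega> unfolding I_def p_def by blast
    qed (use \<tau> in simp)
  qed
  have decay: "cmod (padic_fourier I \<mu> \<xi>) \<le> 1 * padic_vec_norm I \<xi> powr (- real n / \<tau>) * ln (1 + padic_vec_norm I \<xi>) ^ (n + 1)"
    if gt: "padic_vec_norm I \<xi> > 1" for \<xi>
  proof -
    obtain l b i where l: "l \<ge> 1" and norm: "padic_vec_norm I \<xi> = real CARD('p) ^ l"
      and b: "\<And>i. i \<in> I \<Longrightarrow> padic_norm (\<xi> i - of_int (b i) / of_nat CARD('p) ^ l) \<le> 1"
      and i: "i \<in> I" "\<not> int CARD('p) dvd b i"
      using padic_vec_rational_part[OF I gt] by blast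
    \<comment> \<open>Since \<open>K 0 = 0 < l\<close>, this \<open>j\<close> is a successor, and
      its predecessor is the step whose levels enclose \<open>l\<close>.\<close>
    define j where "j = (LEAST j. l \<le> K j)"
    have "l \<le> K l" by (rule strict_mono_imp_increasing[OF K])
    then have lj: "l \<le> K j" unfolding j_def by (rule LeastI)
    then obtain j' where j': "j = Suc j'" using l K0 by (cases j) auto
    have "\<not> l \<le> K j'" unfolding j_def[symmetric] by (rule not_less_Least[of j' "\<lambda>j. l \<le> K j", folded j_def]) (simp add: j')
    then have lj': "K j' < l" by simp
    have ex: "\<exists>i<m. \<exists>j<n. \<not> int p dvd b (i, j)" using i by (auto simp: I_def p_def)
    have "\<forall>x. cmod (\<Sum>u<N j'. unit_char (of_int (\<Sum>i\<in>I. G j' x u i * b i) / real p ^ l))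
        \<le> real (N j') * ((real p ^ l) powr (- real n / \<tau>) * ln (1 + real p ^ l) ^ (n + 1))"
      using step[of j'] ex lj lj' unfolding refinement_step_def I_def j' by blast
    then have "cmod (padic_fourier I \<mu> \<xi>) \<le> (real p ^ l) powr (- real n / \<tau>) * ln (1 + real p ^ l) ^ (n + 1)"
      using b lj unfolding p_def j' by (intro four[of \<xi> b l j']) blast+
    then show ?thesis by (simp add: norm p_def)
  qed
  show "\<exists>\<mu> :: (nat \<times> nat \<Rightarrow> 'p padic) measure.
       sets \<mu> = sets (borel_sigma (padic_vec_topology ({..<m} \<times> {..<n}))) \<and>
       prob_space \<mu> \<and>
       closed_support (padic_vec_topology ({..<m} \<times> {..<n})) \<mu> \<subseteq> well_approximable m n \<tau> \<and>
       (\<forall>\<xi> \<in> vecs ({..<m} \<times> {..<n}). padic_vec_norm ({..<m} \<times> {..<n}) \<xi> > 1 \<longrightarrow>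
          cmod (padic_fourier ({..<m} \<times> {..<n}) \<mu> \<xi>)
            \<le> 1 * padic_vec_norm ({..<m} \<times> {..<n}) \<xi> powr (- real n / \<tau>)
                * ln (1 + padic_vec_norm ({..<m} \<times> {..<n}) \<xi>) ^ (n + 1))"
    using \<mu> support decay unfolding I_def by blast
qed simp

end
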